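(* Assume that $\Phi$ is either strictly convex or strictly concave. For any $p\in(\tfrac12,1]$, any $\alpha\in\mathbb R_+$ and any $\theta\in(0,1)$, $$\liminf_{\substack{N\to\infty\\ k/N\to\alpha}}\frac{T^{N,k}_{\mathrm{mix}}(\theta)}{N}\ \ge\ T_{eq,p,\alpha}.$$
   Context: Rate function: $g:\mathbb N\to[0,\infty)$, $\mathbb N=\{0,1,2,\dots\}$, is non-decreasing with $g(0)=0<g(1)$, Lipschitz, i.e. $g^\star:=\sup_{k\ge0}|g(k+1)-g(k)|<\infty$. Put $g(k)!=g(k)g(k-1)\cdots g(1)$ ($g(0)!=1$), $Z(\varphi)=\sum_{k\ge 0}\varphi^k/g(k)!$, with radius of convergence $\varphi^\star$; it is assumed that $\lim_{\varphi\uparrow\varphi^\star}Z(\varphi)=\infty$. For $0\le\varphi<\varphi^\star$, $\bar\nu_\varphi(k)=\frac1{Z(\varphi)}\frac{\varphi^k}{g(k)!}$ is a probability on $\mathbb N$. The flux $\Phi:[0,\infty)\to[0,\varphi^\star)$ is the inverse of $\varphi\mapsto \mathbb E_{\bar\nu_\varphi}(X)$. Process: $\Omega^0_{N,k}=\{\eta\in\mathbb N^{\{1,\dots,N\}}:\sum_i\eta(i)=k\}$, $k\geq1$. The ZRP$(g,p)$ on $\{1,\dots,N\}$, $q=1-p$, is the continuous-time Markov chain on $\Omega^0_{N,k}$ with generator $$\mathcal A_NJ(\eta)=\sum_{i=1}^{N-1}p\,g(\eta(i))(J(\eta^{i,i+1})-J(\eta))+\sum_{i=2}^{N}q\,g(\eta(i))(J(\eta^{i,i-1})-J(\eta)),$$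 where $\eta^{x,y}$ is obtained from $\eta$ by moving one particle from $x$ to $y$. $\pi_{N,k}$ is its equilibrium (invariant) probability, $\pi_{N,k}(\eta)\propto\prod_{y=1}^N (p/q)^{\eta(y)y}/g(\eta(y))!$ (for $p=1$, the Dirac mass at the configuration with all $k$ particles at site $N$). $P^\eta_t$ is the law at time $t$ of the process started at $\eta$; $d_{N,k}(t)=\max_{\eta\in\Omega^0_{N,k}}\|P^\eta_t-\pi_{N,k}\|_{\mathrm{TV}}$; $T^{N,k}_{\mathrm{mix}}(\theta)=\inf\{t\ge0:d_{N,k}(t)\le\theta\}$. The limit is along any sequence $k=k_N\ge1$ with $k_N/N\to\alpha$. Macroscopic equilibrium time: for $\alpha\ge0$, $U^\alpha$ is the unique Barron--Jensen viscosity solution of $\partial_tU+\Phi(\partial_xU)=0$ on $[0,\infty)\times\mathbb R$ with initial datum the c.d.f. of $\alpha\delta_0$, and $$T_{eq,p,\alpha}=\frac1{p-q}\inf\{t>0:\ U^\alpha(t,x)\le\alpha\mathbf 1_{x>1}\ \text{for all }x\in\mathbb R\}.$$ Barron--Jensen solutions: if $\Phi$ is strictly convex, a bounded lower semicontinuous $U$ on $[0,\infty)\times\mathbb R$ is a Barron--Jensen solution of $\partial_tU+\Phi(\partial_xU)=0$ if for every $C^1$ function $\varphi$ and every minimum point $(t_0,x_0)\in(0,\infty)\times\mathbb R$ of $U-\varphi$ one has $\partial_t\varphi(t_0,x_0)+\Phi(\partial_x\varphi(t_0,x_0))=0$. If $\Phi$ is strictly concave, replace lower by upper semicontinuous and minimum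 by maximum. For initial datum the c.d.f. of a finite measure $u_0$, the unique such solution is given by the Hopf--Lax formula (which may be taken as the definition of $U$): for $t>0$, - $\Phi$ strictly convex: $U(t,x)=\inf_{y\in\mathbb R}\big(u_0((-\infty,y))+t\Psi(\tfrac{x-y}{t})\big)$, $\Psi(s)=\sup_{a\ge0}(as-\Phi(a))$; - $\Phi$ strictly concave: $U(t,x)=\sup_{y\in\mathbb R}\big(u_0((-\infty,y])-t\Psi(-\tfrac{x-y}{t})\big)$, $\Psi(s)=\sup_{a\ge0}(as+\Phi(a))$. *)

theory Defs
  imports "HOL-Probability.Probability"
begin

section \<open>Rate function, grand canonical measures and flux\<close>

definition rate_function :: "(nat \<Rightarrow> real) \<Rightarrow> bool" where
  "rate_function g \<longleftrightarrow> mono g \<and> g 0 = 0 \<and> 0 < g 1 \<and>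
     bdd_above (range (\<lambda>k. \<bar>g (Suc k) - g k\<bar>))"

definition g_fact :: "(nat \<Rightarrow> real) \<Rightarrow> nat \<Rightarrow> real" where
  "g_fact g k = (\<Prod>i\<in>{1..k}. g i)"

definition partition_fun :: "(nat \<Rightarrow> real) \<Rightarrow> real \<Rightarrow> real" where
  "partition_fun g \<phi> = (\<Sum>k. \<phi> ^ k / g_fact g k)"

text \<open>The radius of convergence may be infinite, hence an extended real.\<close>

definition phi_star :: "(nat \<Rightarrow> real) \<Rightarrow> ereal" where
  "phi_star g = conv_radius (\<lambda>k. 1 / g_fact g k)"

definition nu_bar :: "(nat \<Rightarrow> real) \<Rightarrow> real \<Rightarrow> nat \<Rightarrow> real" where
  "nu_bar g \<phi> k = 1 / partition_fun g \<phi> * (\<phi> ^ k / g_fact g k)"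

definition mean_density :: "(nat \<Rightarrow> real) \<Rightarrow> real \<Rightarrow> real" where
  "mean_density g \<phi> = (\<Sum>k. real k * nu_bar g \<phi> k)"

definition flux :: "(nat \<Rightarrow> real) \<Rightarrow> real \<Rightarrow> real" where
  "flux g = the_inv_into {\<phi>. 0 \<le> \<phi> \<and> ereal \<phi> < phi_star g} (mean_density g)"

definition strictly_convex_on :: "real set \<Rightarrow> (real \<Rightarrow> real) \<Rightarrow> bool" where
  "strictly_convex_on S f \<longleftrightarrow> convex S \<and>
     (\<forall>x\<in>S. \<forall>y\<in>S. \<forall>u v. x \<noteq> y \<longrightarrow> 0 < u \<longrightarrow> 0 < v \<longrightarrow> u + v = 1 \<longrightarrow>
        f (u * x + v * y) < u * f x + v * f y)"

definition strictly_concave_on :: "real set \<Rightarrow> (real \<Rightarrow> real) \<Rightarrow> bool" where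
  "strictly_concave_on S f \<longleftrightarrow> strictly_convex_on S (\<lambda>x. - f x)"


section \<open>The zero range process on a segment\<close>

text \<open>Configurations are extensional functions, i.e. equal to \<open>undefined\<close> outside \<open>{1..N}\<close>.\<close>

definition zrp_configs :: "nat \<Rightarrow> nat \<Rightarrow> (nat \<Rightarrow> nat) set" where
  "zrp_configs N k = {\<eta> \<in> {1..N} \<rightarrow>\<^sub>E UNIV. (\<Sum>i\<in>{1..N}. \<eta> i) = k}"

text \<open>Only used for \<open>x \<noteq> y\<close>. The truncated subtraction is harmless: in the generator,
  moves out of an empty site are multiplied by \<open>g 0 = 0\<close>.\<close>

definition move :: "nat \<Rightarrow> nat \<Rightarrow> (nat \<Rightarrow> nat) \<Rightarrow> (nat \<Rightarrow> nat)" where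
  "move x y \<eta> = \<eta>(x := \<eta> x - 1, y := \<eta> y + 1)"

definition zrp_generator ::
  "(nat \<Rightarrow> real) \<Rightarrow> real \<Rightarrow> nat \<Rightarrow> ((nat \<Rightarrow> nat) \<Rightarrow> real) \<Rightarrow> (nat \<Rightarrow> nat) \<Rightarrow> real" where
  "zrp_generator g p N J \<eta> =
     (\<Sum>i\<in>{1..N - 1}. p * g (\<eta> i) * (J (move i (i + 1) \<eta>) - J \<eta>)) +
     (\<Sum>i\<in>{2..N}. (1 - p) * g (\<eta> i) * (J (move i (i - 1) \<eta>) - J \<eta>))"

text \<open>The Markov semigroup \<open>exp (t * A)\<close>. On the configurations with \<open>k\<close> particles, a finite
  set left invariant by the dynamics, the generator is a bounded operator and the exponential
  series converges.\<close>

definition zrp_semigroup ::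
  "(nat \<Rightarrow> real) \<Rightarrow> real \<Rightarrow> nat \<Rightarrow> real \<Rightarrow> ((nat \<Rightarrow> nat) \<Rightarrow> real) \<Rightarrow> (nat \<Rightarrow> nat) \<Rightarrow> real" where
  "zrp_semigroup g p N t J \<eta> = (\<Sum>n. t ^ n / fact n * (zrp_generator g p N ^^ n) J \<eta>)"

text \<open>The law at time \<open>t\<close> of the process started at \<open>\<eta>\<close>.\<close>

definition zrp_law ::
  "(nat \<Rightarrow> real) \<Rightarrow> real \<Rightarrow> nat \<Rightarrow> nat \<Rightarrow> (nat \<Rightarrow> nat) \<Rightarrow> real \<Rightarrow> (nat \<Rightarrow> nat) measure" where
  "zrp_law g p N k \<eta> t =
     point_measure (zrp_configs N k) (\<lambda>\<xi>. ennreal (zrp_semigroup g p N t (indicat_real {\<xi>}) \<eta>))"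

definition equilibrium_weight ::
  "(nat \<Rightarrow> real) \<Rightarrow> real \<Rightarrow> nat \<Rightarrow> (nat \<Rightarrow> nat) \<Rightarrow> real" where
  "equilibrium_weight g p N \<eta> = (\<Prod>y\<in>{1..N}. (p / (1 - p)) ^ (\<eta> y * y) / g_fact g (\<eta> y))"

definition zrp_equilibrium ::
  "(nat \<Rightarrow> real) \<Rightarrow> real \<Rightarrow> nat \<Rightarrow> nat \<Rightarrow> (nat \<Rightarrow> nat) measure" where
  "zrp_equilibrium g p N k =
     (if p = 1
      then return (count_space (zrp_configs N k)) (\<lambda>i\<in>{1..N}. if i = N then k else 0)
      else point_measure (zrp_configs N k)
             (\<lambda>\<eta>. ennreal (equilibrium_weight g p N \<eta> /
                           (\<Sum>\<xi>\<in>zrp_configs N k. equilibrium_weight g p N \<xi>))))"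

definition tv_dist :: "'a measure \<Rightarrow> 'a measure \<Rightarrow> real" where
  "tv_dist M M' = (SUP A\<in>sets M. \<bar>measure M A - measure M' A\<bar>)"

definition mixing_dist :: "(nat \<Rightarrow> real) \<Rightarrow> real \<Rightarrow> nat \<Rightarrow> nat \<Rightarrow> real \<Rightarrow> real" where
  "mixing_dist g p N k t =
     Max ((\<lambda>\<eta>. tv_dist (zrp_law g p N k \<eta> t) (zrp_equilibrium g p N k)) ` zrp_configs N k)"

definition mixing_time :: "(nat \<Rightarrow> real) \<Rightarrow> real \<Rightarrow> nat \<Rightarrow> nat \<Rightarrow> real \<Rightarrow> ereal" where
  "mixing_time g p N k \<theta> = (INF t\<in>{t. 0 \<le> t \<and> mixing_dist g p N k t \<le> \<theta>}. ereal t)"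


section \<open>Macroscopic equilibrium time\<close>

text \<open>The Legendre-type transforms below may be infinite, so the Hopf-Lax formulas take values in
  the extended reals. Since \<open>\<Phi> 0 = 0\<close> the transforms are nonnegative, and no sum of
  infinities of opposite signs occurs.\<close>

definition legendre_convex :: "(real \<Rightarrow> real) \<Rightarrow> real \<Rightarrow> ereal" where
  "legendre_convex \<Phi> s = (SUP a\<in>{0..}. ereal (a * s - \<Phi> a))"

definition legendre_concave :: "(real \<Rightarrow> real) \<Rightarrow> real \<Rightarrow> ereal" where
  "legendre_concave \<Phi> s = (SUP a\<in>{0..}. ereal (a * s + \<Phi> a))"

text \<open>The Barron-Jensen solution at positive times \<open>t\<close> of \<open>\<partial>\<^sub>t U + \<Phi>(\<partial>\<^sub>x U) = 0\<close>
  whose initial datum is the c.d.f. of \<open>\<mu>\<close>, for \<open>\<Phi>\<close> strictly convex or strictly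
  concave on the half-line, given by the Hopf-Lax formula.\<close>

definition hopf_lax :: "(real \<Rightarrow> real) \<Rightarrow> real measure \<Rightarrow> real \<Rightarrow> real \<Rightarrow> ereal" where
  "hopf_lax \<Phi> \<mu> t x =
     (if strictly_convex_on {0..} \<Phi>
      then (INF y. ereal (measure \<mu> {..<y}) + ereal t * legendre_convex \<Phi> ((x - y) / t))
      else (SUP y. ereal (measure \<mu> {..y}) - ereal t * legendre_concave \<Phi> (- ((x - y) / t))))"

definition macro_solution :: "(nat \<Rightarrow> real) \<Rightarrow> real \<Rightarrow> real \<Rightarrow> real \<Rightarrow> ereal" where
  "macro_solution g \<alpha> = hopf_lax (flux g) (scale_measure (ennreal \<alpha>) (return borel 0))"

definition macro_eq_time :: "(nat \<Rightarrow> real) \<Rightarrow> real \<Rightarrow> real \<Rightarrow> ereal" where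
  "macro_eq_time g p \<alpha> =
     ereal (1 / (p - (1 - p))) *
     (INF t\<in>{t. 0 < t \<and> (\<forall>x. macro_solution g \<alpha> t x \<le> ereal (\<alpha> * indicat_real {1<..} x))}. ereal t)"

end

theory Submission
  imports Defs
begin

text \<open>The lower bound on the mixing time comes from one event: some particle still sits in a left part
\<open>{1..m}\<close> of the segment, with \<open>m \<le> (1 - \<delta>) N\<close>. In equilibrium the current through every bond
vanishes, so the occupation decays geometrically away from the right end and the event has
vanishing probability (\<open>equilibrium_left_empty\<close>). What is left is to find, for every macroscopic time
before the equilibrium time, an initial configuration from which \<open>{1..m}\<close> is not emptied by then,
with probability tending to one; then the total variation distance exceeds every \<open>\<theta> < 1\<close>.

Attractiveness simplifies this task. Particles entering \<open>{1..m}\<close> from the right only help, so the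
process may be replaced by one on \<open>{1..m}\<close> from which particles at \<open>m\<close> exit for good
(\<open>segment_le_emptying_prob\<close>); and particles of the initial configuration that are not wanted can be
parked at site \<open>N\<close>.

\<^bold>\<open>Convex flux.\<close> Here \<open>\<Phi> a \<ge> g 1 * a\<close>, hence the macroscopic solution is in equilibrium as soon as
the slowest particles, whose speed is \<open>(2 p - 1) * g 1\<close>, have crossed the segment. A single particle
started at site \<open>1\<close> is a random walk with this drift (\<open>single_particle_emptying_prob\<close>).

\<^bold>\<open>Concave flux.\<close> Let time be measured in units in which the drift \<open>2 p - 1\<close> is one. By the Hopf--Lax
formula, \<open>t * \<phi> < \<alpha> + mean_density g \<phi>\<close> for every fugacity \<open>\<phi>\<close> if \<open>t\<close> is before the equilibrium time.
Macroscopically, an observer who moves with speed \<open>1 / t\<close> is overtaken by the mass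
\<open>\<Phi> u - u / t \<le> \<alpha> / t\<close> per unit time whatever the local density \<open>u\<close>, so within a time less than \<open>t\<close> the
mass \<open>\<alpha>\<close> cannot all overtake an observer who starts next to it. The
microscopic counterpart needs the local density and the local current to be related by \<open>\<Phi>\<close>, that is,
local equilibrium. This is obtained by an exponential moment method. The weighted \<open>L\<^sup>2\<close> norm of the
emptying probability, tilted by \<open>exp (lam * (mass behind the front))\<close>, satisfies a differential
inequality (\<open>front_form_bound\<close>). On a block of \<open>l\<close> sites its right-hand side contains the excess
\<open>\<Sum>x. \<gamma> * g (\<xi> x) - \<xi> x\<close>, which need not be small for a given configuration, with a factor of order
\<open>1 / N\<close>, and the negative of a Dirichlet form with a factor of order one. So the function may be
regarded as constant on configurations of the block with the same number \<open>K\<close> of particles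
(\<open>sector_inequality\<close>), and only the canonical mean of \<open>g\<close> matters. This mean is compared with
\<open>\<Phi> (K / l)\<close> in \<open>canonical_rate_bound\<close>: the canonical partition functions are log-concave, so the
grand canonical law of \<open>K\<close> at a fugacity slightly below the canonical mean rate has a geometric tail
beyond \<open>K\<close>. Since \<open>lam\<close> can be taken large, the resulting Gronwall bound \<open>emptying_prob_bound\<close> beats
the entropy of the initial configuration, which is of order \<open>N\<close> if the particles are spread in piles
of fixed height over a small fraction of the sites.\<close>

section \<open>Markov jump processes\<close>

definition jump_gen ::
  "'i set \<Rightarrow> ('i \<Rightarrow> 's \<Rightarrow> real) \<Rightarrow> ('i \<Rightarrow> 's \<Rightarrow> 's) \<Rightarrow> ('s \<Rightarrow> real) \<Rightarrow> 's \<Rightarrow> real" where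
  "jump_gen I c T J \<eta> = (\<Sum>i\<in>I. c i \<eta> * (J (T i \<eta>) - J \<eta>))"

definition gen_exp :: "(('s \<Rightarrow> real) \<Rightarrow> 's \<Rightarrow> real) \<Rightarrow> real \<Rightarrow> ('s \<Rightarrow> real) \<Rightarrow> 's \<Rightarrow> real" where
  "gen_exp A t J \<eta> = (\<Sum>n. t ^ n / fact n * (A ^^ n) J \<eta>)"

lemma jump_gen_linear_combination:
  "jump_gen I c T (\<lambda>x. a * J x + b * K x) \<eta> = a * jump_gen I c T J \<eta> + b * jump_gen I c T K \<eta>"
  unfolding jump_gen_def sum_distrib_left sum.distrib[symmetric]
  by (intro sum.cong refl) (simp add: algebra_simps)

lemma jump_gen_sum:
  "jump_gen I c T (\<lambda>x. \<Sum>j\<in>S. a j * J j x) \<eta> = (\<Sum>j\<in>S. a j * jump_gen I c T (J j) \<eta>)"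
proof (induction S rule: infinite_finite_induct)
  case (insert j S)
  have "jump_gen I c T (\<lambda>x. \<Sum>j\<in>insert j S. a j * J j x) \<eta> =
        jump_gen I c T (\<lambda>x. a j * J j x + 1 * (\<Sum>j\<in>S. a j * J j x)) \<eta>"
    using insert by simp
  also have "\<dots> = (\<Sum>j\<in>insert j S. a j * jump_gen I c T (J j) \<eta>)"
    unfolding jump_gen_linear_combination using insert by simp
  finally show ?case .
qed (simp_all add: jump_gen_def)

lemma jump_gen_funpow_sum:
  "(jump_gen I c T ^^ n) (\<lambda>x. \<Sum>j\<in>S. J j x) \<eta> = (\<Sum>j\<in>S. (jump_gen I c T ^^ n) (J j) \<eta>)"
proof (induction n arbitrary: \<eta>)
  case (Suc n)
  have "(jump_gen I c T ^^ n) (\<lambda>x. \<Sum>j\<in>S. J j x) = (\<lambda>x. \<Sum>j\<in>S. 1 * (jump_gen I c T ^^ n) (J j) x)"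
    using Suc by auto
  then show ?case by (simp add: jump_gen_sum[of I c T "\<lambda>_. 1", simplified])
qed simp

text \<open>The transition operator of the discrete skeleton of a jump process observed at the times of a
Poisson process of rate \<open>\<Lambda>\<close>. Inequalities between semigroups are proved for its powers by
induction and carried over by \<open>uniformization\<close> below.\<close>

definition uniformized :: "real \<Rightarrow> (('s \<Rightarrow> real) \<Rightarrow> 's \<Rightarrow> real) \<Rightarrow> ('s \<Rightarrow> real) \<Rightarrow> 's \<Rightarrow> real" where
  "uniformized \<Lambda> A J \<eta> = J \<eta> + A J \<eta> / \<Lambda>"

locale jump_process =
  fixes I :: "'i set" and c :: "'i \<Rightarrow> 's \<Rightarrow> real" and T :: "'i \<Rightarrow> 's \<Rightarrow> 's"
    and X :: "'s set" and \<Lambda> :: real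
  assumes finite_X: "finite X"
    and rate_nonneg: "\<And>i \<eta>. i \<in> I \<Longrightarrow> \<eta> \<in> X \<Longrightarrow> 0 \<le> c i \<eta>"
    and closed: "\<And>i \<eta>. i \<in> I \<Longrightarrow> \<eta> \<in> X \<Longrightarrow> c i \<eta> \<noteq> 0 \<Longrightarrow> T i \<eta> \<in> X"
    and rate_le: "\<And>\<eta>. \<eta> \<in> X \<Longrightarrow> (\<Sum>i\<in>I. c i \<eta>) \<le> \<Lambda>"
    and rate_pos: "0 < \<Lambda>"
begin

abbreviation "A \<equiv> jump_gen I c T"
abbreviation "P \<equiv> gen_exp A"
abbreviation "Q \<equiv> uniformized \<Lambda> A"

lemma gen_bound:
  assumes "\<And>\<eta>. \<eta> \<in> X \<Longrightarrow> \<bar>J \<eta>\<bar> \<le> M" "\<eta> \<in> X"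
  shows "\<bar>A J \<eta>\<bar> \<le> 2 * \<Lambda> * M"
proof -
  have M: "0 \<le> M" using assms(1)[OF assms(2)] by linarith
  have "\<bar>A J \<eta>\<bar> \<le> (\<Sum>i\<in>I. \<bar>c i \<eta> * (J (T i \<eta>) - J \<eta>)\<bar>)"
    unfolding jump_gen_def by (rule sum_abs)
  also have "\<dots> \<le> (\<Sum>i\<in>I. c i \<eta> * (2 * M))"
  proof (rule sum_mono)
    fix i assume i: "i \<in> I"
    show "\<bar>c i \<eta> * (J (T i \<eta>) - J \<eta>)\<bar> \<le> c i \<eta> * (2 * M)"
    proof (cases "c i \<eta> = 0")
      case False
      then have "\<bar>J (T i \<eta>)\<bar> \<le> M" "\<bar>J \<eta>\<bar> \<le> M"
        using assms closed[OF i assms(2)] by auto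
      then have "\<bar>J (T i \<eta>) - J \<eta>\<bar> \<le> 2 * M" by linarith
      then show ?thesis
        using rate_nonneg[OF i assms(2)] by (simp add: abs_mult mult_left_mono)
    qed simp
  qed
  also have "\<dots> = (\<Sum>i\<in>I. c i \<eta>) * (2 * M)" by (simp add: sum_distrib_right)
  also have "\<dots> \<le> \<Lambda> * (2 * M)"
    using rate_le[OF assms(2)] M by (intro mult_right_mono) auto
  finally show ?thesis by (simp add: mult_ac)
qed

lemma gen_power_bound:
  assumes "\<And>\<eta>. \<eta> \<in> X \<Longrightarrow> \<bar>J \<eta>\<bar> \<le> M" "\<eta> \<in> X"
  shows "\<bar>(A ^^ n) J \<eta>\<bar> \<le> (2 * \<Lambda>) ^ n * M"
  using assms(2)
proof (induction n arbitrary: \<eta>)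
  case (Suc n)
  have "\<bar>A ((A ^^ n) J) \<eta>\<bar> \<le> 2 * \<Lambda> * ((2 * \<Lambda>) ^ n * M)"
    by (rule gen_bound) (use Suc in auto)
  then show ?case by (simp add: mult_ac)
qed (use assms in auto)

lemma bounded_on_states: obtains M where "\<And>\<eta>. \<eta> \<in> X \<Longrightarrow> \<bar>J \<eta> :: real\<bar> \<le> M"
proof -
  have "\<bar>J \<eta>\<bar> \<le> (\<Sum>\<xi>\<in>X. \<bar>J \<xi>\<bar>)" if "\<eta> \<in> X" for \<eta>
    using member_le_sum[OF that, of "\<lambda>\<xi>. \<bar>J \<xi>\<bar>"] finite_X by auto
  then show ?thesis using that by blast
qed

lemma semigroup_abs_summable:
  assumes "\<eta> \<in> X"
  shows "summable (\<lambda>n. \<bar>t ^ n / fact n * (A ^^ n) J \<eta>\<bar>)"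
proof -
  obtain M where M: "\<And>\<eta>. \<eta> \<in> X \<Longrightarrow> \<bar>J \<eta>\<bar> \<le> M" using bounded_on_states by blast
  have "summable (\<lambda>n. M * (inverse (fact n) * (2 * \<Lambda> * \<bar>t\<bar>) ^ n))"
    by (intro summable_mult summable_exp)
  then show ?thesis
  proof (rule summable_comparison_test'[of _ 0])
    fix n
    have "\<bar>t ^ n / fact n * (A ^^ n) J \<eta>\<bar> = \<bar>t\<bar> ^ n / fact n * \<bar>(A ^^ n) J \<eta>\<bar>"
      by (simp add: abs_mult power_abs)
    also have "\<dots> \<le> \<bar>t\<bar> ^ n / fact n * ((2 * \<Lambda>) ^ n * M)"
      by (intro mult_left_mono gen_power_bound M assms) auto
    finally show "norm \<bar>t ^ n / fact n * (A ^^ n) J \<eta>\<bar> \<le> M * (inverse (fact n) * (2 * \<Lambda> * \<bar>t\<bar>) ^ n)"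
      by (simp add: field_simps power_mult_distrib)
  qed
qed

lemma semigroup_summable:
  assumes "\<eta> \<in> X"
  shows "summable (\<lambda>n. t ^ n / fact n * (A ^^ n) J \<eta>)"
  using semigroup_abs_summable[OF assms] by (rule summable_rabs_cancel)

lemma semigroup_sum:
  assumes "\<eta> \<in> X"
  shows "P t (\<lambda>x. \<Sum>j\<in>S. J j x) \<eta> = (\<Sum>j\<in>S. P t (J j) \<eta>)"
  unfolding gen_exp_def jump_gen_funpow_sum sum_distrib_left
  by (rule suminf_sum) (rule semigroup_summable[OF assms])

lemma semigroup_has_derivative:
  assumes "\<eta> \<in> X"
  shows "((\<lambda>t. P t J \<eta>) has_real_derivative A (P t J) \<eta>) (at t)"
proof -
  define a where "a = (\<lambda>n. (A ^^ n) J \<eta> / fact n)"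
  have sm: "summable (\<lambda>n. a n * x ^ n)" for x
    using semigroup_summable[OF assms, of x J] by (simp add: a_def mult.commute)
  have "((\<lambda>x. \<Sum>n. a n * x ^ n) has_field_derivative (\<Sum>n. diffs a n * t ^ n)) (at t)"
    by (rule termdiffs_strong_converges_everywhere) (rule sm)
  also have "(\<lambda>x. \<Sum>n. a n * x ^ n) = (\<lambda>t. P t J \<eta>)"
    by (simp add: gen_exp_def a_def mult.commute)
  also have "(\<lambda>n. diffs a n * t ^ n) = (\<lambda>n. \<Sum>i\<in>I. c i \<eta> *
      (t ^ n / fact n * (A ^^ n) J (T i \<eta>) - t ^ n / fact n * (A ^^ n) J \<eta>))"
  proof
    fix n
    have "diffs a n * t ^ n = t ^ n / fact n * (A ^^ Suc n) J \<eta>"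
      by (simp add: diffs_def a_def fact_Suc del: funpow.simps of_nat_Suc)
    then show "diffs a n * t ^ n = (\<Sum>i\<in>I. c i \<eta> *
      (t ^ n / fact n * (A ^^ n) J (T i \<eta>) - t ^ n / fact n * (A ^^ n) J \<eta>))"
      by (simp add: jump_gen_def sum_distrib_left algebra_simps)
  qed
  also have "(\<Sum>n. \<Sum>i\<in>I. c i \<eta> *
      (t ^ n / fact n * (A ^^ n) J (T i \<eta>) - t ^ n / fact n * (A ^^ n) J \<eta>)) = A (P t J) \<eta>"
  proof -
    have "(\<lambda>n. c i \<eta> * (t ^ n / fact n * (A ^^ n) J (T i \<eta>) - t ^ n / fact n * (A ^^ n) J \<eta>))
       sums (c i \<eta> * (P t J (T i \<eta>) - P t J \<eta>))" if "i \<in> I" for i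
    proof (cases "c i \<eta> = 0")
      case False
      then have "T i \<eta> \<in> X" using closed that assms by blast
      then show ?thesis unfolding gen_exp_def
        by (intro sums_mult sums_diff summable_sums semigroup_summable assms)
    qed simp
    then have "(\<lambda>n. \<Sum>i\<in>I. c i \<eta> *
      (t ^ n / fact n * (A ^^ n) J (T i \<eta>) - t ^ n / fact n * (A ^^ n) J \<eta>)) sums
       (\<Sum>i\<in>I. c i \<eta> * (P t J (T i \<eta>) - P t J \<eta>))" by (rule sums_sum)
    then show ?thesis by (simp add: sums_iff jump_gen_def)
  qed
  finally show ?thesis .
qed

lemma semigroup_cong:
  assumes "\<And>\<eta>. \<eta> \<in> X \<Longrightarrow> J \<eta> = K \<eta>" "\<eta> \<in> X"
  shows "P t J \<eta> = P t K \<eta>"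
proof -
  have "(A ^^ n) J \<eta> = (A ^^ n) K \<eta>" if "\<eta> \<in> X" for n \<eta>
    using that
  proof (induction n arbitrary: \<eta>)
    case (Suc n)
    then show ?case
      unfolding funpow.simps o_apply jump_gen_def
      by (intro sum.cong refl) (use closed in fastforce)
  qed (use assms in auto)
  then show ?thesis using assms(2) by (simp add: gen_exp_def)
qed

lemma uniformized_power:
  "\<Lambda> ^ n * (Q ^^ n) J \<eta> = (\<Sum>j\<le>n. real (n choose j) * \<Lambda> ^ (n - j) * (A ^^ j) J \<eta>)"
proof (induction n arbitrary: \<eta>)
  case (Suc n)
  have L: "\<Lambda> \<noteq> 0" using rate_pos by simp
  have eq: "(Q ^^ n) J = (\<lambda>\<eta>. \<Sum>j\<le>n. (real (n choose j) * \<Lambda> ^ (n - j) / \<Lambda> ^ n) * (A ^^ j) J \<eta>)"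
  proof
    fix \<eta> show "(Q ^^ n) J \<eta> = (\<Sum>j\<le>n. (real (n choose j) * \<Lambda> ^ (n - j) / \<Lambda> ^ n) * (A ^^ j) J \<eta>)"
      using Suc.IH[of \<eta>] L by (simp add: field_simps sum_divide_distrib[symmetric])
  qed
  have A: "\<Lambda> ^ n * A ((Q ^^ n) J) \<eta> = (\<Sum>j\<le>n. real (n choose j) * \<Lambda> ^ (n - j) * (A ^^ Suc j) J \<eta>)"
    unfolding eq jump_gen_sum sum_distrib_left using L by (intro sum.cong) auto
  have "\<Lambda> ^ Suc n * (Q ^^ Suc n) J \<eta> = \<Lambda> * (\<Lambda> ^ n * (Q ^^ n) J \<eta>) + \<Lambda> ^ n * A ((Q ^^ n) J) \<eta>"
    using L by (simp add: uniformized_def field_simps)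
  also have "\<dots> = (\<Sum>j\<le>n. real (n choose j) * \<Lambda> ^ (Suc n - j) * (A ^^ j) J \<eta>)
      + (\<Sum>j\<le>n. real (n choose j) * \<Lambda> ^ (n - j) * (A ^^ Suc j) J \<eta>)"
    unfolding A Suc.IH sum_distrib_left
    by (intro arg_cong2[where f="(+)"] sum.cong refl) (auto simp: Suc_diff_le)
  also have "(\<Sum>j\<le>n. real (n choose j) * \<Lambda> ^ (Suc n - j) * (A ^^ j) J \<eta>) =
     (\<Sum>j\<le>Suc n. real (n choose j) * \<Lambda> ^ (Suc n - j) * (A ^^ j) J \<eta>)" by simp
  also have "\<dots> = \<Lambda> ^ Suc n * J \<eta> + (\<Sum>j\<le>n. real (n choose Suc j) * \<Lambda> ^ (n - j) * (A ^^ Suc j) J \<eta>)"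
    by (subst sum.atMost_Suc_shift) simp
  also have "\<dots> + (\<Sum>j\<le>n. real (n choose j) * \<Lambda> ^ (n - j) * (A ^^ Suc j) J \<eta>)
     = \<Lambda> ^ Suc n * J \<eta> + (\<Sum>j\<le>n. real (Suc n choose Suc j) * \<Lambda> ^ (n - j) * (A ^^ Suc j) J \<eta>)"
    by (simp add: sum.distrib[symmetric] algebra_simps del: funpow.simps)
  also have "\<dots> = (\<Sum>j\<le>Suc n. real (Suc n choose j) * \<Lambda> ^ (Suc n - j) * (A ^^ j) J \<eta>)"
    by (subst sum.atMost_Suc_shift) simp
  finally show ?case .
qed simp

text \<open>\<open>exp (\<Lambda> t) exp (t A) = exp (t (\<Lambda> + A))\<close>: the Cauchy product of two exponential series, with
\<open>\<Lambda> + A = \<Lambda> Q\<close>. All coefficients on the left are nonnegative for \<open>t \<ge> 0\<close>.\<close>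

lemma uniformization:
  assumes "\<eta> \<in> X"
  shows "(\<lambda>n. (\<Lambda> * t) ^ n / fact n * (Q ^^ n) J \<eta>) sums (exp (\<Lambda> * t) * P t J \<eta>)"
proof -
  have s: "summable (\<lambda>n. norm (t ^ n / fact n * (A ^^ n) J \<eta>))"
    using semigroup_abs_summable[OF assms] by simp
  have e: "summable (\<lambda>n. norm ((\<Lambda> * t) ^ n / fact n))"
    using summable_norm_exp[of "\<Lambda> * t"] by (simp add: divide_inverse mult.commute)
  have "(\<lambda>n. \<Sum>i\<le>n. (t ^ i / fact i * (A ^^ i) J \<eta>) * ((\<Lambda> * t) ^ (n - i) / fact (n - i)))
     sums (P t J \<eta> * (\<Sum>n. (\<Lambda> * t) ^ n / fact n))"
    unfolding gen_exp_def by (rule Cauchy_product_sums[OF s e])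
  moreover have "(\<Sum>n. (\<Lambda> * t) ^ n / fact n) = exp (\<Lambda> * t)"
    by (simp add: exp_def divide_inverse mult.commute)
  moreover have "(\<Sum>i\<le>n. (t ^ i / fact i * (A ^^ i) J \<eta>) * ((\<Lambda> * t) ^ (n - i) / fact (n - i)))
      = (\<Lambda> * t) ^ n / fact n * (Q ^^ n) J \<eta>" for n
  proof -
    have "(\<Lambda> * t) ^ n / fact n * (Q ^^ n) J \<eta> = t ^ n / fact n * (\<Lambda> ^ n * (Q ^^ n) J \<eta>)"
      by (simp add: power_mult_distrib)
    also have "\<dots> = (\<Sum>i\<le>n. (t ^ i / fact i * (A ^^ i) J \<eta>) * ((\<Lambda> * t) ^ (n - i) / fact (n - i)))"
      unfolding uniformized_power sum_distrib_left
    proof (rule sum.cong[OF refl])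
      fix j assume "j \<in> {..n}"
      then have j: "j \<le> n" by simp
      have "t ^ n = t ^ j * t ^ (n - j)" using j by (simp flip: power_add)
      then show "t ^ n / fact n * (real (n choose j) * \<Lambda> ^ (n - j) * (A ^^ j) J \<eta>) =
           t ^ j / fact j * (A ^^ j) J \<eta> * ((\<Lambda> * t) ^ (n - j) / fact (n - j))"
        using j by (simp add: binomial_fact power_mult_distrib field_simps)
    qed
    finally show ?thesis by simp
  qed
  ultimately show ?thesis by (simp add: mult.commute)
qed

lemma uniformized_alt:
  "Q J \<eta> = (1 - (\<Sum>i\<in>I. c i \<eta>) / \<Lambda>) * J \<eta> + (\<Sum>i\<in>I. c i \<eta> / \<Lambda> * J (T i \<eta>))"
  by (simp add: uniformized_def jump_gen_def right_diff_distrib sum_subtractf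
      sum_distrib_right[symmetric] sum_divide_distrib[symmetric] diff_divide_distrib
      left_diff_distrib)

lemma uniformized_mono:
  assumes "\<And>\<eta>. \<eta> \<in> X \<Longrightarrow> J \<eta> \<le> K \<eta>" "\<eta> \<in> X"
  shows "Q J \<eta> \<le> Q K \<eta>"
proof -
  have "(\<Sum>i\<in>I. c i \<eta> / \<Lambda> * J (T i \<eta>)) \<le> (\<Sum>i\<in>I. c i \<eta> / \<Lambda> * K (T i \<eta>))"
  proof (rule sum_mono)
    fix i assume "i \<in> I"
    then show "c i \<eta> / \<Lambda> * J (T i \<eta>) \<le> c i \<eta> / \<Lambda> * K (T i \<eta>)"
      using assms closed[of i \<eta>] rate_nonneg[of i \<eta>] rate_pos
      by (cases "c i \<eta> = 0") (simp, intro mult_left_mono, auto)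
  qed
  moreover have "(1 - (\<Sum>i\<in>I. c i \<eta>) / \<Lambda>) * J \<eta> \<le> (1 - (\<Sum>i\<in>I. c i \<eta>) / \<Lambda>) * K \<eta>"
    using assms rate_le[OF assms(2)] rate_pos by (intro mult_left_mono) auto
  ultimately show ?thesis unfolding uniformized_alt by linarith
qed

lemma semigroup_nonneg:
  assumes J: "\<And>\<eta>. \<eta> \<in> X \<Longrightarrow> 0 \<le> J \<eta>" and "\<eta> \<in> X" "0 \<le> t"
  shows "0 \<le> P t J \<eta>"
proof -
  have nn: "0 \<le> (Q ^^ n) J \<eta>" if "\<eta> \<in> X" for n \<eta>
    using that
  proof (induction n arbitrary: \<eta>)
    case (Suc n)
    have "Q (\<lambda>_. 0) \<eta> \<le> Q ((Q ^^ n) J) \<eta>" by (rule uniformized_mono) (use Suc in auto)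
    moreover have "Q (\<lambda>_. 0) \<eta> = 0" by (simp add: uniformized_def jump_gen_def)
    ultimately show ?case by simp
  qed (use J in auto)
  have u: "(\<lambda>n. (\<Lambda> * t) ^ n / fact n * (Q ^^ n) J \<eta>) sums (exp (\<Lambda> * t) * P t J \<eta>)"
    by (rule uniformization) fact
  have "0 \<le> exp (\<Lambda> * t) * P t J \<eta>"
    by (rule sums_le[OF _ sums_zero u]) (use nn assms rate_pos in auto)
  then show ?thesis by (simp add: zero_le_mult_iff)
qed

text \<open>The maximum principle, in the form needed to bound an exit time by an exponential function.\<close>

lemma semigroup_le_exp_supersolution:
  assumes super: "\<And>\<eta>. \<eta> \<in> X \<Longrightarrow> A F \<eta> \<le> \<gamma> * F \<eta>"
    and init: "\<And>\<eta>. \<eta> \<in> X \<Longrightarrow> J \<eta> \<le> F \<eta>" and \<gamma>: "0 \<le> \<gamma>" and "\<eta> \<in> X" "0 \<le> t"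
  shows "P t J \<eta> \<le> exp (\<gamma> * t) * F \<eta>"
proof -
  have le: "(Q ^^ n) J \<eta> \<le> (1 + \<gamma> / \<Lambda>) ^ n * F \<eta>" if "\<eta> \<in> X" for n \<eta>
    using that
  proof (induction n arbitrary: \<eta>)
    case (Suc n)
    have "(Q ^^ Suc n) J \<eta> \<le> Q (\<lambda>\<eta>. (1 + \<gamma> / \<Lambda>) ^ n * F \<eta>) \<eta>"
      unfolding funpow.simps o_apply by (rule uniformized_mono) (use Suc in simp_all)
    also have "\<dots> = (1 + \<gamma> / \<Lambda>) ^ n * (F \<eta> + A F \<eta> / \<Lambda>)"
      using jump_gen_linear_combination[of I c T "(1 + \<gamma> / \<Lambda>) ^ n" F 0 F \<eta>]
      unfolding uniformized_def by (simp only: mult_zero_left add_0_right distrib_left times_divide_eq_right)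
    also have "\<dots> \<le> (1 + \<gamma> / \<Lambda>) ^ n * (F \<eta> + (\<gamma> * F \<eta>) / \<Lambda>)"
      using super[OF Suc.prems] \<gamma> rate_pos
      by (intro mult_left_mono add_left_mono divide_right_mono) auto
    finally show ?case by (simp add: algebra_simps)
  qed (use init in auto)
  have Fs: "(\<lambda>n. ((\<Lambda> + \<gamma>) * t) ^ n / fact n * F \<eta>) sums (exp ((\<Lambda> + \<gamma>) * t) * F \<eta>)"
    using exp_converges[of "(\<Lambda> + \<gamma>) * t"] by (intro sums_mult2) (simp add: divide_inverse mult.commute)
  have "(\<Lambda> * t) ^ n / fact n * (Q ^^ n) J \<eta> \<le> ((\<Lambda> + \<gamma>) * t) ^ n / fact n * F \<eta>" for n
  proof -
    have "(\<Lambda> * t) ^ n / fact n * (Q ^^ n) J \<eta> \<le> (\<Lambda> * t) ^ n / fact n * ((1 + \<gamma> / \<Lambda>) ^ n * F \<eta>)"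
      using \<open>0 \<le> t\<close> rate_pos by (intro mult_left_mono le \<open>\<eta> \<in> X\<close>) simp
    also have "\<dots> = (\<Lambda> * t * (1 + \<gamma> / \<Lambda>)) ^ n / fact n * F \<eta>"
      by (simp add: power_mult_distrib)
    also have "\<Lambda> * t * (1 + \<gamma> / \<Lambda>) = (\<Lambda> + \<gamma>) * t" using rate_pos by (simp add: field_simps)
    finally show ?thesis .
  qed
  then have "exp (\<Lambda> * t) * P t J \<eta> \<le> exp ((\<Lambda> + \<gamma>) * t) * F \<eta>"
    by (rule sums_le[OF _ uniformization[OF \<open>\<eta> \<in> X\<close>] Fs])
  also have "\<dots> = exp (\<Lambda> * t) * (exp (\<gamma> * t) * F \<eta>)"
    by (simp add: exp_add algebra_simps)
  finally show ?thesis by simp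
qed

end

text \<open>Two processes, possibly on different state spaces related by \<open>f\<close>, are compared through their
skeletons; this is why both are uniformized at the same rate.\<close>

lemma semigroup_le_semigroup:
  assumes "jump_process I c T X \<Lambda>" "jump_process I' c' T' X' \<Lambda>"
    and le: "\<And>n \<eta>. \<eta> \<in> X \<Longrightarrow> (uniformized \<Lambda> (jump_gen I c T) ^^ n) J \<eta>
             \<le> (uniformized \<Lambda> (jump_gen I' c' T') ^^ n) J' (f \<eta>)"
    and "\<eta> \<in> X" "f \<eta> \<in> X'" "0 \<le> t"
  shows "gen_exp (jump_gen I c T) t J \<eta> \<le> gen_exp (jump_gen I' c' T') t J' (f \<eta>)"
proof -
  interpret a: jump_process I c T X \<Lambda> by fact
  interpret b: jump_process I' c' T' X' \<Lambda> by fact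
  have "0 \<le> (\<Lambda> * t) ^ n / fact n" for n
    using a.rate_pos \<open>0 \<le> t\<close> by simp
  then have "(\<Lambda> * t) ^ n / fact n * (uniformized \<Lambda> (jump_gen I c T) ^^ n) J \<eta>
    \<le> (\<Lambda> * t) ^ n / fact n * (uniformized \<Lambda> (jump_gen I' c' T') ^^ n) J' (f \<eta>)" for n
    by (rule mult_left_mono[OF le[OF \<open>\<eta> \<in> X\<close>]])
  then have "exp (\<Lambda> * t) * gen_exp (jump_gen I c T) t J \<eta>
     \<le> exp (\<Lambda> * t) * gen_exp (jump_gen I' c' T') t J' (f \<eta>)"
    by (rule sums_le[OF _ a.uniformization[OF assms(4)] b.uniformization[OF assms(5)]])
  then show ?thesis by simp
qed

section \<open>Grand canonical measures\<close>

locale zero_range_rate =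
  fixes g :: "nat \<Rightarrow> real"
  assumes rate_function: "rate_function g"
begin

lemma g_mono: "m \<le> n \<Longrightarrow> g m \<le> g n"
  using rate_function by (auto simp: rate_function_def mono_def)

lemma g_0 [simp]: "g 0 = 0"
  using rate_function by (simp add: rate_function_def)

lemma g1_pos: "0 < g 1"
  using rate_function by (simp add: rate_function_def)

lemma g_nonneg: "0 \<le> g n"
  using g_mono[of 0 n] by simp

lemma g_pos: "0 < n \<Longrightarrow> 0 < g n"
  using g_mono[of 1 n] g1_pos by linarith

lemma g_linear_bound: obtains C where "0 < C" "\<And>n. g n \<le> C * real n"
proof -
  obtain C where C: "\<And>k. \<bar>g (Suc k) - g k\<bar> \<le> C"
    using rate_function by (auto simp: rate_function_def bdd_above_def)
  have "g n \<le> max C 1 * real n" for n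
  proof (induction n)
    case (Suc n)
    have "g (Suc n) \<le> g n + max C 1" using C[of n] by linarith
    then show ?case using Suc by (simp add: algebra_simps)
  qed simp
  then show ?thesis by (intro that[of "max C 1"]) auto
qed

lemma g_fact_0 [simp]: "g_fact g 0 = 1"
  by (simp add: g_fact_def)

lemma g_fact_Suc: "g_fact g (Suc n) = g (Suc n) * g_fact g n"
  by (simp add: g_fact_def mult.commute)

lemma g_fact_pos: "0 < g_fact g n"
  by (induction n) (simp_all add: g_fact_Suc g_pos)

lemma g_weight_Suc: "g (Suc n) / g_fact g (Suc n) = 1 / g_fact g n"
  using g_pos[of "Suc n"] by (simp add: g_fact_Suc)

definition fugacities :: "real set" where
  "fugacities = {\<phi>. 0 \<le> \<phi> \<and> ereal \<phi> < phi_star g}"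

lemma fugacities_mono: "\<phi> \<in> fugacities \<Longrightarrow> 0 \<le> \<psi> \<Longrightarrow> \<psi> \<le> \<phi> \<Longrightarrow> \<psi> \<in> fugacities"
  unfolding fugacities_def by (auto intro: le_less_trans[of "ereal \<psi>" "ereal \<phi>"])

text \<open>Ratio test: the radius of convergence is at least the supremum of the rates.\<close>

lemma less_rate_fugacity:
  assumes "0 \<le> \<phi>" "\<phi> < g K"
  shows "\<phi> \<in> fugacities"
proof -
  define \<psi> where "\<psi> = (\<phi> + g K) / 2"
  have \<psi>: "\<phi> < \<psi>" "\<psi> < g K" "0 < \<psi>" using assms by (auto simp: \<psi>_def)
  have "summable (\<lambda>n. 1 / g_fact g n * \<psi> ^ n)"
  proof (rule summable_ratio_test[of "\<psi> / g K" K])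
    show "\<psi> / g K < 1" using \<psi> by simp
    fix n assume n: "K \<le> n"
    have "norm (1 / g_fact g (Suc n) * \<psi> ^ Suc n) = \<psi> / g (Suc n) * norm (1 / g_fact g n * \<psi> ^ n)"
      using \<psi> g_pos[of "Suc n"] g_fact_pos[of n] by (simp add: g_fact_Suc abs_mult)
    also have "\<dots> \<le> \<psi> / g K * norm (1 / g_fact g n * \<psi> ^ n)"
      using \<psi> g_mono[of K "Suc n"] n by (intro mult_right_mono divide_left_mono mult_pos_pos) auto
    finally show "norm (1 / g_fact g (Suc n) * \<psi> ^ Suc n) \<le> \<psi> / g K * norm (1 / g_fact g n * \<psi> ^ n)" .
  qed
  then have "ereal \<psi> \<le> phi_star g"
    using conv_radius_geI[of "\<lambda>k. 1 / g_fact g k" \<psi>] \<psi> by (simp add: phi_star_def)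
  moreover have "ereal \<phi> < ereal \<psi>" using \<psi> by simp
  ultimately have "ereal \<phi> < phi_star g" by (rule less_le_trans[rotated])
  then show ?thesis using assms by (simp add: fugacities_def)
qed

lemma fugacity_above_0: "g 1 / 2 \<in> fugacities"
  using g1_pos by (intro less_rate_fugacity[of _ 1]) auto

lemma summable_weights:
  assumes "\<bar>\<phi>\<bar> \<in> fugacities"
  shows "summable (\<lambda>n. \<bar>1 / g_fact g n * \<phi> ^ n\<bar>)"
    and "summable (\<lambda>n. \<bar>real n * (1 / g_fact g n) * \<phi> ^ n\<bar>)"
    and "summable (\<lambda>n. \<bar>real (Suc n) * (1 / g_fact g (Suc n)) * \<phi> ^ n\<bar>)"
proof -
  have lt: "ereal (norm \<phi>) < conv_radius (\<lambda>n. 1 / g_fact g n)"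
    using assms by (simp add: fugacities_def phi_star_def)
  show "summable (\<lambda>n. \<bar>1 / g_fact g n * \<phi> ^ n\<bar>)"
    using abs_summable_in_conv_radius[OF lt] by simp
  obtain K where K: "ereal \<bar>\<phi>\<bar> < ereal K" "ereal K < conv_radius (\<lambda>n. 1 / g_fact g n)"
    using ereal_dense2[OF lt] by auto
  have "summable (\<lambda>n. 1 / g_fact g n * x ^ n)" if "norm x < K" for x
    by (rule summable_in_conv_radius, rule le_less_trans[OF _ K(2)]) (use that in simp)
  then have "summable (\<lambda>n. diffs (\<lambda>n. 1 / g_fact g n) n * \<bar>\<phi>\<bar> ^ n)"
    using K(1) by (intro termdiff_converges[of _ K]) auto
  then show *: "summable (\<lambda>n. \<bar>real (Suc n) * (1 / g_fact g (Suc n)) * \<phi> ^ n\<bar>)"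
    using less_imp_le[OF g_fact_pos] by (simp add: diffs_def abs_mult power_abs del: of_nat_Suc)
  have "summable (\<lambda>n. \<bar>real (Suc n) * (1 / g_fact g (Suc n)) * \<phi> ^ Suc n\<bar>)"
    using summable_mult[OF *, of "\<bar>\<phi>\<bar>"] by (simp add: abs_mult mult_ac)
  then show "summable (\<lambda>n. \<bar>real n * (1 / g_fact g n) * \<phi> ^ n\<bar>)"
    by (subst (asm) summable_Suc_iff) 
qed

lemma partition_fun_sums:
  assumes "\<phi> \<in> fugacities"
  shows "(\<lambda>n. \<phi> ^ n / g_fact g n) sums partition_fun g \<phi>"
proof -
  have "\<bar>\<phi>\<bar> \<in> fugacities" using assms by (simp add: fugacities_def)
  then have "summable (\<lambda>n. 1 / g_fact g n * \<phi> ^ n)"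
    using summable_weights(1) by (blast intro: summable_rabs_cancel)
  then show ?thesis by (simp add: partition_fun_def summable_sums)
qed

lemma partition_fun_ge_1:
  assumes "\<phi> \<in> fugacities" shows "1 \<le> partition_fun g \<phi>"
proof -
  have "(\<Sum>n\<in>{0}. \<phi> ^ n / g_fact g n) \<le> partition_fun g \<phi>"
    using assms partition_fun_sums[OF assms] g_fact_pos less_imp_le[OF g_fact_pos] unfolding partition_fun_def
    by (intro sum_le_suminf) (auto simp: sums_iff fugacities_def)
  then show ?thesis by simp
qed

lemma mean_density_sums:
  assumes "\<phi> \<in> fugacities"
  shows "(\<lambda>n. real n * (\<phi> ^ n / g_fact g n)) sums (mean_density g \<phi> * partition_fun g \<phi>)"
proof -
  have "\<bar>\<phi>\<bar> \<in> fugacities" using assms by (simp add: fugacities_def)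
  then have s: "summable (\<lambda>n. real n * (\<phi> ^ n / g_fact g n))"
    using summable_weights(2)[of \<phi>] summable_rabs_cancel by fastforce
  have "mean_density g \<phi> = (\<Sum>k. 1 / partition_fun g \<phi> * (real k * (\<phi> ^ k / g_fact g k)))"
    unfolding mean_density_def nu_bar_def by (intro suminf_cong) simp
  also have "\<dots> = 1 / partition_fun g \<phi> * (\<Sum>k. real k * (\<phi> ^ k / g_fact g k))"
    by (rule suminf_mult[OF s])
  finally show ?thesis
    using s partition_fun_ge_1[OF assms] by (simp add: sums_iff)
qed

lemma mean_density_0: "mean_density g 0 = 0"
proof -
  have "(\<lambda>k. real k * nu_bar g 0 k) = (\<lambda>k. 0)"
    by (auto simp: nu_bar_def fun_eq_iff)
  then show ?thesis by (simp only: mean_density_def suminf_zero)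
qed

text \<open>The numerator of the difference of the two densities is a double series that is antisymmetrised
along its diagonals; all diagonals are nonnegative, and the one of index \<open>1\<close> is positive.\<close>

lemma mean_density_strict_mono:
  assumes "\<phi> \<in> fugacities" "\<psi> \<in> fugacities" "\<phi> < \<psi>"
  shows "mean_density g \<phi> < mean_density g \<psi>"
proof -
  note nn = less_imp_le[OF g_fact_pos]
  have pos: "0 \<le> \<phi>" "0 < \<psi>" using assms by (auto simp: fugacities_def)
  let ?a = "\<lambda>x i. x ^ i / g_fact g i" and ?b = "\<lambda>x i. real i * (x ^ i / g_fact g i)"
  let ?Z = "partition_fun g" and ?M = "\<lambda>x. mean_density g x * partition_fun g x"
  have prod: "(\<lambda>n. \<Sum>i\<le>n. ?b x i * ?a y (n - i)) sums (?M x * ?Z y)"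
    if "x \<in> fugacities" "y \<in> fugacities" for x y
  proof -
    have "0 \<le> x" "0 \<le> y" using that by (auto simp: fugacities_def)
    then have "summable (\<lambda>i. norm (?b x i))" "summable (\<lambda>i. norm (?a y i))"
      using mean_density_sums[OF that(1)] partition_fun_sums[OF that(2)] nn
      by (simp_all add: sums_iff)
    then show ?thesis
      using Cauchy_product_sums[of "?b x" "?a y"] mean_density_sums[OF that(1)] partition_fun_sums[OF that(2)]
      by (simp add: sums_iff)
  qed
  define D where "D = (\<lambda>n. \<Sum>i\<le>n. ?b \<psi> i * ?a \<phi> (n - i) - ?b \<phi> i * ?a \<psi> (n - i))"
  have D: "D sums (?M \<psi> * ?Z \<phi> - ?M \<phi> * ?Z \<psi>)"
    unfolding D_def sum_subtractf by (intro sums_diff prod assms)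
  have Dn: "0 \<le> D n" for n
  proof -
    define s where "s i = ?a \<psi> i * ?a \<phi> (n - i) - ?a \<phi> i * ?a \<psi> (n - i)" for i
    have s_anti: "s (n - i) = - s i" if "i \<in> {..n}" for i
      using that by (simp add: s_def mult.commute)
    have D1: "D n = (\<Sum>i\<le>n. real i * s i)" unfolding D_def s_def
      by (intro sum.cong) (auto simp: algebra_simps)
    also have "(\<Sum>i\<le>n. real i * s i) = (\<Sum>i\<le>n. real (n - i) * s (n - i))"
      by (rule sum.reindex_bij_witness[of _ "\<lambda>i. n - i" "\<lambda>i. n - i"]) auto
    also have "\<dots> = (\<Sum>i\<le>n. - real (n - i) * s i)"
      by (intro sum.cong refl) (simp only: s_anti mult_minus_left mult_minus_right)
    finally have D2: "D n = (\<Sum>i\<le>n. - real (n - i) * s i)" .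
    have "D n + D n = (\<Sum>i\<le>n. real i * s i + - real (n - i) * s i)"
      unfolding sum.distrib by (subst (1) D1, subst D2) (rule refl)
    then have "2 * D n = (\<Sum>i\<le>n. (real i - real (n - i)) * s i)"
      by (simp only: mult_2 left_diff_distrib mult_minus_left add_uminus_conv_diff)
    also have "0 \<le> \<dots>"
    proof (rule sum_nonneg)
      fix i assume "i \<in> {..n}"
      then have i: "i \<le> n" by simp
      have s: "s i = (\<psi> ^ i * \<phi> ^ (n - i) - \<phi> ^ i * \<psi> ^ (n - i)) / (g_fact g i * g_fact g (n - i))"
        by (simp add: s_def diff_divide_distrib)
      have key: "\<phi> ^ v * \<psi> ^ u \<le> \<psi> ^ v * \<phi> ^ u" if "u \<le> v" for u v
      proof -
        have "\<phi> ^ v * \<psi> ^ u = \<phi> ^ (v - u) * (\<phi> ^ u * \<psi> ^ u)"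
          using that by (simp add: power_add[symmetric])
        also have "\<dots> \<le> \<psi> ^ (v - u) * (\<phi> ^ u * \<psi> ^ u)"
          using assms(3) pos by (intro mult_right_mono power_mono) auto
        also have "\<dots> = \<psi> ^ v * \<phi> ^ u"
          using that by (simp add: power_add[symmetric])
        finally show ?thesis .
      qed
      show "0 \<le> (real i - real (n - i)) * s i"
      proof (cases "n - i \<le> i")
        case True
        then show ?thesis unfolding s using key[OF True] nn
          by (intro mult_nonneg_nonneg divide_nonneg_nonneg) auto
      next
        case False
        then have "i \<le> n - i" by simp
        from key[OF this] False nn show ?thesis unfolding s
          by (intro mult_nonpos_nonpos divide_nonpos_nonneg mult_nonneg_nonneg) (auto simp: mult.commute)
      qed
    qed
    finally show ?thesis by simp
  qed
  have D1: "0 < D 1"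
    using assms(3) g_fact_pos[of 1] by (simp add: D_def divide_strict_right_mono)
  have "0 < suminf D"
    by (rule suminf_pos2[of D 1]) (use D Dn D1 in \<open>auto simp: sums_iff\<close>)
  then have "0 < ?M \<psi> * ?Z \<phi> - ?M \<phi> * ?Z \<psi>" using D by (simp add: sums_iff)
  also have "\<dots> = (mean_density g \<psi> - mean_density g \<phi>) * (?Z \<phi> * ?Z \<psi>)"
    by (simp add: algebra_simps)
  finally have "0 < (mean_density g \<psi> - mean_density g \<phi>) * (?Z \<phi> * ?Z \<psi>)" .
  moreover have "0 < ?Z \<phi> * ?Z \<psi>"
    using partition_fun_ge_1[OF assms(1)] partition_fun_ge_1[OF assms(2)] by simp
  ultimately show ?thesis using zero_less_mult_pos2 by fastforce
qed

lemma flux_mean_density: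
  assumes "\<phi> \<in> fugacities" shows "flux g (mean_density g \<phi>) = \<phi>"
proof -
  have "inj_on (mean_density g) fugacities"
    by (rule linorder_inj_onI) (use mean_density_strict_mono in \<open>force+\<close>)
  then show ?thesis
    using assms by (simp add: flux_def fugacities_def the_inv_into_f_f)
qed

lemma zero_fugacity: "0 \<in> fugacities"
  using fugacities_mono[OF fugacity_above_0, of 0] g1_pos by simp

lemma flux_0: "flux g 0 = 0"
  using flux_mean_density[OF zero_fugacity] by (simp add: mean_density_0)

lemma mean_density_nonneg: "\<phi> \<in> fugacities \<Longrightarrow> 0 \<le> mean_density g \<phi>"
  using mean_density_strict_mono[OF zero_fugacity, of \<phi>] mean_density_0
  by (cases "\<phi> = 0") (auto simp: fugacities_def)

text \<open>To first order in the fugacity a site carries at most one particle, so \<open>g\<close> acts on it like \<open>g 1\<close>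
times the occupation number.\<close>

lemma mean_density_over_fugacity_tendsto:
  "((\<lambda>\<phi>. mean_density g \<phi> / \<phi>) \<longlongrightarrow> 1 / g 1) (at_right 0)"
proof -
  let ?F = "\<lambda>x. \<Sum>n. real (Suc n) * (1 / g_fact g (Suc n)) * x ^ n"
  let ?G = "\<lambda>x. \<Sum>n. 1 / g_fact g n * x ^ n"
  have dom: "\<bar>x\<bar> \<in> fugacities" if "\<bar>x\<bar> < g 1 / 2" for x
    using fugacities_mono[OF fugacity_above_0] that by simp
  have F: "(?F \<longlongrightarrow> real (Suc 0) * (1 / g_fact g (Suc 0))) (at 0)"
    by (rule powser_limit_0[of "g 1 / 2"])
       (use g1_pos summable_rabs_cancel[OF summable_weights(3)[OF dom]] in \<open>auto intro: summable_sums\<close>)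
  have G: "(?G \<longlongrightarrow> 1 / g_fact g 0) (at 0)"
    by (rule powser_limit_0[of "g 1 / 2"])
       (use g1_pos summable_rabs_cancel[OF summable_weights(1)[OF dom]] in \<open>auto intro: summable_sums\<close>)
  have "((\<lambda>x. ?F x / ?G x) \<longlongrightarrow> (real (Suc 0) * (1 / g_fact g (Suc 0))) / (1 / g_fact g 0)) (at_right 0)"
    by (rule tendsto_divide; (rule tendsto_mono[OF at_le F] tendsto_mono[OF at_le G])?) auto
  moreover have "eventually (\<lambda>x. ?F x / ?G x = mean_density g x / x) (at_right 0)"
    unfolding eventually_at_right_field
  proof (intro exI[of _ "g 1 / 2"] conjI allI impI)
    fix x assume x: "0 < x" "x < g 1 / 2"
    then have d: "x \<in> fugacities" using dom[of x] by simp
    have "summable (\<lambda>n. real (Suc n) * (1 / g_fact g (Suc n)) * x ^ n)"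
      using summable_rabs_cancel[OF summable_weights(3)[OF dom[of x]]] x by simp
    then have "(\<lambda>n. x * (real (Suc n) * (1 / g_fact g (Suc n)) * x ^ n)) sums (x * ?F x)"
      by (intro sums_mult summable_sums)
    then have "(\<lambda>n. real (Suc n) * (x ^ Suc n / g_fact g (Suc n))) sums (x * ?F x)"
      by (simp add: mult_ac)
    then have "(\<lambda>n. real n * (x ^ n / g_fact g n)) sums (x * ?F x)"
      by (subst (asm) sums_Suc_iff) simp
    then have 1: "x * ?F x = mean_density g x * partition_fun g x"
      using mean_density_sums[OF d] sums_unique2 by blast
    have 2: "?G x = partition_fun g x" by (simp add: partition_fun_def)
    show "?F x / ?G x = mean_density g x / x"
      unfolding 2 using 1 x partition_fun_ge_1[OF d] by (simp add: field_simps)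
  qed (use g1_pos in auto)
  ultimately show ?thesis
    by (simp add: filterlim_cong g_fact_Suc)
qed

section \<open>Equivalence of ensembles\<close>

text \<open>\<open>conv_weight l n\<close> is the canonical partition function of \<open>n\<close> particles on \<open>l\<close> sites, see
\<open>sum_weight_sector\<close>.\<close>

fun conv_weight :: "nat \<Rightarrow> nat \<Rightarrow> real" where
  "conv_weight 0 n = (if n = 0 then 1 else 0)"
| "conv_weight (Suc l) n = (\<Sum>i\<le>n. conv_weight l (n - i) / g_fact g i)"

lemma conv_weight_nonneg: "0 \<le> conv_weight l n"
  by (induction l arbitrary: n) (auto intro!: sum_nonneg divide_nonneg_pos g_fact_pos)

lemma conv_weight_0_pos: "0 < conv_weight l 0"
  by (induction l) auto

lemma conv_weight_pos: "0 < conv_weight (Suc l) n"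
proof -
  have "conv_weight l (n - n) / g_fact g n \<le> conv_weight (Suc l) n"
    unfolding conv_weight.simps
    by (rule member_le_sum) (auto intro!: divide_nonneg_pos conv_weight_nonneg g_fact_pos)
  then show ?thesis
    using divide_pos_pos[OF conv_weight_0_pos[of l] g_fact_pos[of n]] by simp
qed

text \<open>Removing a particle from the last site absorbs a factor \<open>g\<close>: the ratio
\<open>conv_weight l (n - 1) / conv_weight l n\<close> is the canonical mean of \<open>g\<close> at a site.\<close>

lemma conv_weight_shift:
  "conv_weight (Suc l) n = (\<Sum>i\<le>Suc n. g i * (conv_weight l (Suc n - i) / g_fact g i))"
proof -
  have "g (Suc i) * (conv_weight l (n - i) / g_fact g (Suc i)) = conv_weight l (n - i) / g_fact g i" for i
    using g_weight_Suc[of i] by (metis times_divide_eq_left times_divide_eq_right mult.commute mult_1)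
  then show ?thesis by (subst sum.atMost_Suc_shift) simp
qed

text \<open>The canonical mean of \<open>g\<close> at a site is nondecreasing in the number of particles.\<close>

lemma conv_weight_log_concave:
  "s \<le> t \<Longrightarrow> conv_weight l s * conv_weight l (t + h) \<le> conv_weight l (s + h) * conv_weight l t"
proof (induction l arbitrary: s t h)
  case (Suc l)
  let ?c = "conv_weight (Suc l)"
  \<comment> \<open>Chebyshev's sum inequality: the law of the last site is stochastically increasing in the
    total number of particles, and \<open>g\<close> is increasing.\<close>
  have one: "?c s * ?c (Suc t) \<le> ?c (Suc s) * ?c t" if st: "s \<le> t" for s t
  proof -
    define b where "b = (\<lambda>n i. if i \<le> n then conv_weight l (n - i) / g_fact g i else 0)"
    let ?I = "{..Suc t}"
    have c1: "?c t = (\<Sum>j\<in>?I. g j * b (Suc t) j)"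
      unfolding conv_weight_shift b_def by (intro sum.cong) auto
    have c2: "?c (Suc t) = (\<Sum>j\<in>?I. b (Suc t) j)"
      unfolding conv_weight.simps b_def by (intro sum.cong) auto
    have c3: "?c s = (\<Sum>i\<in>?I. g i * b (Suc s) i)"
      unfolding conv_weight_shift using st
      by (intro sum.mono_neutral_cong_left) (auto simp: b_def)
    have c4: "?c (Suc s) = (\<Sum>i\<in>?I. b (Suc s) i)"
      unfolding conv_weight.simps using st
      by (intro sum.mono_neutral_cong_left) (auto simp: b_def)
    define f where "f i j = (g j - g i) * (b (Suc s) i * b (Suc t) j)" for i j
    have "?c (Suc s) * ?c t - ?c s * ?c (Suc t) = (\<Sum>i\<in>?I. \<Sum>j\<in>?I. f i j)"
      unfolding c1 c2 c3 c4 sum_product f_def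
      by (simp add: sum_subtractf[symmetric] algebra_simps del: sum.atMost_Suc)
    moreover have "(\<Sum>i\<in>?I. \<Sum>j\<in>?I. f i j) = (\<Sum>i\<in>?I. \<Sum>j\<in>?I. f j i)"
      by (rule sum.swap)
    ultimately have "2 * (?c (Suc s) * ?c t - ?c s * ?c (Suc t)) = (\<Sum>i\<in>?I. \<Sum>j\<in>?I. f i j + f j i)"
      by (simp add: sum.distrib)
    also have "0 \<le> \<dots>"
    proof (intro sum_nonneg)
      have *: "0 \<le> f i j + f j i" if "i \<le> j" "j \<le> Suc t" for i j
      proof -
        have fe: "f i j + f j i = (g j - g i) * (b (Suc s) i * b (Suc t) j - b (Suc s) j * b (Suc t) i)"
          by (simp add: f_def algebra_simps)
        have bn: "0 \<le> b n i" for n i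
          by (auto simp: b_def intro!: divide_nonneg_pos conv_weight_nonneg g_fact_pos)
        have "b (Suc s) j * b (Suc t) i \<le> b (Suc s) i * b (Suc t) j"
        proof (cases "j \<le> Suc s")
          case True
          have "conv_weight l (Suc s - j) * conv_weight l ((Suc t - j) + (j - i))
             \<le> conv_weight l ((Suc s - j) + (j - i)) * conv_weight l (Suc t - j)"
            using st by (intro Suc.IH) auto
          moreover have "(Suc t - j) + (j - i) = Suc t - i" "(Suc s - j) + (j - i) = Suc s - i"
            using True that by auto
          ultimately have "conv_weight l (Suc s - j) * conv_weight l (Suc t - i)
             \<le> conv_weight l (Suc s - i) * conv_weight l (Suc t - j)" by simp
          from divide_right_mono[OF this, of "g_fact g i * g_fact g j"] True that show ?thesis
            using less_imp_le[OF g_fact_pos] by (simp add: b_def mult.commute)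
        next
          case False
          then show ?thesis using bn[of "Suc s" i] bn[of "Suc t" j] by (simp add: b_def[of ] )
        qed
        then show ?thesis unfolding fe using g_mono[OF that(1)] by simp
      qed
      fix i j assume "i \<in> ?I" "j \<in> ?I"
      then show "0 \<le> f i j + f j i"
        using *[of i j] *[of j i] by (cases "i \<le> j") (auto simp: add.commute)
    qed
    finally show ?thesis by simp
  qed
  show ?case
  proof (induction h)
    case (Suc h)
    have step: "?c (s + h) * ?c (Suc (t + h)) \<le> ?c (Suc (s + h)) * ?c (t + h)"
      by (rule one) (use \<open>s \<le> t\<close> in simp)
    have "(?c s * ?c (t + h)) * (?c (s + h) * ?c (Suc (t + h)))
       \<le> (?c (s + h) * ?c t) * (?c (Suc (s + h)) * ?c (t + h))"
      by (rule mult_mono[OF Suc.IH step]) (intro mult_nonneg_nonneg conv_weight_nonneg)+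
    then have "(?c (s + h) * ?c (t + h)) * (?c s * ?c (Suc (t + h)))
       \<le> (?c (s + h) * ?c (t + h)) * (?c (Suc (s + h)) * ?c t)"
      by (simp only: mult_ac)
    moreover have "0 < ?c (s + h) * ?c (t + h)" by (intro mult_pos_pos conv_weight_pos)
    ultimately show ?case by (simp only: mult_le_cancel_left_pos add_Suc_right)
  qed simp
qed auto

lemma conv_weight_step_le: "0 < K \<Longrightarrow> conv_weight (Suc l) (K - 1) \<le> g K * conv_weight (Suc l) K"
proof (cases K)
  case (Suc n)
  have "conv_weight (Suc l) n \<le> (\<Sum>i\<le>Suc n. g (Suc n) * (conv_weight l (Suc n - i) / g_fact g i))"
    unfolding conv_weight_shift
    by (intro sum_mono mult_right_mono g_mono divide_nonneg_pos conv_weight_nonneg g_fact_pos) auto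
  then show ?thesis using Suc
    by (simp add: sum_distrib_left del: sum.atMost_Suc)
qed simp

lemma conv_weight_sums:
  assumes "\<phi> \<in> fugacities"
  shows "(\<lambda>n. conv_weight l n * \<phi> ^ n) sums (partition_fun g \<phi> ^ l)"
    and "(\<lambda>n. real n * (conv_weight l n * \<phi> ^ n)) sums
           (real l * mean_density g \<phi> * partition_fun g \<phi> ^ l)"
proof (induction l)
  case 0
  have "(\<lambda>n. conv_weight 0 n * \<phi> ^ n) = (\<lambda>n. if n = 0 then 1 else 0)" by auto
  then show "(\<lambda>n. conv_weight 0 n * \<phi> ^ n) sums (partition_fun g \<phi> ^ 0)"
    using sums_single[of 0 "\<lambda>_. 1::real"] by simp
  have "(\<lambda>n. real n * (conv_weight 0 n * \<phi> ^ n)) = (\<lambda>n. 0)" by auto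
  then show "(\<lambda>n. real n * (conv_weight 0 n * \<phi> ^ n)) sums
           (real 0 * mean_density g \<phi> * partition_fun g \<phi> ^ 0)" by simp
next
  case (Suc l)
  have \<phi>: "0 \<le> \<phi>" using assms by (simp add: fugacities_def)
  note nn = less_imp_le[OF g_fact_pos]
  let ?a = "\<lambda>i. \<phi> ^ i / g_fact g i" and ?a' = "\<lambda>i. real i * (\<phi> ^ i / g_fact g i)"
  let ?b = "\<lambda>n. conv_weight l n * \<phi> ^ n" and ?b' = "\<lambda>n. real n * (conv_weight l n * \<phi> ^ n)"
  have n: "\<bar>?a i\<bar> = ?a i" "\<bar>?a' i\<bar> = ?a' i" "\<bar>?b i\<bar> = ?b i" "\<bar>?b' i\<bar> = ?b' i" for i
    using \<phi> nn conv_weight_nonneg[of l] by (simp_all add: abs_mult)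
  note S = partition_fun_sums[OF assms] mean_density_sums[OF assms] Suc
  have s: "summable (\<lambda>i. norm (?a i))" "summable (\<lambda>i. norm (?a' i))"
     "summable (\<lambda>i. norm (?b i))" "summable (\<lambda>i. norm (?b' i))"
    unfolding real_norm_def n using S by (auto simp: sums_iff)
  have pw: "\<phi> ^ n = \<phi> ^ i * \<phi> ^ (n - i)" if "i \<le> n" for i n
    using that by (simp flip: power_add)
  have "(\<lambda>n. \<Sum>i\<le>n. ?a i * ?b (n - i)) sums (partition_fun g \<phi> * partition_fun g \<phi> ^ l)"
    using Cauchy_product_sums[OF s(1,3)] S by (simp add: sums_iff)
  moreover have "(\<Sum>i\<le>n. ?a i * ?b (n - i)) = conv_weight (Suc l) n * \<phi> ^ n" for n
    by (auto simp: sum_distrib_right pw intro!: sum.cong)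
  ultimately show "(\<lambda>n. conv_weight (Suc l) n * \<phi> ^ n) sums (partition_fun g \<phi> ^ Suc l)"
    by simp
  have "(\<lambda>n. (\<Sum>i\<le>n. ?a' i * ?b (n - i)) + (\<Sum>i\<le>n. ?a i * ?b' (n - i))) sums
     ((mean_density g \<phi> * partition_fun g \<phi>) * partition_fun g \<phi> ^ l
      + partition_fun g \<phi> * (real l * mean_density g \<phi> * partition_fun g \<phi> ^ l))"
    using Cauchy_product_sums[OF s(2,3)] Cauchy_product_sums[OF s(1,4)] S
    by (intro sums_add) (auto simp: sums_iff)
  moreover have "(\<Sum>i\<le>n. ?a' i * ?b (n - i)) + (\<Sum>i\<le>n. ?a i * ?b' (n - i))
     = real n * (conv_weight (Suc l) n * \<phi> ^ n)" for n
    unfolding sum.distrib[symmetric] conv_weight.simps sum_distrib_left sum_distrib_right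
  proof (intro sum.cong refl)
    fix i assume "i \<in> {..n}"
    then have i: "i \<le> n" by simp
    have "?a' i * ?b (n - i) + ?a i * ?b' (n - i) = (real i + real (n - i)) * (?a i * ?b (n - i))"
      by (simp only: distrib_right) (simp only: mult_ac)
    also have "real i + real (n - i) = real n" using i by simp
    also have "?a i * ?b (n - i) = conv_weight l (n - i) / g_fact g i * \<phi> ^ n"
      by (simp add: pw[OF i])
    finally show "?a' i * ?b (n - i) + ?a i * ?b' (n - i)
      = real n * (conv_weight l (n - i) / g_fact g i * \<phi> ^ n)" .
  qed
  ultimately show "(\<lambda>n. real n * (conv_weight (Suc l) n * \<phi> ^ n)) sums
           (real (Suc l) * mean_density g \<phi> * partition_fun g \<phi> ^ Suc l)"
    by (simp add: algebra_simps)
qed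

text \<open>Equivalence of ensembles, as an upper bound on the canonical mean rate \<open>R\<close>. At fugacity
\<open>(1 - \<kappa>) R\<close> the weights \<open>q n\<close> of the particle numbers decrease geometrically beyond \<open>K\<close>, since the
canonical mean rates only increase from there on; hence the mean number of particles is at most
\<open>K + 1 / \<kappa>\<^sup>2\<close>, and the hypothesis at this fugacity bounds \<open>R\<close>.\<close>

lemma canonical_rate_bound:
  assumes le: "\<And>\<phi>. \<phi> \<in> fugacities \<Longrightarrow> t * \<phi> \<le> \<alpha> + mean_density g \<phi>"
    and t: "0 < t" and \<kappa>: "0 < \<kappa>" "\<kappa> < 1" and l: "0 < l" and K: "0 < K"
  shows "t * (1 - \<kappa>) * real l * conv_weight l (K - 1)
       \<le> (\<alpha> * real l + real K + 1 / \<kappa>\<^sup>2) * conv_weight l K"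
proof -
  obtain l' where l': "l = Suc l'" using l by (cases l) auto
  let ?c = "conv_weight l"
  have cpos: "0 < ?c n" for n unfolding l' by (rule conv_weight_pos)
  define R where "R = ?c (K - 1) / ?c K"
  define \<phi> where "\<phi> = (1 - \<kappa>) * R"
  have R: "0 < R" "R \<le> g K"
    using cpos[of K] cpos[of "K - 1"] conv_weight_step_le[OF K, of l', folded l']
    unfolding R_def by (simp_all add: pos_divide_le_eq)
  have "0 < R * \<kappa>" using R \<kappa> by simp
  then have "\<phi> < R" by (simp only: \<phi>_def left_diff_distrib) (simp add: mult.commute)
  then have "\<phi> < g K" using R(2) by linarith
  moreover have "0 < \<phi>" using R \<kappa> by (simp add: \<phi>_def)
  ultimately have \<phi>: "0 < \<phi>" "\<phi> < g K" by auto
  then have dom: "\<phi> \<in> fugacities" by (intro less_rate_fugacity) auto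
  define q where "q n = ?c n * \<phi> ^ n" for n
  have qpos: "0 < q n" for n using cpos \<phi> by (simp add: q_def)
  have decay: "q (K + j) \<le> (1 - \<kappa>) ^ j * q K" for j
  proof (induction j)
    case (Suc j)
    have "?c (K - 1) * ?c (K + j + 1) \<le> ?c (K - 1 + 1) * ?c (K + j)"
      by (rule conv_weight_log_concave) auto
    then have "R * ?c (Suc (K + j)) \<le> ?c (K + j)"
      using K cpos by (simp add: R_def field_simps)
    then have "(1 - \<kappa>) * (R * ?c (Suc (K + j))) \<le> (1 - \<kappa>) * ?c (K + j)"
      using \<kappa> by (intro mult_left_mono) auto
    then have "\<phi> * ?c (Suc (K + j)) * \<phi> ^ (K + j) \<le> (1 - \<kappa>) * ?c (K + j) * \<phi> ^ (K + j)"
      using \<phi> by (intro mult_right_mono) (auto simp: \<phi>_def mult_ac)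
    then have "q (K + Suc j) \<le> (1 - \<kappa>) * q (K + j)" by (simp add: q_def mult_ac)
    also have "\<dots> \<le> (1 - \<kappa>) * ((1 - \<kappa>) ^ j * q K)"
      using Suc \<kappa> by (intro mult_left_mono) auto
    finally show ?case by (simp add: mult_ac)
  qed simp
  note S = conv_weight_sums[OF dom, of l, folded q_def]
  define e where "e n = (if n < K then 0 else real (Suc (n - K)) * (1 - \<kappa>) ^ (n - K) * q K)" for n
  have e: "e sums (1 / \<kappa>\<^sup>2 * q K)"
  proof -
    have "(\<lambda>n. real (Suc n) * (1 - \<kappa>) ^ n * q K) sums (1 / (1 - (1 - \<kappa>))\<^sup>2 * q K)"
      by (intro sums_mult2 geometric_deriv_sums) (use \<kappa> in auto)
    then have "(\<lambda>n. e (n + K)) sums (1 / \<kappa>\<^sup>2 * q K)" by (simp add: e_def)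
    then show ?thesis by (subst (asm) sums_zero_iff_shift) (auto simp: e_def)
  qed
  have "real n * q n \<le> real K * q n + e n" for n
  proof (cases "n < K")
    case True
    then show ?thesis using qpos[of n] by (simp add: e_def)
  next
    case False
    then obtain j where j: "n = K + j" using le_Suc_ex not_less by blast
    have "real j * q n \<le> real (Suc j) * ((1 - \<kappa>) ^ j * q K)"
      using decay[of j] qpos[of n] j by (intro mult_mono) (auto simp: less_imp_le)
    then show ?thesis using j by (simp add: e_def algebra_simps)
  qed
  then have "real l * mean_density g \<phi> * partition_fun g \<phi> ^ l
      \<le> real K * partition_fun g \<phi> ^ l + 1 / \<kappa>\<^sup>2 * q K"
    by (rule sums_le[OF _ S(2) sums_add[OF sums_mult[OF S(1)] e]])
  moreover have "q K \<le> partition_fun g \<phi> ^ l"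
    using sum_le_suminf[of q "{K}"] S(1) qpos by (auto simp: sums_iff less_imp_le)
  ultimately have "real l * mean_density g \<phi> * partition_fun g \<phi> ^ l
      \<le> (real K + 1 / \<kappa>\<^sup>2) * partition_fun g \<phi> ^ l"
    using mult_left_mono[of "q K" "partition_fun g \<phi> ^ l" "1 / \<kappa>\<^sup>2"] by (simp add: algebra_simps)
  moreover have "0 < partition_fun g \<phi> ^ l" using partition_fun_ge_1[OF dom] by simp
  ultimately have m: "real l * mean_density g \<phi> \<le> real K + 1 / \<kappa>\<^sup>2" by simp
  have "real l * (t * \<phi>) \<le> real l * (\<alpha> + mean_density g \<phi>)"
    by (intro mult_left_mono le dom) auto
  also have "\<dots> \<le> \<alpha> * real l + real K + 1 / \<kappa>\<^sup>2" using m by (simp add: algebra_simps)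
  finally have "real l * (t * \<phi>) * ?c K \<le> (\<alpha> * real l + real K + 1 / \<kappa>\<^sup>2) * ?c K"
    using cpos[of K] by (intro mult_right_mono) auto

  moreover have "t * (1 - \<kappa>) * real l * ?c (K - 1) = real l * (t * \<phi>) * ?c K"
  proof -
    have "t * (1 - \<kappa>) * real l * ?c (K - 1) = t * real l * ((1 - \<kappa>) * ?c (K - 1))"
      by (simp only: mult_ac)
    also have "\<dots> = t * real l * (\<phi> * ?c K)"
      using cpos[of K] by (simp add: \<phi>_def R_def)
    finally show ?thesis by (simp only: mult_ac)
  qed
  ultimately show ?thesis by (simp only:)
qed

end

section \<open>Configurations and their weights\<close>

text \<open>Configurations on \<open>{1..m}\<close> vanish outside, so that adding or removing a particle is a function
update; a set \<open>D\<close> of particle numbers covers both the sectors \<open>D = {K}\<close> and \<open>D = {..k}\<close>.\<close>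

definition configs :: "nat \<Rightarrow> nat set \<Rightarrow> (nat \<Rightarrow> nat) set" where
  "configs m D = {\<xi>. (\<forall>x. x \<notin> {1..m} \<longrightarrow> \<xi> x = 0) \<and> (\<Sum>x\<in>{1..m}. \<xi> x) \<in> D}"

definition add_particle :: "nat \<Rightarrow> (nat \<Rightarrow> nat) \<Rightarrow> nat \<Rightarrow> nat" where
  "add_particle x \<xi> = \<xi>(x := Suc (\<xi> x))"

lemma add_particle_commute: "add_particle x (add_particle y \<xi>) = add_particle y (add_particle x \<xi>)"
  by (auto simp: add_particle_def fun_eq_iff)

lemma add_particle_apply: "add_particle x \<xi> y = (if x = y then Suc (\<xi> y) else \<xi> y)"
  by (simp add: add_particle_def)

lemma sum_add_particle:
  assumes "x \<in> {1..m}"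
  shows "(\<Sum>y\<in>{1..m}. add_particle x \<xi> y) = Suc (\<Sum>y\<in>{1..m}. \<xi> y)"
proof -
  have "(\<Sum>y\<in>{1..m}. add_particle x \<xi> y) = (\<Sum>y\<in>{1..m}. \<xi> y + (if y = x then 1 else 0))"
    by (intro sum.cong) (auto simp: add_particle_apply)
  then show ?thesis using assms by (simp add: sum.distrib)
qed

lemma add_particle_in_configs:
  assumes "x \<in> {1..m}" "\<xi> \<in> configs m D" "\<And>n. n \<in> D \<Longrightarrow> Suc n \<in> D'"
  shows "add_particle x \<xi> \<in> configs m D'"
  unfolding configs_def mem_Collect_eq sum_add_particle[OF assms(1)]
  using assms by (auto simp: configs_def add_particle_apply)

lemma config_le_total:
  assumes "\<xi> \<in> configs m D" "\<And>n. n \<in> D \<Longrightarrow> n \<le> k"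
  shows "\<xi> x \<le> k"
proof (cases "x \<in> {1..m}")
  case True
  then have "\<xi> x \<le> (\<Sum>x\<in>{1..m}. \<xi> x)" by (intro member_le_sum) auto
  then show ?thesis using assms by (force simp: configs_def)
next
  case False
  then show ?thesis using assms by (auto simp: configs_def)
qed

lemma finite_configs: "finite D \<Longrightarrow> finite (configs m D)"
proof -
  assume "finite D"
  then obtain k where k: "\<And>n. n \<in> D \<Longrightarrow> n \<le> k" by (meson Max_ge)
  have "configs m D \<subseteq> {\<xi>. \<forall>x. (x \<in> {1..m} \<longrightarrow> \<xi> x \<in> {..k}) \<and> (x \<notin> {1..m} \<longrightarrow> \<xi> x = 0)}"
    using config_le_total[OF _ k] by (auto simp: configs_def)
  then show ?thesis by (rule finite_subset) (intro finite_set_of_finite_funs; simp)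
qed

lemma remove_particle:
  assumes "x \<in> {1..m}" "\<xi> \<in> configs m D'" "0 < \<xi> x" "\<And>n. Suc n \<in> D' \<Longrightarrow> n \<in> D"
  obtains \<zeta> where "\<zeta> \<in> configs m D" "\<xi> = add_particle x \<zeta>"
proof
  let ?\<zeta> = "\<xi>(x := \<xi> x - 1)"
  show eq: "\<xi> = add_particle x ?\<zeta>" using assms(3) by (auto simp: add_particle_def fun_eq_iff)
  have "Suc (\<Sum>y\<in>{1..m}. ?\<zeta> y) \<in> D'"
    using assms(2) sum_add_particle[OF assms(1), of ?\<zeta>] eq by (simp add: configs_def)
  then show "?\<zeta> \<in> configs m D" using assms by (auto simp: configs_def)
qed

context zero_range_rate
begin

text \<open>The grand canonical weights at fugacity \<open>1\<close>. They are never normalised; only finitely many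
configurations occur.\<close>

definition weight :: "nat \<Rightarrow> (nat \<Rightarrow> nat) \<Rightarrow> real" where
  "weight m \<xi> = (\<Prod>x\<in>{1..m}. 1 / g_fact g (\<xi> x))"

lemma weight_pos: "0 < weight m \<xi>"
  unfolding weight_def by (intro prod_pos) (simp add: g_fact_pos)

lemma weight_add_particle:
  assumes "x \<in> {1..m}"
  shows "weight m (add_particle x \<zeta>) * g (add_particle x \<zeta> x) = weight m \<zeta>"
proof -
  have "weight m \<xi> = 1 / g_fact g (\<xi> x) * (\<Prod>y\<in>{1..m} - {x}. 1 / g_fact g (\<xi> y))" for \<xi>
    unfolding weight_def using assms by (subst prod.remove[of _ x]) auto
  moreover have "(\<Prod>y\<in>{1..m} - {x}. 1 / g_fact g (add_particle x \<zeta> y)) = (\<Prod>y\<in>{1..m} - {x}. 1 / g_fact g (\<zeta> y))"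
    by (intro prod.cong) (auto simp: add_particle_apply)
  moreover have "(1 / a * P) * b = b / a * P" for a b P :: real by simp
  ultimately show ?thesis
    by (simp only: add_particle_apply if_True simp_thms g_weight_Suc)
qed

text \<open>The change of variables behind every integration by parts below.\<close>

lemma sum_configs_add_particle:
  assumes x: "x \<in> {1..m}" and "finite D" and D: "\<And>n. Suc n \<in> D' \<longleftrightarrow> n \<in> D" and "finite D'"
  shows "(\<Sum>\<xi>\<in>configs m D'. weight m \<xi> * g (\<xi> x) * G \<xi>)
       = (\<Sum>\<zeta>\<in>configs m D. weight m \<zeta> * G (add_particle x \<zeta>))"
proof -
  have inj: "inj_on (add_particle x) (configs m D)"
    by (rule inj_onI) (auto simp: add_particle_def fun_eq_iff split: if_splits)
  have sub: "add_particle x ` configs m D \<subseteq> configs m D'"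
    using add_particle_in_configs[OF x, of _ D D'] D by auto
  have "(\<Sum>\<xi>\<in>configs m D'. weight m \<xi> * g (\<xi> x) * G \<xi>)
      = (\<Sum>\<xi>\<in>add_particle x ` configs m D. weight m \<xi> * g (\<xi> x) * G \<xi>)"
  proof (rule sum.mono_neutral_right[OF finite_configs[OF \<open>finite D'\<close>] sub], intro ballI)
    fix \<xi> assume \<xi>: "\<xi> \<in> configs m D' - add_particle x ` configs m D"
    have "\<xi> x = 0"
    proof (rule ccontr)
      assume "\<xi> x \<noteq> 0"
      then obtain \<zeta> where "\<zeta> \<in> configs m D" "\<xi> = add_particle x \<zeta>"
        using remove_particle[OF x, of \<xi> D' D] \<xi> D by auto
      then show False using \<xi> by auto
    qed
    then show "weight m \<xi> * g (\<xi> x) * G \<xi> = 0" by simp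
  qed
  also have "\<dots> = (\<Sum>\<zeta>\<in>configs m D. weight m \<zeta> * G (add_particle x \<zeta>))"
    by (subst sum.reindex[OF inj]) (simp add: weight_add_particle[OF x])
  finally show ?thesis .
qed

lemma sum_weight_sector: "(\<Sum>\<xi>\<in>configs m {K}. weight m \<xi>) = conv_weight m K"
proof (induction m arbitrary: K)
  case 0
  have "configs 0 {K} = (if K = 0 then {\<lambda>_. 0} else {})" by (auto simp: configs_def)
  then show ?case by (simp add: weight_def)
next
  case (Suc m)
  have w: "weight (Suc m) \<xi> = weight m \<xi> / g_fact g (\<xi> (Suc m))" for \<xi>
    by (simp add: weight_def)
  have "(\<Sum>\<xi>\<in>configs (Suc m) {K}. weight (Suc m) \<xi>) =
     (\<Sum>(i, \<zeta>)\<in>(SIGMA i:{..K}. configs m {K - i}). weight m \<zeta> / g_fact g i)"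
  proof (rule sum.reindex_bij_witness[of _ "\<lambda>(i, \<zeta>). \<zeta>(Suc m := i)" "\<lambda>\<xi>. (\<xi> (Suc m), \<xi>(Suc m := 0))"])
    fix \<xi> assume \<xi>: "\<xi> \<in> configs (Suc m) {K}"
    show "(case (\<xi> (Suc m), \<xi>(Suc m := 0)) of (i, \<zeta>) \<Rightarrow> \<zeta>(Suc m := i)) = \<xi>" by auto
    have "(\<Sum>x\<in>{1..m}. (\<xi>(Suc m := 0)) x) = (\<Sum>x\<in>{1..m}. \<xi> x)" by (intro sum.cong) auto
    then show "(\<xi> (Suc m), \<xi>(Suc m := 0)) \<in> (SIGMA i:{..K}. configs m {K - i})"
      using \<xi> by (auto simp: configs_def)
    have "weight m (\<xi>(Suc m := 0)) = weight m \<xi>"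
      unfolding weight_def by (intro prod.cong) auto
    then show "(case (\<xi> (Suc m), \<xi>(Suc m := 0)) of (i, \<zeta>) \<Rightarrow> weight m \<zeta> / g_fact g i) = weight (Suc m) \<xi>"
      by (simp add: w)
  next
    fix b assume b: "b \<in> (SIGMA i:{..K}. configs m {K - i})"
    obtain i \<zeta> where [simp]: "b = (i, \<zeta>)" by (cases b)
    have z: "\<zeta> (Suc m) = 0" using b by (auto simp: configs_def)
    then show "((case b of (i, \<zeta>) \<Rightarrow> \<zeta>(Suc m := i)) (Suc m), (case b of (i, \<zeta>) \<Rightarrow> \<zeta>(Suc m := i))(Suc m := 0)) = b"
      by (auto simp: fun_eq_iff)
    have "(\<Sum>x\<in>{1..m}. (\<zeta>(Suc m := i)) x) = (\<Sum>x\<in>{1..m}. \<zeta> x)" by (intro sum.cong) auto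
    then show "(case b of (i, \<zeta>) \<Rightarrow> \<zeta>(Suc m := i)) \<in> configs (Suc m) {K}"
      using b by (auto simp: configs_def)
  qed
  also have "\<dots> = (\<Sum>i\<le>K. \<Sum>\<zeta>\<in>configs m {K - i}. weight m \<zeta> / g_fact g i)"
    by (subst sum.Sigma) (auto intro: finite_configs)
  also have "\<dots> = (\<Sum>i\<le>K. conv_weight m (K - i) / g_fact g i)"
    by (simp add: sum_divide_distrib[symmetric] Suc.IH)
  finally show ?case by simp
qed

end

section \<open>The process with exit and its comparison with the segment\<close>

locale zero_range_process = zero_range_rate +
  fixes p :: real
  assumes p: "1 / 2 < p" "p \<le> 1"
begin

definition jump_rate :: "bool \<times> nat \<Rightarrow> (nat \<Rightarrow> nat) \<Rightarrow> real" where
  "jump_rate i \<xi> = (if fst i then p else 1 - p) * g (\<xi> (snd i))"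

definition segment_moves :: "nat \<Rightarrow> (bool \<times> nat) set" where
  "segment_moves N = {True} \<times> {1..N - 1} \<union> {False} \<times> {2..N}"

definition segment_move :: "bool \<times> nat \<Rightarrow> (nat \<Rightarrow> nat) \<Rightarrow> nat \<Rightarrow> nat" where
  "segment_move i \<eta> = move (snd i) (if fst i then snd i + 1 else snd i - 1) \<eta>"

text \<open>In the process with exit a particle that jumps to the right from site \<open>m\<close> disappears.\<close>

definition exit_moves :: "nat \<Rightarrow> (bool \<times> nat) set" where
  "exit_moves m = {True} \<times> {1..m} \<union> {False} \<times> {2..m}"

definition exit_move :: "nat \<Rightarrow> bool \<times> nat \<Rightarrow> (nat \<Rightarrow> nat) \<Rightarrow> nat \<Rightarrow> nat" where
  "exit_move m i \<xi> = (if i = (True, m) then \<xi>(m := \<xi> m - 1) else segment_move i \<xi>)"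

abbreviation segment_gen :: "nat \<Rightarrow> ((nat \<Rightarrow> nat) \<Rightarrow> real) \<Rightarrow> (nat \<Rightarrow> nat) \<Rightarrow> real" where
  "segment_gen N \<equiv> jump_gen (segment_moves N) jump_rate segment_move"

abbreviation exit_gen :: "nat \<Rightarrow> ((nat \<Rightarrow> nat) \<Rightarrow> real) \<Rightarrow> (nat \<Rightarrow> nat) \<Rightarrow> real" where
  "exit_gen m \<equiv> jump_gen (exit_moves m) jump_rate (exit_move m)"

lemma zrp_generator_eq: "zrp_generator g p N = segment_gen N"
proof (intro ext)
  fix J :: "(nat \<Rightarrow> nat) \<Rightarrow> real" and \<eta>
  have "segment_gen N J \<eta> =
     (\<Sum>i\<in>{True} \<times> {1..N - 1}. jump_rate i \<eta> * (J (segment_move i \<eta>) - J \<eta>)) +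
     (\<Sum>i\<in>{False} \<times> {2..N}. jump_rate i \<eta> * (J (segment_move i \<eta>) - J \<eta>))"
    unfolding jump_gen_def segment_moves_def by (rule sum.union_disjoint) auto
  also have "(\<Sum>i\<in>{True} \<times> {1..N - 1}. jump_rate i \<eta> * (J (segment_move i \<eta>) - J \<eta>)) =
      (\<Sum>i\<in>{1..N - 1}. p * g (\<eta> i) * (J (move i (i + 1) \<eta>) - J \<eta>))"
    by (rule sum.reindex_bij_witness[of _ "Pair True" snd]) (auto simp: jump_rate_def segment_move_def)
  also have "(\<Sum>i\<in>{False} \<times> {2..N}. jump_rate i \<eta> * (J (segment_move i \<eta>) - J \<eta>)) =
      (\<Sum>i\<in>{2..N}. (1 - p) * g (\<eta> i) * (J (move i (i - 1) \<eta>) - J \<eta>))"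
    by (rule sum.reindex_bij_witness[of _ "Pair False" snd]) (auto simp: jump_rate_def segment_move_def)
  finally show "zrp_generator g p N J \<eta> = segment_gen N J \<eta>"
    by (simp add: zrp_generator_def)
qed

lemma jump_rate_nonneg: "0 \<le> jump_rate i \<xi>"
  using p g_nonneg by (simp add: jump_rate_def)

lemma jump_rate_nonzero: "jump_rate i \<xi> \<noteq> 0 \<Longrightarrow> 0 < \<xi> (snd i)"
  by (cases "\<xi> (snd i) = 0") (auto simp: jump_rate_def)

lemma total_jump_rate_le:
  assumes "\<And>n. g n \<le> C * real n" "I \<subseteq> UNIV \<times> {1..m}" "(\<Sum>x\<in>{1..m}. \<xi> x) \<le> k" "0 \<le> C"
  shows "(\<Sum>i\<in>I. jump_rate i \<xi>) \<le> C * real k"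
proof -
  have "(\<Sum>i\<in>I. jump_rate i \<xi>) \<le> (\<Sum>i\<in>UNIV \<times> {1..m}. jump_rate i \<xi>)"
    using assms by (intro sum_mono2) (auto simp: jump_rate_nonneg)
  also have "\<dots> = (\<Sum>b\<in>UNIV. \<Sum>x\<in>{1..m}. jump_rate (b, x) \<xi>)"
    by (subst sum.Sigma) auto
  also have "\<dots> = (\<Sum>x\<in>{1..m}. g (\<xi> x))"
    by (simp add: UNIV_bool jump_rate_def sum.distrib[symmetric] algebra_simps)
  also have "\<dots> \<le> (\<Sum>x\<in>{1..m}. C * real (\<xi> x))" by (intro sum_mono assms)
  also have "\<dots> = C * real (\<Sum>x\<in>{1..m}. \<xi> x)" by (simp add: sum_distrib_left)
  also have "\<dots> \<le> C * real k"
    using assms(3,4) by (intro mult_left_mono) (simp_all only: of_nat_le_iff)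
  finally show ?thesis .
qed

lemma exit_move_add_particle:
  assumes "(b, x) \<in> exit_moves m"
  shows "exit_move m (b, x) (add_particle x \<zeta>) =
     (if b then if x = m then \<zeta> else add_particle (x + 1) \<zeta> else add_particle (x - 1) \<zeta>)"
  using assms by (auto simp: exit_moves_def exit_move_def segment_move_def move_def add_particle_def fun_eq_iff)

lemma exit_move_cases:
  assumes "(b, x) \<in> exit_moves m"
  obtains "\<And>\<zeta>. exit_move m (b, x) (add_particle x \<zeta>) = \<zeta>"
  | z where "z \<in> {1..m}" "\<And>\<zeta>. exit_move m (b, x) (add_particle x \<zeta>) = add_particle z \<zeta>"
proof (cases "b \<and> x = m")
  case True
  then show ?thesis using that(1) exit_move_add_particle[OF assms] by simp
next
  case False
  have eq: "exit_move m (b, x) (add_particle x \<zeta>) = add_particle (if b then x + 1 else x - 1) \<zeta>" for \<zeta>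
    using False exit_move_add_particle[OF assms] by simp
  have "(if b then x + 1 else x - 1) \<in> {1..m}"
    using False assms by (cases b) (auto simp: exit_moves_def)
  then show ?thesis using eq by (rule that(2))
qed

lemma exit_moves_site: "(b, x) \<in> exit_moves m \<Longrightarrow> x \<in> {1..m}"
  by (auto simp: exit_moves_def)

lemma finite_exit_moves: "finite (exit_moves m)"
  by (simp add: exit_moves_def)

lemma exit_process:
  assumes C: "\<And>n. g n \<le> C * real n" "0 < C"
  shows "jump_process (exit_moves m) jump_rate (exit_move m) (configs m {..k}) (C * real (Suc k))"
proof
  show "finite (configs m {..k})" by (simp add: finite_configs)
  show "0 < C * real (Suc k)" using C by simp
next
  fix i \<xi> assume i: "i \<in> exit_moves m" and \<xi>: "\<xi> \<in> configs m {..k}" and "jump_rate i \<xi> \<noteq> 0"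
  obtain b x where [simp]: "i = (b, x)" by (cases i)
  have x: "x \<in> {1..m}" "0 < \<xi> x"
    using i jump_rate_nonzero[OF \<open>jump_rate i \<xi> \<noteq> 0\<close>] by (auto simp: exit_moves_def)
  obtain \<zeta> where \<zeta>: "\<zeta> \<in> configs m {..<k}" "\<xi> = add_particle x \<zeta>"
    using remove_particle[OF x(1) \<xi> x(2), of "{..<k}"] by auto
  have *: "add_particle z \<zeta> \<in> configs m {..k}" if "z \<in> {1..m}" for z
    by (rule add_particle_in_configs[OF that \<zeta>(1)]) auto
  have **: "\<zeta> \<in> configs m {..k}" using \<zeta>(1) by (auto simp: configs_def)
  have "(b, x) \<in> exit_moves m" using i by simp
  then show "exit_move m i \<xi> \<in> configs m {..k}"
    by (cases rule: exit_move_cases) (simp_all add: \<zeta>(2) * **)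
next
  fix \<xi> assume "\<xi> \<in> configs m {..k}"
  then have "(\<Sum>i\<in>exit_moves m. jump_rate i \<xi>) \<le> C * real k"
    using C by (intro total_jump_rate_le[of _ _ m]) (auto simp: exit_moves_def configs_def)
  also have "\<dots> \<le> C * real (Suc k)" using C by simp
  finally show "(\<Sum>i\<in>exit_moves m. jump_rate i \<xi>) \<le> C * real (Suc k)" .
qed (simp add: jump_rate_nonneg)

lemma move_in_zrp_configs:
  assumes "\<eta> \<in> zrp_configs N k" "x \<in> {1..N}" "y \<in> {1..N}" "x \<noteq> y" "0 < \<eta> x"
  shows "move x y \<eta> \<in> zrp_configs N k"
proof -
  have "(\<Sum>i\<in>{1..N}. move x y \<eta> i) + (\<Sum>i\<in>{1..N}. if i = x then 1 else 0) =
        (\<Sum>i\<in>{1..N}. \<eta> i) + (\<Sum>i\<in>{1..N}. if i = y then 1 else 0)"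
    unfolding sum.distrib[symmetric] using assms by (intro sum.cong) (auto simp: move_def)
  then have "(\<Sum>i\<in>{1..N}. move x y \<eta> i) = (\<Sum>i\<in>{1..N}. \<eta> i)" using assms by simp
  then show ?thesis using assms by (auto simp: zrp_configs_def PiE_iff extensional_def move_def)
qed

lemma finite_zrp_configs: "finite (zrp_configs N k)"
proof -
  have "zrp_configs N k \<subseteq> {1..N} \<rightarrow>\<^sub>E {..k}"
  proof
    fix \<eta> assume \<eta>: "\<eta> \<in> zrp_configs N k"
    have "\<eta> x \<le> k" if "x \<in> {1..N}" for x
      using member_le_sum[OF that, of \<eta>] \<eta> by (auto simp: zrp_configs_def)
    then show "\<eta> \<in> {1..N} \<rightarrow>\<^sub>E {..k}" using \<eta> by (auto simp: zrp_configs_def PiE_iff)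
  qed
  then show ?thesis by (rule finite_subset) (simp add: finite_PiE)
qed

lemma segment_process:
  assumes C: "\<And>n. g n \<le> C * real n" "0 < C"
  shows "jump_process (segment_moves N) jump_rate segment_move (zrp_configs N k) (C * real (Suc k))"
proof
  show "finite (zrp_configs N k)" by (rule finite_zrp_configs)
  show "0 < C * real (Suc k)" using C by simp
next
  fix i \<xi> assume "i \<in> segment_moves N" "\<xi> \<in> zrp_configs N k" "jump_rate i \<xi> \<noteq> 0"
  then show "segment_move i \<xi> \<in> zrp_configs N k"
    using jump_rate_nonzero[of i \<xi>]
    by (auto simp: segment_moves_def segment_move_def intro!: move_in_zrp_configs)
next
  fix \<xi> assume "\<xi> \<in> zrp_configs N k"
  then have "(\<Sum>i\<in>segment_moves N. jump_rate i \<xi>) \<le> C * real k"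
    using C by (intro total_jump_rate_le[of _ _ N]) (auto simp: segment_moves_def zrp_configs_def)
  also have "\<dots> \<le> C * real (Suc k)" using C by simp
  finally show "(\<Sum>i\<in>segment_moves N. jump_rate i \<xi>) \<le> C * real (Suc k)" .
qed (simp add: jump_rate_nonneg)

text \<open>Antitone in the number of particles at each site, for configurations of at most \<open>k\<close>
particles.\<close>

definition decreasing_on :: "nat \<Rightarrow> nat \<Rightarrow> ((nat \<Rightarrow> nat) \<Rightarrow> real) \<Rightarrow> bool" where
  "decreasing_on m k F \<longleftrightarrow> (\<forall>\<zeta>\<in>configs m {..<k}. \<forall>x\<in>{1..m}. F (add_particle x \<zeta>) \<le> F \<zeta>)"

text \<open>Attractiveness. Since \<open>g\<close> is nondecreasing, the process with an additional particle can be coupled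
to the one without it.\<close>

lemma decreasing_on_uniformized:
  assumes C: "\<And>n. g n \<le> C * real n" "0 < C" and F: "decreasing_on m k F"
  shows "decreasing_on m k (uniformized (C * real (Suc k)) (exit_gen m) F)"
  unfolding decreasing_on_def
proof (intro ballI)
  fix \<xi> x assume \<xi>: "\<xi> \<in> configs m {..<k}" and x: "x \<in> {1..m}"
  let ?\<Lambda> = "C * real (Suc k)" and ?\<xi>' = "add_particle x \<xi>"
  have \<xi>': "?\<xi>' \<in> configs m {..k}" by (rule add_particle_in_configs[OF x \<xi>]) auto
  have dec: "F (add_particle y \<zeta>) \<le> F \<zeta>" if "\<zeta> \<in> configs m {..<k}" "y \<in> {1..m}" for y \<zeta>
    using F that by (auto simp: decreasing_on_def)
  have \<Lambda>: "0 < ?\<Lambda>" using C by simp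
  \<comment> \<open>Couple the two configurations: a jump of rate \<open>jump_rate i \<xi>\<close> is made by both, and the
    excess rate moves the additional particle only.\<close>
  have coupled: "jump_rate i ?\<xi>' * (F (exit_move m i ?\<xi>') - F ?\<xi>')
     \<le> jump_rate i \<xi> * (F (exit_move m i \<xi>) - F \<xi>) + jump_rate i ?\<xi>' * (F \<xi> - F ?\<xi>')"
    if i: "i \<in> exit_moves m" for i
  proof -
    obtain b y where [simp]: "i = (b, y)" by (cases i)
    have y: "y \<in> {1..m}" using i by (auto simp: exit_moves_def)
    have by_move: "(b, y) \<in> exit_moves m" using i by simp
    have r: "jump_rate i \<xi> \<le> jump_rate i ?\<xi>'"
      using p by (auto simp: jump_rate_def add_particle_apply intro!: mult_left_mono g_mono)
    have 1: "(jump_rate i ?\<xi>' - jump_rate i \<xi>) * (F (exit_move m i ?\<xi>') - F \<xi>) \<le> 0"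
    proof (cases "y = x")
      case True
      have "F (exit_move m i ?\<xi>') \<le> F \<xi>"
        using by_move by (cases rule: exit_move_cases) (simp_all add: True[symmetric] dec[OF \<xi>])
      then show ?thesis using r by (intro mult_nonneg_nonpos) auto
    next
      case False
      then show ?thesis by (simp add: jump_rate_def add_particle_apply)
    qed
    have 2: "jump_rate i \<xi> * (F (exit_move m i ?\<xi>') - F (exit_move m i \<xi>)) \<le> 0"
    proof (cases "jump_rate i \<xi> = 0")
      case False
      then have "0 < \<xi> y" using jump_rate_nonzero[of i \<xi>] by simp
      then obtain \<zeta> where \<zeta>: "\<zeta> \<in> configs m {..<k - 1}" "\<xi> = add_particle y \<zeta>"
        by (rule remove_particle[OF y \<xi>, where D = "{..<k - 1}"]) auto
      have eq: "?\<xi>' = add_particle y (add_particle x \<zeta>)"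
        unfolding \<zeta> by (rule add_particle_commute)
      have \<zeta>k: "\<zeta> \<in> configs m {..<k}" and z: "add_particle z \<zeta> \<in> configs m {..<k}" if "z \<in> {1..m}" for z
        using \<zeta>(1) that add_particle_in_configs[of z m \<zeta> "{..<k - 1}" "{..<k}"] by (auto simp: configs_def)
      have "F (exit_move m i ?\<xi>') \<le> F (exit_move m i \<xi>)"
        using by_move unfolding eq unfolding \<zeta>(2)
      proof (cases rule: exit_move_cases)
        case 1
        then show "F (exit_move m i (add_particle y (add_particle x \<zeta>))) \<le> F (exit_move m i (add_particle y \<zeta>))"
          using dec[OF \<zeta>k[OF x] x] by simp
      next
        case (2 w)
        then show "F (exit_move m i (add_particle y (add_particle x \<zeta>))) \<le> F (exit_move m i (add_particle y \<zeta>))"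
          using dec[OF z[OF 2(1)] x] by (simp add: add_particle_commute[of w x])
      qed
      then show ?thesis using jump_rate_nonneg[of i \<xi>] by (intro mult_nonneg_nonpos) auto
    qed simp
    show ?thesis using 1 2 by (simp add: algebra_simps)
  qed
  have "exit_gen m F ?\<xi>' \<le> exit_gen m F \<xi> + (\<Sum>i\<in>exit_moves m. jump_rate i ?\<xi>') * (F \<xi> - F ?\<xi>')"
    unfolding jump_gen_def sum_distrib_right sum.distrib[symmetric] by (rule sum_mono) (rule coupled)
  also have "\<dots> \<le> exit_gen m F \<xi> + ?\<Lambda> * (F \<xi> - F ?\<xi>')"
    using jump_process.rate_le[OF exit_process[OF C] \<xi>'] dec[OF \<xi> x]
    by (intro add_left_mono mult_right_mono) auto
  finally have "(exit_gen m F ?\<xi>' - exit_gen m F \<xi>) / ?\<Lambda> \<le> F \<xi> - F ?\<xi>'"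
    using \<Lambda> by (subst pos_divide_le_eq) (auto simp: mult.commute)
  then show "uniformized ?\<Lambda> (exit_gen m) F ?\<xi>' \<le> uniformized ?\<Lambda> (exit_gen m) F \<xi>"
    by (simp add: uniformized_def diff_divide_distrib)
qed

definition restriction :: "nat \<Rightarrow> (nat \<Rightarrow> nat) \<Rightarrow> nat \<Rightarrow> nat" where
  "restriction m \<eta> x = (if x \<in> {1..m} then \<eta> x else 0)"

lemma restriction_in_configs:
  assumes "\<eta> \<in> zrp_configs N k" "m \<le> N"
  shows "restriction m \<eta> \<in> configs m {..k}"
proof -
  have "(\<Sum>x\<in>{1..m}. restriction m \<eta> x) = (\<Sum>x\<in>{1..m}. \<eta> x)"
    by (intro sum.cong) (auto simp: restriction_def)
  also have "\<dots> \<le> (\<Sum>x\<in>{1..N}. \<eta> x)" using assms by (intro sum_mono2) auto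
  finally show ?thesis using assms by (auto simp: configs_def zrp_configs_def restriction_def)
qed

text \<open>The only transitions of the segment that the process with exit lacks, and that are visible in
\<open>{1..m}\<close>, insert a particle at \<open>m\<close>.\<close>

lemma segment_gen_restriction_le:
  assumes F: "decreasing_on m k F" and \<eta>: "\<eta> \<in> zrp_configs N k" and m: "1 \<le> m" "m < N"
  shows "segment_gen N (\<lambda>\<eta>. F (restriction m \<eta>)) \<eta> \<le> exit_gen m F (restriction m \<eta>)"
proof -
  let ?f = "\<lambda>i. jump_rate i \<eta> * (F (restriction m (segment_move i \<eta>)) - F (restriction m \<eta>))"
  have fin: "finite (segment_moves N)" by (simp add: segment_moves_def)
  have sub: "exit_moves m \<subseteq> segment_moves N"
    using m by (auto simp: exit_moves_def segment_moves_def)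
  have neg: "?f i \<le> 0" if i: "i \<in> segment_moves N - exit_moves m" for i
  proof (cases "jump_rate i \<eta> = 0 \<or> i \<noteq> (False, m + 1)")
    case True
    have "restriction m (segment_move i \<eta>) = restriction m \<eta>" if "i \<noteq> (False, m + 1)"
      using i that
      by (auto simp: segment_moves_def exit_moves_def restriction_def segment_move_def move_def fun_eq_iff)
    then show ?thesis using True by auto
  next
    case False
    then have pos: "0 < \<eta> (m + 1)" using jump_rate_nonzero[of i \<eta>] by auto
    have "(\<Sum>x\<in>{1..m}. restriction m \<eta> x) = (\<Sum>x\<in>{1..m}. \<eta> x)"
      by (intro sum.cong) (auto simp: restriction_def)
    also have "\<dots> < (\<Sum>x\<in>{1..m + 1}. \<eta> x)" using pos by simp
    also have "\<dots> \<le> (\<Sum>x\<in>{1..N}. \<eta> x)" using m by (intro sum_mono2) auto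
    finally have "restriction m \<eta> \<in> configs m {..<k}"
      using \<eta> by (auto simp: configs_def zrp_configs_def restriction_def)
    moreover have "restriction m (segment_move i \<eta>) = add_particle m (restriction m \<eta>)"
      using False m by (auto simp: restriction_def segment_move_def move_def add_particle_def fun_eq_iff)
    ultimately have "F (restriction m (segment_move i \<eta>)) \<le> F (restriction m \<eta>)"
      using F m by (auto simp: decreasing_on_def)
    then show ?thesis using jump_rate_nonneg[of i \<eta>] by (intro mult_nonneg_nonpos) auto
  qed
  have "segment_gen N (\<lambda>\<eta>. F (restriction m \<eta>)) \<eta> = sum ?f (segment_moves N - exit_moves m) + sum ?f (exit_moves m)"
    unfolding jump_gen_def by (rule sum.subset_diff[OF sub fin])
  also have "\<dots> \<le> sum ?f (exit_moves m)"
    using sum_nonpos[of "segment_moves N - exit_moves m" ?f, OF neg] by linarith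
  also have "\<dots> = exit_gen m F (restriction m \<eta>)"
    unfolding jump_gen_def
  proof (rule sum.cong[OF refl])
    fix i assume i: "i \<in> exit_moves m"
    have "jump_rate i (restriction m \<eta>) = jump_rate i \<eta>"
      using i by (auto simp: exit_moves_def jump_rate_def restriction_def)
    moreover have "restriction m (segment_move i \<eta>) = exit_move m i (restriction m \<eta>)"
    proof
      fix z
      obtain b x where bx: "i = (b, x)" by (cases i)
      show "restriction m (segment_move i \<eta>) z = exit_move m i (restriction m \<eta>) z"
      proof (cases b)
        case True
        then show ?thesis
          using i unfolding bx exit_moves_def
          by (cases "x = m") (auto simp: exit_move_def segment_move_def restriction_def move_def)
      next
        case False
        then show ?thesis
          using i unfolding bx exit_moves_def
          by (auto simp: exit_move_def segment_move_def restriction_def move_def)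
      qed
    qed
    ultimately show "?f i = jump_rate i (restriction m \<eta>) *
        (F (exit_move m i (restriction m \<eta>)) - F (restriction m \<eta>))" by simp
  qed
  finally show ?thesis .
qed

definition empty_indicator :: "(nat \<Rightarrow> nat) \<Rightarrow> real" where
  "empty_indicator \<xi> = (if \<xi> = (\<lambda>_. 0) then 1 else 0)"

definition emptying_prob :: "nat \<Rightarrow> real \<Rightarrow> (nat \<Rightarrow> nat) \<Rightarrow> real" where
  "emptying_prob m t \<xi> = gen_exp (exit_gen m) t empty_indicator \<xi>"

lemma segment_le_emptying_prob:
  assumes \<eta>: "\<eta> \<in> zrp_configs N k" and m: "1 \<le> m" "m < N" and "0 \<le> t"
  shows "gen_exp (segment_gen N) t (\<lambda>\<eta>. empty_indicator (restriction m \<eta>)) \<eta>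
     \<le> emptying_prob m t (restriction m \<eta>)"
proof -
  obtain C where C: "\<And>n. g n \<le> C * real n" "0 < C" using g_linear_bound by blast
  let ?\<Lambda> = "C * real (Suc k)"
  let ?Q = "uniformized ?\<Lambda> (segment_gen N)" and ?Q' = "uniformized ?\<Lambda> (exit_gen m)"
  interpret seg: jump_process "segment_moves N" jump_rate segment_move "zrp_configs N k" ?\<Lambda>
    by (rule segment_process[OF C])
  have dec: "decreasing_on m k ((?Q' ^^ n) empty_indicator)" for n
  proof (induction n)
    case 0
    have "add_particle x \<zeta> \<noteq> (\<lambda>_. 0)" for x \<zeta> by (auto simp: add_particle_def fun_eq_iff)
    then show ?case by (auto simp: decreasing_on_def empty_indicator_def)
  next
    case (Suc n)
    then show ?case using decreasing_on_uniformized[OF C] by simp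
  qed
  have "(?Q ^^ n) (\<lambda>\<eta>. empty_indicator (restriction m \<eta>)) \<eta> \<le> (?Q' ^^ n) empty_indicator (restriction m \<eta>)"
    if "\<eta> \<in> zrp_configs N k" for n \<eta>
    using that
  proof (induction n arbitrary: \<eta>)
    case (Suc n)
    let ?F = "(?Q' ^^ n) empty_indicator"
    have "(?Q ^^ Suc n) (\<lambda>\<eta>. empty_indicator (restriction m \<eta>)) \<eta> \<le> ?Q (\<lambda>\<eta>. ?F (restriction m \<eta>)) \<eta>"
      unfolding funpow.simps o_apply by (rule seg.uniformized_mono) (use Suc in simp_all)
    also have "\<dots> = ?F (restriction m \<eta>) + segment_gen N (\<lambda>\<eta>. ?F (restriction m \<eta>)) \<eta> / ?\<Lambda>"
      by (rule uniformized_def)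
    also have "\<dots> \<le> ?F (restriction m \<eta>) + exit_gen m ?F (restriction m \<eta>) / ?\<Lambda>"
      by (rule add_left_mono, rule divide_right_mono[OF segment_gen_restriction_le[OF dec[of n] Suc.prems m]])
         (use C in simp)
    also have "\<dots> = ?Q' ?F (restriction m \<eta>)" by (rule uniformized_def[symmetric])
    finally show ?case by simp
  qed simp
  note le = this
  have r: "restriction m \<eta> \<in> configs m {..k}" using restriction_in_configs[OF \<eta>] m by simp
  show ?thesis
    unfolding emptying_prob_def
    by (rule semigroup_le_semigroup[where f = "restriction m",
          OF segment_process[OF C, of N k] exit_process[OF C, of m k] le \<eta> r \<open>0 \<le> t\<close>])
qed

end

section \<open>The local inequality on a block\<close>

lemma move_add_particle: "x \<noteq> y \<Longrightarrow> move x y (add_particle x \<zeta>) = add_particle y \<zeta>"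
  by (auto simp: move_def add_particle_def fun_eq_iff)

lemma move_in_configs:
  assumes "\<xi> \<in> configs m D" "0 < \<xi> x" "x \<in> {1..m}" "y \<in> {1..m}" "x \<noteq> y"
  shows "move x y \<xi> \<in> configs m D"
proof -
  obtain \<zeta> where \<zeta>: "\<zeta> \<in> configs m {n. Suc n \<in> D}" "\<xi> = add_particle x \<zeta>"
    using remove_particle[OF assms(3,1,2), of "{n. Suc n \<in> D}"] by auto
  have "add_particle y \<zeta> \<in> configs m D"
    by (rule add_particle_in_configs[OF assms(4) \<zeta>(1)]) auto
  then show ?thesis using assms(5) by (simp add: \<zeta>(2) move_add_particle)
qed

lemma sum_configs_sectors:
  "(\<Sum>\<xi>\<in>configs m {..k}. f \<xi>) = (\<Sum>K\<le>k. \<Sum>\<xi>\<in>configs m {K}. f \<xi>)"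
proof -
  have "configs m {..k} = (\<Union>K\<in>{..k}. configs m {K})" by (auto simp: configs_def)
  then show ?thesis
    by (simp, intro sum.UNION_disjoint) (auto simp: finite_configs, auto simp: configs_def)
qed

context zero_range_rate
begin

text \<open>The Dirichlet form of the jumps to the right inside a block.\<close>

definition energy :: "nat \<Rightarrow> nat set \<Rightarrow> ((nat \<Rightarrow> nat) \<Rightarrow> real) \<Rightarrow> real" where
  "energy l D R = (\<Sum>\<xi>\<in>configs l D. \<Sum>x\<in>{1..<l}.
     weight l \<xi> * g (\<xi> x) * (R \<xi> - R (move x (x + 1) \<xi>))\<^sup>2)"

lemma energy_nonneg: "0 \<le> energy l D R"
  unfolding energy_def
  by (intro sum_nonneg mult_nonneg_nonneg) (auto intro: less_imp_le[OF weight_pos] g_nonneg)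

lemma difference_le_energy:
  assumes "finite D" "\<xi> \<in> configs l D" "x \<in> {1..<l}" "0 < \<xi> x"
  shows "(R \<xi> - R (move x (x + 1) \<xi>))\<^sup>2 \<le> 1 / (weight l \<xi> * g (\<xi> x)) * energy l D R"
proof -
  let ?e = "\<lambda>\<xi> x. weight l \<xi> * g (\<xi> x) * (R \<xi> - R (move x (x + 1) \<xi>))\<^sup>2"
  have nn: "0 \<le> ?e \<xi> x" for \<xi> x
    by (intro mult_nonneg_nonneg) (auto intro: less_imp_le[OF weight_pos] g_nonneg)
  have "?e \<xi> x \<le> (\<Sum>x\<in>{1..<l}. ?e \<xi> x)"
    by (rule member_le_sum[of _ _ "?e \<xi>"]) (use assms nn in auto)
  also have "\<dots> \<le> energy l D R" unfolding energy_def
    by (rule member_le_sum[of \<xi> _ "\<lambda>\<xi>. \<Sum>x\<in>{1..<l}. ?e \<xi> x"])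
       (use assms nn finite_configs in \<open>auto intro: sum_nonneg\<close>)
  finally have "?e \<xi> x \<le> energy l D R" .
  moreover have "0 < weight l \<xi> * g (\<xi> x)" using assms weight_pos g_pos by simp
  ultimately show ?thesis by (simp add: pos_le_divide_eq mult.commute)
qed

text \<open>Moving all particles to the right end of the block, one jump at a time, connects every
configuration with the one that has all \<open>K\<close> particles at \<open>l\<close>. Constants may depend on the sector, as
the block is fixed while the system grows.\<close>

lemma pointwise_poincare:
  assumes l: "0 < l" and \<sigma>: "\<sigma> \<in> configs l {K}"
  shows "\<exists>C\<ge>0. \<forall>R. (R \<sigma> - R ((\<lambda>_. 0)(l := K)))\<^sup>2 \<le> C * energy l {K} R"
  using \<sigma>
proof (induction "\<Sum>x\<in>{1..l}. (l - x) * \<sigma> x" arbitrary: \<sigma> rule: less_induct)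
  case (less \<sigma>)
  show ?case
  proof (cases "\<exists>x\<in>{1..<l}. 0 < \<sigma> x")
    case True
    then obtain x where x: "x \<in> {1..<l}" "0 < \<sigma> x" by blast
    let ?\<sigma>' = "move x (x + 1) \<sigma>"
    have in': "?\<sigma>' \<in> configs l {K}" by (rule move_in_configs) (use less x in auto)
    obtain \<zeta> where \<zeta>: "\<sigma> = add_particle x \<zeta>"
      by (rule remove_particle[of x l \<sigma> "{K}" UNIV]) (use less.prems x in auto)
    have pot: "(\<Sum>z\<in>{1..l}. (l - z) * add_particle y \<zeta> z) = (\<Sum>z\<in>{1..l}. (l - z) * \<zeta> z) + (l - y)"
      if "y \<in> {1..l}" for y
    proof -
      have "(\<Sum>z\<in>{1..l}. (l - z) * add_particle y \<zeta> z)
          = (\<Sum>z\<in>{1..l}. (l - z) * \<zeta> z + (if z = y then l - y else 0))"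
        by (intro sum.cong) (auto simp: add_particle_apply)
      then show ?thesis using that by (simp add: sum.distrib)
    qed
    have "?\<sigma>' = add_particle (x + 1) \<zeta>" unfolding \<zeta> by (rule move_add_particle) simp
    then have "(\<Sum>z\<in>{1..l}. (l - z) * ?\<sigma>' z) < (\<Sum>z\<in>{1..l}. (l - z) * \<sigma> z)"
      using x pot[of x] pot[of "x + 1"] \<zeta> by auto
    from less.hyps[OF this in'] obtain C where C: "0 \<le> C"
      "\<And>R. (R ?\<sigma>' - R ((\<lambda>_. 0)(l := K)))\<^sup>2 \<le> C * energy l {K} R" by auto
    let ?c = "1 / (weight l \<sigma> * g (\<sigma> x))"
    have "(R \<sigma> - R ((\<lambda>_. 0)(l := K)))\<^sup>2 \<le> (2 * ?c + 2 * C) * energy l {K} R" for R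
    proof -
      have "(a + b)\<^sup>2 \<le> 2 * a\<^sup>2 + 2 * b\<^sup>2" for a b :: real
        using zero_le_power2[of "a - b"] by (simp add: power2_sum power2_diff)
      from this[of "R \<sigma> - R ?\<sigma>'" "R ?\<sigma>' - R ((\<lambda>_. 0)(l := K))"]
      have "(R \<sigma> - R ((\<lambda>_. 0)(l := K)))\<^sup>2 \<le> 2 * (R \<sigma> - R ?\<sigma>')\<^sup>2 + 2 * (R ?\<sigma>' - R ((\<lambda>_. 0)(l := K)))\<^sup>2"
        by simp
      also have "\<dots> \<le> 2 * (?c * energy l {K} R) + 2 * (C * energy l {K} R)"
        using C(2)[of R] difference_le_energy[of "{K}" \<sigma> l x R] less.prems x by auto
      finally show ?thesis by (simp only: distrib_right mult.assoc)
    qed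
    moreover have "0 \<le> 2 * ?c + 2 * C"
      using C weight_pos[of l \<sigma>] g_nonneg[of "\<sigma> x"] by simp
    ultimately show ?thesis by blast
  next
    case False
    then have z: "\<sigma> x = 0" if "x \<noteq> l" for x
      using that less.prems by (cases "x \<in> {1..l}") (auto simp: configs_def)
    have "(\<Sum>x\<in>{1..l}. \<sigma> x) = (\<Sum>x\<in>{1..l}. if x = l then \<sigma> l else 0)"
      by (intro sum.cong) (auto simp: z)
    then have "\<sigma> l = K" using less.prems l by (simp add: configs_def)
    then have "\<sigma> = (\<lambda>_. 0)(l := K)" using z by auto
    then show ?thesis by (intro exI[of _ 0]) auto
  qed
qed

text \<open>If the energy is small, \<open>R\<close> is nearly equal on the whole sector to its value at a reference
configuration; the mean of \<open>V\<close> being below \<open>s\<close> by a margin \<open>\<eta>\<close> then decides. The margin absorbs the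
cross term of the expansion of the square.\<close>

lemma sector_inequality:
  assumes l: "0 < l" and \<eta>: "0 < \<eta>"
    and mean: "(\<Sum>\<xi>\<in>configs l {K}. weight l \<xi> * V \<xi>) \<le> (s - \<eta>) * (\<Sum>\<xi>\<in>configs l {K}. weight l \<xi>)"
  shows "\<exists>\<Gamma>\<ge>0. \<forall>R. (\<Sum>\<xi>\<in>configs l {K}. weight l \<xi> * (R \<xi>)\<^sup>2 * (V \<xi> - s)) \<le> \<Gamma> * energy l {K} R"
proof -
  let ?S = "configs l {K}" and ?o = "(\<lambda>_. 0)(l := K)" and ?w = "weight l"
  have fin: "finite ?S" by (simp add: finite_configs)
  have "\<forall>\<sigma>\<in>?S. \<exists>C. 0 \<le> C \<and> (\<forall>R. (R \<sigma> - R ?o)\<^sup>2 \<le> C * energy l {K} R)"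
    using pointwise_poincare[OF l] by (intro ballI)
  from bchoice[OF this] obtain c where c: "\<And>\<sigma>. \<sigma> \<in> ?S \<Longrightarrow> 0 \<le> c \<sigma>"
     "\<And>\<sigma> R. \<sigma> \<in> ?S \<Longrightarrow> (R \<sigma> - R ?o)\<^sup>2 \<le> c \<sigma> * energy l {K} R"
    by blast
  define A where "A = (\<Sum>\<xi>\<in>?S. \<bar>V \<xi> - s\<bar>)"
  have A: "\<bar>V \<xi> - s\<bar> \<le> A" if "\<xi> \<in> ?S" for \<xi>
    unfolding A_def by (rule member_le_sum[of _ _ "\<lambda>\<xi>. \<bar>V \<xi> - s\<bar>"]) (use that fin in auto)
  have A0: "0 \<le> A" by (simp add: A_def sum_nonneg)
  define B where "B = A\<^sup>2 / \<eta> + A"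
  have B0: "0 \<le> B" using A0 \<eta> by (simp add: B_def)
  define \<Gamma> where "\<Gamma> = (\<Sum>\<xi>\<in>?S. ?w \<xi> * (B * c \<xi>))"
  have "0 \<le> \<Gamma>" unfolding \<Gamma>_def
    by (intro sum_nonneg mult_nonneg_nonneg less_imp_le[OF weight_pos] B0 c)
  moreover have "(\<Sum>\<xi>\<in>?S. ?w \<xi> * (R \<xi>)\<^sup>2 * (V \<xi> - s)) \<le> \<Gamma> * energy l {K} R" for R
  proof -
    have pt: "(R \<xi>)\<^sup>2 * (V \<xi> - s) \<le> (R ?o)\<^sup>2 * (V \<xi> - s + \<eta>) + B * (R \<xi> - R ?o)\<^sup>2" if \<xi>: "\<xi> \<in> ?S" for \<xi>
    proof -
      define a e v where "a = R ?o" and "e = R \<xi> - R ?o" and "v = V \<xi> - s"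
      have R: "R \<xi> = a + e" by (simp add: a_def e_def)
      have v: "\<bar>v\<bar> \<le> A" using A[OF \<xi>] by (simp add: v_def)
      have "0 \<le> (\<eta> * a - e * v)\<^sup>2 / \<eta>" using \<eta> by simp
      also have "\<dots> = \<eta> * a\<^sup>2 - 2 * a * e * v + e\<^sup>2 * v\<^sup>2 / \<eta>"
        using \<eta> by (simp add: power2_eq_square field_simps)
      finally have "2 * a * e * v \<le> \<eta> * a\<^sup>2 + e\<^sup>2 * v\<^sup>2 / \<eta>" by simp
      also have "e\<^sup>2 * v\<^sup>2 / \<eta> \<le> e\<^sup>2 * A\<^sup>2 / \<eta>"
        using v \<eta> by (intro divide_right_mono mult_left_mono) (auto simp: abs_le_square_iff[symmetric])
      finally have 1: "2 * a * e * v \<le> \<eta> * a\<^sup>2 + e\<^sup>2 * A\<^sup>2 / \<eta>" by simp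
      have 2: "e\<^sup>2 * v \<le> e\<^sup>2 * A" using v by (intro mult_left_mono) auto
      have "(a + e)\<^sup>2 * v = a\<^sup>2 * v + 2 * a * e * v + e\<^sup>2 * v"
        by (simp add: power2_eq_square algebra_simps)
      also have "\<dots> \<le> a\<^sup>2 * (v + \<eta>) + B * e\<^sup>2"
        using 1 2 by (simp add: B_def algebra_simps)
      finally show ?thesis unfolding R by (simp add: a_def e_def v_def)
    qed
    have "(\<Sum>\<xi>\<in>?S. ?w \<xi> * (R \<xi>)\<^sup>2 * (V \<xi> - s))
       \<le> (\<Sum>\<xi>\<in>?S. (R ?o)\<^sup>2 * (?w \<xi> * V \<xi> - (s - \<eta>) * ?w \<xi>) + ?w \<xi> * (B * c \<xi>) * energy l {K} R)"
    proof (rule sum_mono)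
      fix \<xi> assume \<xi>: "\<xi> \<in> ?S"
      have "(R \<xi>)\<^sup>2 * (V \<xi> - s) \<le> (R ?o)\<^sup>2 * (V \<xi> - s + \<eta>) + B * (c \<xi> * energy l {K} R)"
        using pt[OF \<xi>] mult_left_mono[OF c(2)[OF \<xi>, of R] B0] by linarith
      from mult_left_mono[OF this less_imp_le[OF weight_pos[of l \<xi>]]]
      show "?w \<xi> * (R \<xi>)\<^sup>2 * (V \<xi> - s) \<le> (R ?o)\<^sup>2 * (?w \<xi> * V \<xi> - (s - \<eta>) * ?w \<xi>) + ?w \<xi> * (B * c \<xi>) * energy l {K} R"
        by (simp add: algebra_simps)
    qed
    also have "\<dots> = (R ?o)\<^sup>2 * ((\<Sum>\<xi>\<in>?S. ?w \<xi> * V \<xi>) - (s - \<eta>) * (\<Sum>\<xi>\<in>?S. ?w \<xi>)) + \<Gamma> * energy l {K} R"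
      unfolding \<Gamma>_def
      by (simp add: sum.distrib sum_subtractf sum_distrib_right sum_distrib_left[symmetric])
    also have "\<dots> \<le> \<Gamma> * energy l {K} R"
      using mult_nonneg_nonpos[of "(R ?o)\<^sup>2" "(\<Sum>\<xi>\<in>?S. ?w \<xi> * V \<xi>) - (s - \<eta>) * (\<Sum>\<xi>\<in>?S. ?w \<xi>)"] mean
      by simp
    finally show ?thesis .
  qed
  ultimately show ?thesis by blast
qed

text \<open>Only finitely many sectors need the energy, so one constant serves all of them.\<close>

lemma sectors_inequality:
  assumes l: "0 < l" and \<eta>: "0 < \<eta>"
    and mean: "\<And>K. (\<Sum>\<xi>\<in>configs l {K}. weight l \<xi> * V \<xi>) \<le> (s - \<eta>) * (\<Sum>\<xi>\<in>configs l {K}. weight l \<xi>)"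
    and large: "\<And>K \<xi>. K0 \<le> K \<Longrightarrow> \<xi> \<in> configs l {K} \<Longrightarrow> V \<xi> \<le> s"
  shows "\<exists>\<Gamma>\<ge>0. \<forall>k R. (\<Sum>\<xi>\<in>configs l {..k}. weight l \<xi> * (R \<xi>)\<^sup>2 * (V \<xi> - s)) \<le> \<Gamma> * energy l {..k} R"
proof -
  have "\<forall>K. \<exists>\<Gamma>. 0 \<le> \<Gamma> \<and> (\<forall>R. (\<Sum>\<xi>\<in>configs l {K}. weight l \<xi> * (R \<xi>)\<^sup>2 * (V \<xi> - s)) \<le> \<Gamma> * energy l {K} R)"
    using sector_inequality[OF l \<eta> mean] by (intro allI)
  from choice[OF this] obtain G where G: "\<And>K. 0 \<le> G K"
    "\<And>K R. (\<Sum>\<xi>\<in>configs l {K}. weight l \<xi> * (R \<xi>)\<^sup>2 * (V \<xi> - s)) \<le> G K * energy l {K} R"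
    by blast
  define \<Gamma> where "\<Gamma> = sum G {..K0}"
  have \<Gamma>: "0 \<le> \<Gamma>" by (simp add: \<Gamma>_def sum_nonneg G)
  have one: "(\<Sum>\<xi>\<in>configs l {K}. weight l \<xi> * (R \<xi>)\<^sup>2 * (V \<xi> - s)) \<le> \<Gamma> * energy l {K} R" for K R
  proof (cases "K \<le> K0")
    case True
    have "G K \<le> \<Gamma>" unfolding \<Gamma>_def by (rule member_le_sum) (use True G in auto)
    then show ?thesis using G(2)[where K = K and R = R] mult_right_mono[OF _ energy_nonneg[of l "{K}" R]] by fastforce
  next
    case False
    have "(\<Sum>\<xi>\<in>configs l {K}. weight l \<xi> * (R \<xi>)\<^sup>2 * (V \<xi> - s)) \<le> 0"
    proof (intro sum_nonpos mult_nonneg_nonpos)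
      fix \<xi> assume "\<xi> \<in> configs l {K}"
      then show "V \<xi> - s \<le> 0" using large[of K \<xi>] False by simp
    qed (auto intro!: mult_nonneg_nonneg less_imp_le[OF weight_pos])
    then show ?thesis using mult_nonneg_nonneg[OF \<Gamma> energy_nonneg[of l "{K}" R]] by linarith
  qed
  have "(\<Sum>\<xi>\<in>configs l {..k}. weight l \<xi> * (R \<xi>)\<^sup>2 * (V \<xi> - s)) \<le> \<Gamma> * energy l {..k} R" for k R
    unfolding energy_def sum_configs_sectors sum_distrib_left[of \<Gamma> _ "{..k}"]
    unfolding energy_def[symmetric] by (rule sum_mono) (rule one)
  then show ?thesis using \<Gamma> by blast
qed

text \<open>For \<open>\<gamma> = (2 * p - 1) / v\<close> this is the current in the frame of a front of speed \<open>v\<close>, summed over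
\<open>B\<close> and divided by \<open>v\<close>. A larger \<open>\<gamma>\<close> leaves room for error terms.\<close>

definition excess :: "real \<Rightarrow> nat set \<Rightarrow> (nat \<Rightarrow> nat) \<Rightarrow> real" where
  "excess \<gamma> B \<xi> = (\<Sum>x\<in>B. \<gamma> * g (\<xi> x) - real (\<xi> x))"

text \<open>The slack between \<open>\<gamma>\<close> and \<open>t\<close> pays for all losses: for the error of the equivalence of ensembles
on a large block, and, through the same bound on a single site, for the sectors with many
particles, since \<open>\<gamma> * g n \<le> r * n + c'\<close> for some \<open>r < 1\<close> and some constant \<open>c'\<close>.\<close>

lemma local_inequality:
  assumes le: "\<And>\<phi>. \<phi> \<in> fugacities \<Longrightarrow> t * \<phi> \<le> \<alpha> + mean_density g \<phi>"
    and \<alpha>: "0 < \<alpha>" and \<gamma>: "0 < \<gamma>" "\<gamma> < t"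
  shows "\<exists>l>0. \<exists>\<rho>>0. \<rho> < 1 \<and> (\<exists>\<Gamma>\<ge>0. \<forall>k R. (\<Sum>\<xi>\<in>configs l {..k}. weight l \<xi> * (R \<xi>)\<^sup>2 *
           (excess \<gamma> {1..l} \<xi> - \<rho> * \<alpha> * real l)) \<le> \<Gamma> * energy l {..k} R)"
proof -
  define \<kappa> where "\<kappa> = (1 - \<gamma> / t) / 2"
  have t: "0 < t" using \<gamma> by simp
  have "\<gamma> / t < 1" "0 < \<gamma> / t" using \<gamma> t by auto
  then have \<kappa>: "0 < \<kappa>" "\<kappa> < 1" by (auto simp: \<kappa>_def)
  define c where "c = 1 / \<kappa>\<^sup>2"
  have c: "0 < c" using \<kappa> by (simp add: c_def)
  define r where "r = \<gamma> / (t * (1 - \<kappa>))"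
  have "t * (1 - \<kappa>) = (t + \<gamma>) / 2" using t by (simp add: \<kappa>_def field_simps)
  then have r: "0 < r" "r < 1" using \<gamma> by (auto simp: r_def divide_simps)
  have can: "\<gamma> * real l * conv_weight l (K - 1) \<le> r * (\<alpha> * real l + real K + c) * conv_weight l K"
    if "0 < l" "0 < K" for l K
  proof -
    have "r * (t * (1 - \<kappa>) * real l * conv_weight l (K - 1)) \<le> r * ((\<alpha> * real l + real K + c) * conv_weight l K)"
      using canonical_rate_bound[OF le t \<kappa> that] r by (intro mult_left_mono) (auto simp: c_def)
    moreover have "r * (t * (1 - \<kappa>)) = \<gamma>" using t \<kappa> by (simp add: r_def)
    ultimately show ?thesis by (simp add: mult.assoc[symmetric])
  qed
  have site: "\<gamma> * g n \<le> r * (\<alpha> + real n + c)" for n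
  proof (cases n)
    case (Suc n')
    have cw: "conv_weight 1 i = 1 / g_fact g i" for i
    proof -
      have "conv_weight 1 i = (\<Sum>j\<le>i. if j = i then 1 / g_fact g i else 0)"
        unfolding One_nat_def conv_weight.simps by (intro sum.cong) auto
      then show ?thesis by simp
    qed
    have "\<gamma> * (1 / g_fact g n') \<le> r * (\<alpha> + real n + c) * (1 / g_fact g n)"
      using can[of 1 n] Suc unfolding cw by simp
    then have "\<gamma> * (g n * (1 / g_fact g n)) \<le> r * (\<alpha> + real n + c) * (1 / g_fact g n)"
      using g_weight_Suc[of n'] Suc by simp
    then show ?thesis using g_fact_pos[of n] by (simp add: divide_le_cancel mult.assoc[symmetric])
  qed (use \<alpha> c r in simp)
  obtain l :: nat where "2 * r * c / ((1 - r) * \<alpha>) < real l" using reals_Archimedean2 by blast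
  then have l: "2 * r * c < (1 - r) * \<alpha> * real l"
    using \<alpha> r by (simp add: pos_divide_less_eq mult.commute)
  have l0: "0 < l" using l r c by (cases l) (auto simp: mult_less_0_iff not_less)
  define \<rho>0 where "\<rho>0 = (1 + r) / 2"
  define \<rho> where "\<rho> = (1 + \<rho>0) / 2"
  have \<rho>: "0 < \<rho>0" "\<rho>0 < \<rho>" "\<rho> < 1" using r by (auto simp: \<rho>_def \<rho>0_def)
  define \<eta> where "\<eta> = (\<rho> - \<rho>0) * \<alpha> * real l"
  have \<eta>: "0 < \<eta>" using \<rho> \<alpha> l0 by (simp add: \<eta>_def)
  have s\<eta>: "\<rho> * \<alpha> * real l - \<eta> = \<rho>0 * \<alpha> * real l" by (simp add: \<eta>_def algebra_simps)
  have mean: "(\<Sum>\<xi>\<in>configs l {K}. weight l \<xi> * excess \<gamma> {1..l} \<xi>)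
     \<le> (\<rho> * \<alpha> * real l - \<eta>) * (\<Sum>\<xi>\<in>configs l {K}. weight l \<xi>)" for K
  proof -
    have "(\<Sum>\<xi>\<in>configs l {K}. weight l \<xi> * excess \<gamma> {1..l} \<xi>)
      = (\<Sum>\<xi>\<in>configs l {K}. \<Sum>x\<in>{1..l}. \<gamma> * (weight l \<xi> * g (\<xi> x) * 1))
       - (\<Sum>\<xi>\<in>configs l {K}. weight l \<xi> * (\<Sum>x\<in>{1..l}. real (\<xi> x)))"
      unfolding excess_def sum_subtractf[symmetric]
      by (simp add: sum_subtractf sum_distrib_left right_diff_distrib mult_ac)
    also have "(\<Sum>\<xi>\<in>configs l {K}. weight l \<xi> * (\<Sum>x\<in>{1..l}. real (\<xi> x))) = real K * conv_weight l K"
      unfolding sum_weight_sector[symmetric] sum_distrib_left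
      by (intro sum.cong refl) (auto simp: configs_def simp flip: of_nat_sum sum_distrib_left)
    also have "(\<Sum>\<xi>\<in>configs l {K}. \<Sum>x\<in>{1..l}. \<gamma> * (weight l \<xi> * g (\<xi> x) * 1))
       = (\<Sum>x\<in>{1..l}. \<gamma> * (\<Sum>\<xi>\<in>configs l {K}. weight l \<xi> * g (\<xi> x) * 1))"
      by (subst sum.swap) (simp add: sum_distrib_left)
    finally have eq: "(\<Sum>\<xi>\<in>configs l {K}. weight l \<xi> * excess \<gamma> {1..l} \<xi>) =
       (\<Sum>x\<in>{1..l}. \<gamma> * (\<Sum>\<xi>\<in>configs l {K}. weight l \<xi> * g (\<xi> x) * 1)) - real K * conv_weight l K" .
    show ?thesis
    proof (cases "K = 0")
      case True
      have "(\<Sum>\<xi>\<in>configs l {K}. weight l \<xi> * g (\<xi> x) * 1) = 0" for x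
      proof (intro sum.neutral ballI)
        fix \<xi> assume "\<xi> \<in> configs l {K}"
        then have "\<xi> x = 0" using config_le_total[of \<xi> l "{K}" 0 x] True by simp
        then show "weight l \<xi> * g (\<xi> x) * 1 = 0" by simp
      qed
      then have "(\<Sum>\<xi>\<in>configs l {K}. weight l \<xi> * excess \<gamma> {1..l} \<xi>) = 0"
        unfolding eq using True by simp
      then show ?thesis unfolding s\<eta>
        using \<rho> \<alpha> by (simp add: sum_nonneg less_imp_le[OF weight_pos])
    next
      case False
      have "(\<Sum>\<xi>\<in>configs l {K}. weight l \<xi> * g (\<xi> x) * 1) = (\<Sum>\<zeta>\<in>configs l {K - 1}. weight l \<zeta> * 1)"
        if "x \<in> {1..l}" for x
        by (rule sum_configs_add_particle[OF that]) (use False in auto)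
      then have "(\<Sum>\<xi>\<in>configs l {K}. weight l \<xi> * excess \<gamma> {1..l} \<xi>)
          = \<gamma> * real l * conv_weight l (K - 1) - real K * conv_weight l K"
        unfolding eq by (simp add: sum_weight_sector)
      also have "\<dots> \<le> r * (\<alpha> * real l + real K + c) * conv_weight l K - real K * conv_weight l K"
        using can[OF l0, of K] False by simp
      also have "\<dots> = (r * \<alpha> * real l + r * c - (1 - r) * real K) * conv_weight l K"
        by (simp add: algebra_simps)
      also have "\<dots> \<le> (\<rho>0 * \<alpha> * real l) * conv_weight l K"
      proof (rule mult_right_mono[OF _ conv_weight_nonneg])
        have "0 \<le> (1 - r) * real K" using r by simp
        moreover have "\<rho>0 * \<alpha> * real l = r * \<alpha> * real l + (1 - r) * \<alpha> * real l / 2"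
          by (simp add: \<rho>0_def field_simps)
        ultimately show "r * \<alpha> * real l + r * c - (1 - r) * real K \<le> \<rho>0 * \<alpha> * real l"
          using l by linarith
      qed
      finally show ?thesis unfolding s\<eta> sum_weight_sector .
    qed
  qed
  obtain K0 :: nat where "real l * r * (\<alpha> + c) / (1 - r) < real K0" using reals_Archimedean2 by blast
  then have K0: "real l * r * (\<alpha> + c) < (1 - r) * real K0"
    using r by (simp add: pos_divide_less_eq mult.commute)
  have large: "excess \<gamma> {1..l} \<xi> \<le> \<rho> * \<alpha> * real l" if K: "K0 \<le> K" and \<xi>: "\<xi> \<in> configs l {K}" for K \<xi>
  proof -
    have "excess \<gamma> {1..l} \<xi> \<le> (\<Sum>x\<in>{1..l}. r * (\<alpha> + c) - (1 - r) * real (\<xi> x))"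
      unfolding excess_def
    proof (rule sum_mono)
      fix x show "\<gamma> * g (\<xi> x) - real (\<xi> x) \<le> r * (\<alpha> + c) - (1 - r) * real (\<xi> x)"
        using site[of "\<xi> x"] by (simp add: algebra_simps)
    qed
    also have "\<dots> = real l * r * (\<alpha> + c) - (1 - r) * (\<Sum>x\<in>{1..l}. real (\<xi> x))"
      by (simp add: sum_subtractf sum_distrib_left)
    also have "(\<Sum>x\<in>{1..l}. real (\<xi> x)) = real K"
      using \<xi> by (auto simp: configs_def simp flip: of_nat_sum)
    also have "real l * r * (\<alpha> + c) - (1 - r) * real K \<le> 0"
    proof -
      have "(1 - r) * real K0 \<le> (1 - r) * real K"
        using K r by (intro mult_left_mono) auto
      then show ?thesis using K0 by linarith
    qed
    also have "0 \<le> \<rho> * \<alpha> * real l" using \<rho> \<alpha> by simp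
    finally show ?thesis .
  qed
  have \<rho>0: "0 < \<rho>" using \<rho> by simp
  have loc: "\<exists>\<Gamma>\<ge>0. \<forall>k R. (\<Sum>\<xi>\<in>configs l {..k}. weight l \<xi> * (R \<xi>)\<^sup>2 *
           (excess \<gamma> {1..l} \<xi> - \<rho> * \<alpha> * real l)) \<le> \<Gamma> * energy l {..k} R"
    by (rule sectors_inequality[OF l0 \<eta> mean large])
  show ?thesis
    by (rule exI[of _ l], rule conjI[OF l0], rule exI[of _ \<rho>], rule conjI[OF \<rho>0],
        rule conjI[OF \<rho>(3)], rule loc)
qed

section \<open>Blocks inside a larger system\<close>

text \<open>The configuration \<open>\<omega>\<close> with the sites \<open>y + 1, \<dots>, y + l\<close> replaced by those of \<open>\<sigma>\<close>.\<close>

definition insert_block :: "nat \<Rightarrow> nat \<Rightarrow> (nat \<Rightarrow> nat) \<Rightarrow> (nat \<Rightarrow> nat) \<Rightarrow> nat \<Rightarrow> nat" where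
  "insert_block y l \<omega> \<sigma> x = (if x \<in> {1 + y..l + y} then \<sigma> (x - y) else \<omega> x)"

lemma sum_insert_block:
  assumes B: "{1 + y..l + y} \<subseteq> {1..m}" and \<omega>: "\<And>x. x \<in> {1 + y..l + y} \<Longrightarrow> \<omega> x = 0"
  shows "(\<Sum>x\<in>{1..m}. insert_block y l \<omega> \<sigma> x) = (\<Sum>x\<in>{1..m}. \<omega> x) + (\<Sum>x\<in>{1..l}. \<sigma> x)"
proof -
  let ?B = "{1 + y..l + y}"
  have "(\<Sum>x\<in>{1..m}. insert_block y l \<omega> \<sigma> x)
     = (\<Sum>x\<in>{1..m} - ?B. insert_block y l \<omega> \<sigma> x) + (\<Sum>x\<in>?B. insert_block y l \<omega> \<sigma> x)"
    by (rule sum.subset_diff[OF B]) simp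
  also have "(\<Sum>x\<in>?B. insert_block y l \<omega> \<sigma> x) = (\<Sum>x\<in>{1..l}. \<sigma> x)"
    unfolding sum.shift_bounds_cl_nat_ivl by (intro sum.cong) (auto simp: insert_block_def)
  also have "(\<Sum>x\<in>{1..m} - ?B. insert_block y l \<omega> \<sigma> x) = (\<Sum>x\<in>{1..m} - ?B. \<omega> x)"
    by (intro sum.cong) (auto simp: insert_block_def)
  also have "\<dots> = (\<Sum>x\<in>{1..m}. \<omega> x)"
    using \<omega> by (intro sum.mono_neutral_left) auto
  finally show ?thesis .
qed

lemma sum_configs_blocks:
  assumes B: "{1 + y..l + y} \<subseteq> {1..m}"
  shows "(\<Sum>\<xi>\<in>configs m {..k}. f \<xi>) =
    (\<Sum>\<omega>\<in>{\<omega> \<in> configs m {..k}. \<forall>x\<in>{1 + y..l + y}. \<omega> x = 0}.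
       \<Sum>\<sigma>\<in>configs l {..k - (\<Sum>x\<in>{1..m}. \<omega> x)}. f (insert_block y l \<omega> \<sigma>))"
proof -
  let ?B = "{1 + y..l + y}"
  let ?O = "{\<omega> \<in> configs m {..k}. \<forall>x\<in>?B. \<omega> x = 0}"
  let ?clear = "\<lambda>\<xi> x. if x \<in> ?B then 0 else \<xi> x" and ?blk = "\<lambda>\<xi> x. if x \<in> {1..l} then \<xi> (x + y) else 0"
  have finO: "finite ?O" by (simp add: finite_configs)
  have ins: "insert_block y l (?clear \<xi>) (?blk \<xi>) = \<xi>" for \<xi> :: "nat \<Rightarrow> nat"
    by (auto simp: insert_block_def fun_eq_iff)
  have "(\<Sum>\<xi>\<in>configs m {..k}. f \<xi>) =
     (\<Sum>(\<omega>, \<sigma>)\<in>(SIGMA \<omega>:?O. configs l {..k - (\<Sum>x\<in>{1..m}. \<omega> x)}). f (insert_block y l \<omega> \<sigma>))"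
  proof (rule sum.reindex_bij_witness[of _ "\<lambda>(\<omega>, \<sigma>). insert_block y l \<omega> \<sigma>" "\<lambda>\<xi>. (?clear \<xi>, ?blk \<xi>)"])
    fix \<xi> assume \<xi>: "\<xi> \<in> configs m {..k}"
    show "(case (?clear \<xi>, ?blk \<xi>) of (\<omega>, \<sigma>) \<Rightarrow> insert_block y l \<omega> \<sigma>) = \<xi>" by (simp only: prod.case ins)
    show "(case (?clear \<xi>, ?blk \<xi>) of (\<omega>, \<sigma>) \<Rightarrow> f (insert_block y l \<omega> \<sigma>)) = f \<xi>" by (simp only: prod.case ins)
    have "(\<Sum>x\<in>{1..m}. \<xi> x) = (\<Sum>x\<in>{1..m}. ?clear \<xi> x) + (\<Sum>x\<in>{1..l}. ?blk \<xi> x)"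
      using sum_insert_block[OF B, of "?clear \<xi>" "?blk \<xi>"] unfolding ins by auto
    then show "(?clear \<xi>, ?blk \<xi>) \<in> (SIGMA \<omega>:?O. configs l {..k - (\<Sum>x\<in>{1..m}. \<omega> x)})"
      using \<xi> by (auto simp: configs_def)
  next
    fix b assume b: "b \<in> (SIGMA \<omega>:?O. configs l {..k - (\<Sum>x\<in>{1..m}. \<omega> x)})"
    obtain \<omega> \<sigma> where bb: "b = (\<omega>, \<sigma>)" by (cases b)
    note b = b[unfolded bb]
    have \<omega>: "\<And>x. x \<in> ?B \<Longrightarrow> \<omega> x = 0" and \<omega>': "\<And>x. x \<notin> {1..m} \<Longrightarrow> \<omega> x = 0"
      and \<sigma>: "\<And>x. x \<notin> {1..l} \<Longrightarrow> \<sigma> x = 0"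
      and tot: "(\<Sum>x\<in>{1..m}. \<omega> x) \<le> k" "(\<Sum>x\<in>{1..l}. \<sigma> x) \<le> k - (\<Sum>x\<in>{1..m}. \<omega> x)"
      using b by (auto simp: configs_def)
    have 1: "?clear (insert_block y l \<omega> \<sigma>) = \<omega>" using \<omega> by (auto simp: insert_block_def fun_eq_iff)
    have 2: "?blk (insert_block y l \<omega> \<sigma>) = \<sigma>" using \<sigma> by (auto simp: insert_block_def fun_eq_iff)
    show "(?clear (case b of (\<omega>, \<sigma>) \<Rightarrow> insert_block y l \<omega> \<sigma>), ?blk (case b of (\<omega>, \<sigma>) \<Rightarrow> insert_block y l \<omega> \<sigma>)) = b"
      unfolding bb prod.case 1 2 by (rule refl)
    have "(\<Sum>x\<in>{1..m}. insert_block y l \<omega> \<sigma> x) \<le> k"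
      using sum_insert_block[OF B, of \<omega> \<sigma>] \<omega> tot by simp
    moreover have "insert_block y l \<omega> \<sigma> x = 0" if "x \<notin> {1..m}" for x
      using that B \<omega>' by (auto simp: insert_block_def)
    ultimately show "(case b of (\<omega>, \<sigma>) \<Rightarrow> insert_block y l \<omega> \<sigma>) \<in> configs m {..k}"
      by (simp add: configs_def bb)
  qed
  also have "\<dots> = (\<Sum>\<omega>\<in>?O. \<Sum>\<sigma>\<in>configs l {..k - (\<Sum>x\<in>{1..m}. \<omega> x)}. f (insert_block y l \<omega> \<sigma>))"
    by (subst sum.Sigma[OF finO]) (auto intro: finite_configs)
  finally show ?thesis .
qed

lemma weight_insert_block:
  assumes B: "{1 + y..l + y} \<subseteq> {1..m}"
  shows "weight m (insert_block y l \<omega> \<sigma>)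
     = (\<Prod>x\<in>{1..m} - {1 + y..l + y}. 1 / g_fact g (\<omega> x)) * weight l \<sigma>"
proof -
  let ?B = "{1 + y..l + y}" and ?f = "\<lambda>x. 1 / g_fact g (insert_block y l \<omega> \<sigma> x)"
  have "weight m (insert_block y l \<omega> \<sigma>) = prod ?f ({1..m} - ?B) * prod ?f ?B"
    unfolding weight_def by (rule prod.subset_diff[OF B]) simp
  also have "prod ?f ?B = weight l \<sigma>"
    unfolding weight_def prod.shift_bounds_cl_nat_ivl
    by (intro prod.cong) (auto simp: insert_block_def)
  also have "prod ?f ({1..m} - ?B) = (\<Prod>x\<in>{1..m} - ?B. 1 / g_fact g (\<omega> x))"
    by (intro prod.cong) (auto simp: insert_block_def)
  finally show ?thesis .
qed

text \<open>The weights are products, so the local inequality holds conditionally on the configuration outside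
the block.\<close>

lemma block_inequality:
  assumes B: "{1 + y..l + y} \<subseteq> {1..m}"
    and loc: "\<And>k R. (\<Sum>\<sigma>\<in>configs l {..k}. weight l \<sigma> * (R \<sigma>)\<^sup>2 * (excess \<gamma> {1..l} \<sigma> - s))
       \<le> \<Gamma> * energy l {..k} R"
  shows "(\<Sum>\<xi>\<in>configs m {..k}. weight m \<xi> * (r \<xi>)\<^sup>2 * (excess \<gamma> {1 + y..l + y} \<xi> - s))
     \<le> \<Gamma> * (\<Sum>\<xi>\<in>configs m {..k}. \<Sum>x\<in>{1 + y..<l + y}.
             weight m \<xi> * g (\<xi> x) * (r \<xi> - r (move x (x + 1) \<xi>))\<^sup>2)"
  unfolding sum_configs_blocks[OF B] sum_distrib_left[of \<Gamma> _ "{\<omega> \<in> configs m {..k}. \<forall>x\<in>{1 + y..l + y}. \<omega> x = 0}"]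
proof (rule sum_mono)
  fix \<omega> assume \<omega>: "\<omega> \<in> {\<omega> \<in> configs m {..k}. \<forall>x\<in>{1 + y..l + y}. \<omega> x = 0}"
  let ?S = "configs l {..k - (\<Sum>x\<in>{1..m}. \<omega> x)}" and ?i = "insert_block y l \<omega>"
  define c where "c = (\<Prod>x\<in>{1..m} - {1 + y..l + y}. 1 / g_fact g (\<omega> x))"
  have c: "0 \<le> c" unfolding c_def by (intro prod_nonneg) (simp add: less_imp_le[OF g_fact_pos])
  have w: "weight m (?i \<sigma>) = c * weight l \<sigma>" for \<sigma>
    unfolding c_def by (rule weight_insert_block[OF B])
  have ex: "excess \<gamma> {1 + y..l + y} (?i \<sigma>) = excess \<gamma> {1..l} \<sigma>" for \<sigma>
    unfolding excess_def sum.shift_bounds_cl_nat_ivl by (intro sum.cong) (auto simp: insert_block_def)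
  have mv: "move (x + y) (x + y + 1) (?i \<sigma>) = ?i (move x (x + 1) \<sigma>)" if "x \<in> {1..<l}" for x \<sigma>
    using that by (auto simp: move_def insert_block_def fun_eq_iff)
  have "(\<Sum>\<sigma>\<in>?S. weight m (?i \<sigma>) * (r (?i \<sigma>))\<^sup>2 * (excess \<gamma> {1 + y..l + y} (?i \<sigma>) - s))
     = c * (\<Sum>\<sigma>\<in>?S. weight l \<sigma> * (r (?i \<sigma>))\<^sup>2 * (excess \<gamma> {1..l} \<sigma> - s))"
    unfolding w ex sum_distrib_left by (intro sum.cong) (auto simp: mult_ac)
  also have "\<dots> \<le> c * (\<Gamma> * energy l {..k - (\<Sum>x\<in>{1..m}. \<omega> x)} (\<lambda>\<sigma>. r (?i \<sigma>)))"
    by (intro mult_left_mono loc c)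
  also have "\<dots> = \<Gamma> * (\<Sum>\<sigma>\<in>?S. \<Sum>x\<in>{1..<l}. c * (weight l \<sigma> * g (\<sigma> x) * (r (?i \<sigma>) - r (?i (move x (x + 1) \<sigma>)))\<^sup>2))"
    unfolding energy_def sum_distrib_left by (simp only: mult_ac)
  also have "(\<Sum>\<sigma>\<in>?S. \<Sum>x\<in>{1..<l}. c * (weight l \<sigma> * g (\<sigma> x) * (r (?i \<sigma>) - r (?i (move x (x + 1) \<sigma>)))\<^sup>2))
    = (\<Sum>\<sigma>\<in>?S. \<Sum>x\<in>{1 + y..<l + y}. weight m (?i \<sigma>) * g (?i \<sigma> x) * (r (?i \<sigma>) - r (move x (x + 1) (?i \<sigma>)))\<^sup>2)"
    unfolding sum.shift_bounds_nat_ivl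
    by (intro sum.cong refl) (auto simp: w mv[simplified] insert_block_def[of y l \<omega> _ "_ + y"])
  finally show "(\<Sum>\<sigma>\<in>?S. weight m (?i \<sigma>) * (r (?i \<sigma>))\<^sup>2 * (excess \<gamma> {1 + y..l + y} (?i \<sigma>) - s))
    \<le> \<Gamma> * (\<Sum>\<sigma>\<in>?S. \<Sum>x\<in>{1 + y..<l + y}. weight m (?i \<sigma>) * g (?i \<sigma> x) * (r (?i \<sigma>) - r (move x (x + 1) (?i \<sigma>)))\<^sup>2)" .
qed

end

section \<open>The moving front\<close>

text \<open>The logistic profile. Its slopes at neighbouring sites differ by a factor of at most \<open>exp \<epsilon>\<close>, so
they are nearly the same on a whole block, and there is no boundary effect at the ends of the front.\<close>

definition front :: "real \<Rightarrow> real \<Rightarrow> real" where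
  "front \<epsilon> y = 1 / (1 + exp (\<epsilon> * y))"

definition front_slope :: "real \<Rightarrow> real \<Rightarrow> real" where
  "front_slope \<epsilon> y = exp (\<epsilon> * y) / (1 + exp (\<epsilon> * y))\<^sup>2"

lemma one_plus_exp_pos: "0 < 1 + exp (x::real)"
  by (simp add: add_pos_pos)

lemma front_nonneg: "0 \<le> front \<epsilon> y"
  using one_plus_exp_pos[of "\<epsilon> * y"] by (simp add: front_def)

lemma front_le_exp: "front \<epsilon> y \<le> exp (- \<epsilon> * y)"
  unfolding front_def using one_plus_exp_pos[of "\<epsilon> * y"]
  by (simp add: exp_minus divide_simps)

lemma front_ge: "1 - exp (\<epsilon> * y) \<le> front \<epsilon> y"
proof -
  have "(1 - exp (\<epsilon> * y)) * (1 + exp (\<epsilon> * y)) \<le> 1" by (simp add: algebra_simps)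
  then show ?thesis unfolding front_def using one_plus_exp_pos[of "\<epsilon> * y"]
    by (simp add: pos_le_divide_eq)
qed

lemma front_antimono: "0 \<le> \<epsilon> \<Longrightarrow> y \<le> z \<Longrightarrow> front \<epsilon> z \<le> front \<epsilon> y"
  unfolding front_def
  by (intro divide_left_mono mult_pos_pos one_plus_exp_pos) (auto intro: mult_left_mono)

lemma front_slope_pos: "0 < front_slope \<epsilon> y"
  using one_plus_exp_pos[of "\<epsilon> * y"] by (simp add: front_slope_def)

lemma front_slope_le_1: "front_slope \<epsilon> y \<le> 1"
proof -
  have "exp (\<epsilon> * y) \<le> (1 + exp (\<epsilon> * y))\<^sup>2" by (simp add: power2_eq_square algebra_simps)
  then show ?thesis unfolding front_slope_def using one_plus_exp_pos[of "\<epsilon> * y"] by simp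
qed

lemma front_has_derivative:
  "((\<lambda>\<sigma>. front \<epsilon> (c - v * \<sigma>)) has_real_derivative v * \<epsilon> * front_slope \<epsilon> (c - v * \<sigma>)) (at \<sigma>)"
  unfolding front_def front_slope_def
  using one_plus_exp_pos[of "\<epsilon> * (c - v * \<sigma>)"]
  by (auto intro!: derivative_eq_intros simp: power2_eq_square field_simps)

lemma front_difference:
  "front \<epsilon> y - front \<epsilon> (y + 1) = exp (\<epsilon> * y) * (exp \<epsilon> - 1) / ((1 + exp (\<epsilon> * y)) * (1 + exp (\<epsilon> * y) * exp \<epsilon>))"
proof -
  have "exp (\<epsilon> * (y + 1)) = exp (\<epsilon> * y) * exp \<epsilon>" by (simp add: algebra_simps exp_add)
  moreover have "0 < 1 + exp (\<epsilon> * y)" "0 < 1 + exp (\<epsilon> * y) * exp \<epsilon>"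
    by (auto intro: add_pos_pos)
  ultimately show ?thesis unfolding front_def by (simp add: field_simps)
qed

lemma front_difference_bounds:
  assumes "0 \<le> \<epsilon>"
  shows "front \<epsilon> y - front \<epsilon> (y + 1) \<le> (exp \<epsilon> - 1) * front_slope \<epsilon> y"
    and "front \<epsilon> y - front \<epsilon> (y + 1) \<le> (exp \<epsilon> - 1) * front_slope \<epsilon> (y + 1)"
    and "(exp \<epsilon> - 1) * front_slope \<epsilon> y \<le> exp \<epsilon> * (front \<epsilon> y - front \<epsilon> (y + 1))"
proof -
  define E e where "E = exp (\<epsilon> * y)" and "e = exp \<epsilon>"
  have E: "0 < E" "1 \<le> e" using assms by (auto simp: E_def e_def)
  have e1: "exp (\<epsilon> * (y + 1)) = E * e" by (simp add: E_def e_def algebra_simps exp_add)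
  have "0 < E * e" using E by simp
  then have pos: "0 < 1 + E" "0 < 1 + E * e" using E(1) by linarith+
  have Ee: "E \<le> E * e" using E by simp
  show "front \<epsilon> y - front \<epsilon> (y + 1) \<le> (exp \<epsilon> - 1) * front_slope \<epsilon> y"
  proof -
    have "E * (e - 1) / ((1 + E) * (1 + E * e)) \<le> E * (e - 1) / ((1 + E) * (1 + E))"
      by (intro divide_left_mono mult_left_mono add_left_mono mult_pos_pos pos Ee) (use E in auto)
    then show ?thesis unfolding front_difference front_slope_def E_def[symmetric] e_def[symmetric]
      by (simp add: power2_eq_square mult_ac)
  qed
  show "front \<epsilon> y - front \<epsilon> (y + 1) \<le> (exp \<epsilon> - 1) * front_slope \<epsilon> (y + 1)"
  proof -
    have "E * (e - 1) / ((1 + E) * (1 + E * e)) \<le> (E * e) * (e - 1) / ((1 + E * e) * (1 + E * e))"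
    proof -
      have "E * (1 + E * e) \<le> (E * e) * (1 + E)" using E by (simp add: algebra_simps)
      then have "E / (1 + E) \<le> (E * e) / (1 + E * e)" using pos by (simp add: frac_le_eq divide_simps)
      then have "E / (1 + E) * ((e - 1) / (1 + E * e)) \<le> (E * e) / (1 + E * e) * ((e - 1) / (1 + E * e))"
        using E pos by (intro mult_right_mono) auto
      then show ?thesis by simp
    qed
    then show ?thesis unfolding front_difference front_slope_def e1 E_def[symmetric] e_def[symmetric]
      by (simp add: power2_eq_square mult_ac)
  qed
  show "(exp \<epsilon> - 1) * front_slope \<epsilon> y \<le> exp \<epsilon> * (front \<epsilon> y - front \<epsilon> (y + 1))"
  proof -
    have "1 / (1 + E) \<le> e / (1 + E * e)" using E pos by (simp add: divide_simps algebra_simps)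
    then have "(1 / (1 + E)) * (E * (e - 1) / (1 + E)) \<le> (e / (1 + E * e)) * (E * (e - 1) / (1 + E))"
      using E pos by (intro mult_right_mono) auto
    then show ?thesis unfolding front_difference front_slope_def E_def[symmetric] e_def[symmetric]
      by (simp add: power2_eq_square mult_ac)
  qed
qed

lemma sum_front_slope_le:
  assumes "0 < \<epsilon>"
  shows "\<epsilon> * (\<Sum>x\<in>{1..m}. front_slope \<epsilon> (real x - c)) \<le> exp \<epsilon>"
proof -
  have tel: "(\<Sum>x\<in>{1..m}. front \<epsilon> (real x - c) - front \<epsilon> (real x - c + 1))
      = front \<epsilon> (1 - c) - front \<epsilon> (real m + 1 - c)"
    by (induction m) (simp_all add: algebra_simps)
  have le1: "front \<epsilon> (1 - c) \<le> 1" using one_plus_exp_pos[of "\<epsilon> * (1 - c)"] by (simp add: front_def)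
  have e: "0 < exp \<epsilon> - 1" using assms by simp
  have "(exp \<epsilon> - 1) * (\<Sum>x\<in>{1..m}. front_slope \<epsilon> (real x - c))
      \<le> exp \<epsilon> * (\<Sum>x\<in>{1..m}. front \<epsilon> (real x - c) - front \<epsilon> (real x - c + 1))"
    unfolding sum_distrib_left
    by (intro sum_mono front_difference_bounds) (use assms in simp)
  also have "\<dots> \<le> exp \<epsilon> * 1"
    unfolding tel using le1 front_nonneg[of \<epsilon> "real m + 1 - c"] by (intro mult_left_mono) auto
  finally have "(exp \<epsilon> - 1) * (\<Sum>x\<in>{1..m}. front_slope \<epsilon> (real x - c)) \<le> exp \<epsilon>" by simp
  moreover have "\<epsilon> * (\<Sum>x\<in>{1..m}. front_slope \<epsilon> (real x - c)) \<le> (exp \<epsilon> - 1) * (\<Sum>x\<in>{1..m}. front_slope \<epsilon> (real x - c))"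
    using exp_ge_add_one_self[of \<epsilon>]
    by (intro mult_right_mono sum_nonneg less_imp_le[OF front_slope_pos]) linarith
  ultimately show ?thesis by linarith
qed

lemma front_slope_shift:
  assumes "0 \<le> \<epsilon>" "0 \<le> i"
  shows "front_slope \<epsilon> (y + i) \<le> exp (\<epsilon> * i) * front_slope \<epsilon> y"
    and "exp (- \<epsilon> * i) * front_slope \<epsilon> y \<le> front_slope \<epsilon> (y + i)"
proof -
  define E e where "E = exp (\<epsilon> * y)" and "e = exp (\<epsilon> * i)"
  have E: "0 < E" "1 \<le> e" using assms by (auto simp: E_def e_def)
  have e1: "exp (\<epsilon> * (y + i)) = E * e" by (simp add: E_def e_def algebra_simps exp_add)
  have "0 < E * e" using E by simp
  then have pos: "0 < 1 + E" "0 < 1 + E * e" using E(1) by linarith+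
  have Ee: "E \<le> E * e" using E by simp
  have "E * e / (1 + E * e)\<^sup>2 \<le> E * e / (1 + E)\<^sup>2"
    by (intro divide_left_mono power_mono add_left_mono mult_pos_pos zero_less_power pos Ee) (use E in auto)
  then show "front_slope \<epsilon> (y + i) \<le> exp (\<epsilon> * i) * front_slope \<epsilon> y"
    unfolding front_slope_def e1 E_def[symmetric] e_def[symmetric] by (simp add: mult_ac)
  have "(1 + E * e)\<^sup>2 \<le> (e * (1 + E))\<^sup>2"
    using E pos by (intro power_mono) (auto simp: algebra_simps)
  then have "E * e / (e * (1 + E))\<^sup>2 \<le> E * e / (1 + E * e)\<^sup>2"
    using E pos by (intro divide_left_mono mult_pos_pos zero_less_power) auto
  moreover have "E * e / (e * (1 + E))\<^sup>2 = E / (e * (1 + E)\<^sup>2)"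
    using E pos by (simp add: power2_eq_square)
  moreover have "exp (- \<epsilon> * i) * (E / (1 + E)\<^sup>2) = E / (e * (1 + E)\<^sup>2)"
    by (simp add: e_def exp_minus divide_inverse)
  ultimately show "exp (- \<epsilon> * i) * front_slope \<epsilon> y \<le> front_slope \<epsilon> (y + i)"
    unfolding front_slope_def e1 E_def[symmetric] by (simp only:)
qed

lemma sum_blocks:
  fixes l M :: nat
  shows "(\<Sum>x\<in>{1..l * M}. f x) = (\<Sum>i<M. \<Sum>x\<in>{1 + l * i..l + l * i}. f x)"
proof (induction M)
  case (Suc M)
  have "(\<Sum>x\<in>{1..l * M + l}. f x) = (\<Sum>x\<in>{1..l * M}. f x) + (\<Sum>x\<in>{l * M + 1..l * M + l}. f x)"
    by (rule sum.ub_add_nat) simp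
  then show ?case using Suc by (simp add: add.commute)
qed simp

lemma sum_block_bonds_le:
  fixes l M :: nat
  assumes "\<And>x. (0::real) \<le> f x"
  shows "(\<Sum>i<M. \<Sum>x\<in>{1 + l * i..<l + l * i}. f x) \<le> (\<Sum>x\<in>{1..<l * M}. f x)"
proof (induction M)
  case (Suc M)
  have "(\<Sum>x\<in>{1..<l * M}. f x) + (\<Sum>x\<in>{1 + l * M..<l + l * M}. f x)
      = (\<Sum>x\<in>{1..<l * M} \<union> {1 + l * M..<l + l * M}. f x)"
    by (rule sum.union_disjoint[symmetric]) auto
  also have "\<dots> \<le> (\<Sum>x\<in>{1..<l * Suc M}. f x)"
    using assms by (intro sum_mono2) auto
  finally show ?case using Suc by simp
qed simp

section \<open>Exponential moments of the mass behind the front\<close>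

context zero_range_process
begin

text \<open>The growth rate of an exponential moment with parameter \<open>z\<close> for a walk with jump rates \<open>p\<close> and
\<open>1 - p\<close>.\<close>

definition tilt :: "real \<Rightarrow> real" where
  "tilt z = p * (exp z - 1) + (1 - p) * (exp (- z) - 1)"

lemma tilt_mono: assumes "0 \<le> a" "a \<le> b" shows "tilt a \<le> tilt b"
proof -
  have "exp (- a) - exp (- b) = exp (- a - b) * (exp b - exp a)"
    by (simp add: right_diff_distrib exp_add[symmetric])
  also have "\<dots> \<le> 1 * (exp b - exp a)" using assms by (intro mult_right_mono) auto
  finally have "(1 - p) * (exp (- a) - exp (- b)) \<le> (1 - p) * (exp b - exp a)"
    using p by (intro mult_left_mono) auto
  also have "\<dots> \<le> p * (exp b - exp a)" using p assms by (intro mult_right_mono) auto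
  finally show ?thesis by (simp add: tilt_def algebra_simps)
qed

lemma tilt_nonneg: "0 \<le> z \<Longrightarrow> 0 \<le> tilt z"
  using tilt_mono[of 0 z] by (simp add: tilt_def)

lemma tilt_le:
  assumes "0 \<le> z" "z \<le> 1"
  shows "tilt z \<le> (2 * p - 1) * z + z\<^sup>2"
proof -
  have "exp z - 1 \<le> z + z\<^sup>2" using exp_bound[OF assms] by simp
  moreover have "exp (- z) - 1 \<le> - z + z\<^sup>2"
  proof -
    have "(1 - z + z\<^sup>2) * (1 + z) = 1 + z ^ 3" by (simp add: power2_eq_square power3_eq_cube algebra_simps)
    then have "1 \<le> (1 - z + z\<^sup>2) * (1 + z)" using assms by simp
    also have "\<dots> \<le> (1 - z + z\<^sup>2) * exp z"
      using exp_ge_add_one_self[of z] assms by (intro mult_left_mono) auto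
    finally have "exp (- z) * 1 \<le> exp (- z) * ((1 - z + z\<^sup>2) * exp z)"
      by (intro mult_left_mono) auto
    moreover have "exp (- z) * ((1 - z + z\<^sup>2) * exp z) = 1 - z + z\<^sup>2"
      by (simp add: exp_minus)
    ultimately show ?thesis by linarith
  qed
  ultimately have "tilt z \<le> p * (z + z\<^sup>2) + (1 - p) * (- z + z\<^sup>2)"
    unfolding tilt_def using p by (intro add_mono mult_left_mono) auto
  then show ?thesis by (simp add: algebra_simps)
qed

text \<open>The quadratic form in the variables \<open>\<zeta>\<close> with one particle less: a jump moves the additional particle
of \<open>\<zeta>\<close>, with a weight that does not depend on where it is.\<close>

lemma sum_exit_gen:
  "(\<Sum>\<xi>\<in>configs m {..k}. weight m \<xi> * F \<xi> * exit_gen m u \<xi>) =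
   (\<Sum>x\<in>{1..m}. \<Sum>\<zeta>\<in>configs m {..<k}. weight m \<zeta> * (p * (F (add_particle x \<zeta>) *
       (u (if x = m then \<zeta> else add_particle (x + 1) \<zeta>) - u (add_particle x \<zeta>))))) +
   (\<Sum>x\<in>{2..m}. \<Sum>\<zeta>\<in>configs m {..<k}. weight m \<zeta> * ((1 - p) * (F (add_particle x \<zeta>) *
       (u (add_particle (x - 1) \<zeta>) - u (add_particle x \<zeta>)))))"
proof -
  let ?G = "\<lambda>i \<xi>. (if fst i then p else 1 - p) * (F \<xi> * (u (exit_move m i \<xi>) - u \<xi>))"
  have one: "(\<Sum>\<xi>\<in>configs m {..k}. weight m \<xi> * g (\<xi> x) * ?G (b, x) \<xi>)
     = (\<Sum>\<zeta>\<in>configs m {..<k}. weight m \<zeta> * ?G (b, x) (add_particle x \<zeta>))"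
    if "(b, x) \<in> exit_moves m" for b x
    by (rule sum_configs_add_particle[OF exit_moves_site[OF that]]) auto
  have "(\<Sum>\<xi>\<in>configs m {..k}. weight m \<xi> * F \<xi> * exit_gen m u \<xi>) =
     (\<Sum>\<xi>\<in>configs m {..k}. \<Sum>i\<in>exit_moves m. weight m \<xi> * g (\<xi> (snd i)) * ?G i \<xi>)"
    unfolding jump_gen_def sum_distrib_left by (intro sum.cong refl) (simp add: jump_rate_def)
  also have "\<dots> = (\<Sum>i\<in>exit_moves m. \<Sum>\<xi>\<in>configs m {..k}. weight m \<xi> * g (\<xi> (snd i)) * ?G i \<xi>)"
    by (rule sum.swap)
  also have "\<dots> = (\<Sum>i\<in>exit_moves m. \<Sum>\<zeta>\<in>configs m {..<k}. weight m \<zeta> * ?G i (add_particle (snd i) \<zeta>))"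
  proof (rule sum.cong[OF refl])
    fix i assume i: "i \<in> exit_moves m"
    show "(\<Sum>\<xi>\<in>configs m {..k}. weight m \<xi> * g (\<xi> (snd i)) * ?G i \<xi>)
      = (\<Sum>\<zeta>\<in>configs m {..<k}. weight m \<zeta> * ?G i (add_particle (snd i) \<zeta>))"
      using one[of "fst i" "snd i"] i by (simp only: prod.collapse)
  qed
  also have "\<dots> = (\<Sum>i\<in>{True} \<times> {1..m}. \<Sum>\<zeta>\<in>configs m {..<k}. weight m \<zeta> * ?G i (add_particle (snd i) \<zeta>))
     + (\<Sum>i\<in>{False} \<times> {2..m}. \<Sum>\<zeta>\<in>configs m {..<k}. weight m \<zeta> * ?G i (add_particle (snd i) \<zeta>))"
    unfolding exit_moves_def by (rule sum.union_disjoint) auto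
  also have "(\<Sum>i\<in>{True} \<times> {1..m}. \<Sum>\<zeta>\<in>configs m {..<k}. weight m \<zeta> * ?G i (add_particle (snd i) \<zeta>)) =
     (\<Sum>x\<in>{1..m}. \<Sum>\<zeta>\<in>configs m {..<k}. weight m \<zeta> * (p * (F (add_particle x \<zeta>) *
       (u (if x = m then \<zeta> else add_particle (x + 1) \<zeta>) - u (add_particle x \<zeta>)))))"
    by (rule sum.reindex_bij_witness[of _ "Pair True" snd])
       (auto simp: exit_move_add_particle exit_moves_def intro!: sum.cong)
  also have "(\<Sum>i\<in>{False} \<times> {2..m}. \<Sum>\<zeta>\<in>configs m {..<k}. weight m \<zeta> * ?G i (add_particle (snd i) \<zeta>)) =
     (\<Sum>x\<in>{2..m}. \<Sum>\<zeta>\<in>configs m {..<k}. weight m \<zeta> * ((1 - p) * (F (add_particle x \<zeta>) *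
       (u (add_particle (x - 1) \<zeta>) - u (add_particle x \<zeta>)))))"
    by (rule sum.reindex_bij_witness[of _ "Pair False" snd])
       (auto simp: exit_move_add_particle exit_moves_def intro!: sum.cong)
  finally show ?thesis .
qed

text \<open>The last term, which stems from the asymmetry, telescopes over the bonds; this is why the
homogeneous weights are a suitable reference although they are not invariant.\<close>

lemma bond_form_bound:
  fixes a b z :: real
  assumes "0 \<le> z"
  shows "p * (exp z * a * b - a\<^sup>2) + (1 - p) * (exp (- z) * a * b - b\<^sup>2)
     \<le> - (a - b)\<^sup>2 / 2 + tilt z / 2 * (a\<^sup>2 + b\<^sup>2) + (2 * p - 1) / 2 * (b\<^sup>2 - a\<^sup>2)"
proof -
  have eq: "p * (exp z * a * b - a\<^sup>2) + (1 - p) * (exp (- z) * a * b - b\<^sup>2)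
    = - (1 + tilt z) * (a - b)\<^sup>2 / 2 + tilt z / 2 * (a\<^sup>2 + b\<^sup>2) + (2 * p - 1) / 2 * (b\<^sup>2 - a\<^sup>2)"
    by (simp add: tilt_def power2_eq_square field_simps)
  have "0 \<le> tilt z * (a - b)\<^sup>2" using tilt_nonneg[OF assms] by simp
  moreover have "- (1 + tilt z) * (a - b)\<^sup>2 / 2 = - (a - b)\<^sup>2 / 2 - tilt z * (a - b)\<^sup>2 / 2"
    by (simp add: left_diff_distrib diff_divide_distrib)
  ultimately show ?thesis unfolding eq by linarith
qed

definition potential :: "nat \<Rightarrow> (nat \<Rightarrow> real) \<Rightarrow> (nat \<Rightarrow> nat) \<Rightarrow> real" where
  "potential m b \<xi> = (\<Sum>x\<in>{1..m}. real (\<xi> x) * b x)"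

lemma potential_add_particle:
  assumes "x \<in> {1..m}" shows "potential m b (add_particle x \<zeta>) = potential m b \<zeta> + b x"
proof -
  have "potential m b (add_particle x \<zeta>) = (\<Sum>y\<in>{1..m}. real (\<zeta> y) * b y + (if y = x then b x else 0))"
    unfolding potential_def by (intro sum.cong) (auto simp: add_particle_apply algebra_simps)
  then show ?thesis using assms by (simp add: sum.distrib potential_def)
qed

text \<open>At site \<open>m\<close> the telescoping term is dominated by half of the exit rate; the other half bounds the
cross term of the exits, which leaves the term with \<open>exp (2 * b m)\<close>.\<close>

lemma tilted_form_bound:
  fixes b :: "nat \<Rightarrow> real" and m :: nat
  defines "r \<equiv> \<lambda>u \<xi>. u \<xi> * exp (potential m b \<xi>)"
  assumes m: "1 \<le> m" and dec: "\<And>x. x \<in> {1..<m} \<Longrightarrow> b (x + 1) \<le> b x"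
  shows "(\<Sum>\<xi>\<in>configs m {..k}. weight m \<xi> * (r u \<xi> * exp (potential m b \<xi>)) * exit_gen m u \<xi>)
    \<le> - (\<Sum>x\<in>{1..<m}. \<Sum>\<xi>\<in>configs m {..k}. weight m \<xi> * g (\<xi> x) * (r u \<xi> - r u (move x (x + 1) \<xi>))\<^sup>2) / 2
      + (\<Sum>x\<in>{1..<m}. tilt (b x - b (x + 1)) / 2 *
           ((\<Sum>\<xi>\<in>configs m {..k}. weight m \<xi> * g (\<xi> x) * (r u \<xi>)\<^sup>2)
          + (\<Sum>\<xi>\<in>configs m {..k}. weight m \<xi> * g (\<xi> (x + 1)) * (r u \<xi>)\<^sup>2)))
      + p * exp (2 * b m) / 2 * (\<Sum>\<xi>\<in>configs m {..k}. weight m \<xi> * (r u \<xi>)\<^sup>2)"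
proof -
  let ?Z = "configs m {..<k}" and ?w = "weight m" and ?r = "r u"
  let ?F = "\<lambda>\<xi>. ?r \<xi> * exp (potential m b \<xi>)"
  let ?H = "\<Sum>\<xi>\<in>configs m {..k}. ?w \<xi> * (?r \<xi>)\<^sup>2"
  define N where "N x = (\<Sum>\<zeta>\<in>?Z. ?w \<zeta> * (?r (add_particle x \<zeta>))\<^sup>2)" for x
  define D where "D x = (\<Sum>\<zeta>\<in>?Z. ?w \<zeta> * (?r (add_particle x \<zeta>) - ?r (add_particle (x + 1) \<zeta>))\<^sup>2)" for x
  have w: "0 \<le> ?w \<zeta>" for \<zeta> by (rule less_imp_le[OF weight_pos])
  have N: "(\<Sum>\<xi>\<in>configs m {..k}. ?w \<xi> * g (\<xi> x) * (?r \<xi>)\<^sup>2) = N x" if "x \<in> {1..m}" for x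
    unfolding N_def by (rule sum_configs_add_particle[OF that]) auto
  have D: "(\<Sum>\<xi>\<in>configs m {..k}. ?w \<xi> * g (\<xi> x) * (?r \<xi> - ?r (move x (x + 1) \<xi>))\<^sup>2) = D x"
    if "x \<in> {1..m}" for x
    unfolding D_def by (subst sum_configs_add_particle[OF that, of "{..<k}"]) (auto simp: move_add_particle)
  have hop: "?F (add_particle x \<zeta>) * (u (add_particle y \<zeta>) - u (add_particle x \<zeta>))
     = exp (b x - b y) * ?r (add_particle x \<zeta>) * ?r (add_particle y \<zeta>) - (?r (add_particle x \<zeta>))\<^sup>2"
    if "x \<in> {1..m}" "y \<in> {1..m}" for x y \<zeta>
    using that by (simp add: r_def potential_add_particle exp_add exp_diff power2_eq_square field_simps)
  have leave: "?F (add_particle m \<zeta>) * (u \<zeta> - u (add_particle m \<zeta>))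
     = exp (b m) * ?r (add_particle m \<zeta>) * ?r \<zeta> - (?r (add_particle m \<zeta>))\<^sup>2" for \<zeta>
    using m by (simp add: r_def potential_add_particle exp_add power2_eq_square field_simps)
  have "(\<Sum>\<xi>\<in>configs m {..k}. ?w \<xi> * ?F \<xi> * exit_gen m u \<xi>) =
     (\<Sum>x\<in>{1..m}. \<Sum>\<zeta>\<in>?Z. ?w \<zeta> * (p * (?F (add_particle x \<zeta>) *
       (u (if x = m then \<zeta> else add_particle (x + 1) \<zeta>) - u (add_particle x \<zeta>))))) +
     (\<Sum>x\<in>{2..m}. \<Sum>\<zeta>\<in>?Z. ?w \<zeta> * ((1 - p) * (?F (add_particle x \<zeta>) *
       (u (add_particle (x - 1) \<zeta>) - u (add_particle x \<zeta>)))))"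
    by (rule sum_exit_gen)
  also have "(\<Sum>x\<in>{1..m}. \<Sum>\<zeta>\<in>?Z. ?w \<zeta> * (p * (?F (add_particle x \<zeta>) *
       (u (if x = m then \<zeta> else add_particle (x + 1) \<zeta>) - u (add_particle x \<zeta>)))))
     = (\<Sum>x\<in>{1..<m}. \<Sum>\<zeta>\<in>?Z. ?w \<zeta> * (p * (exp (b x - b (x + 1)) * ?r (add_particle x \<zeta>) * ?r (add_particle (x + 1) \<zeta>)
            - (?r (add_particle x \<zeta>))\<^sup>2)))
      + (\<Sum>\<zeta>\<in>?Z. ?w \<zeta> * (p * (exp (b m) * ?r (add_particle m \<zeta>) * ?r \<zeta> - (?r (add_particle m \<zeta>))\<^sup>2)))"
  proof -
    have "{1..m} = insert m {1..<m}" using m by auto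
    then show ?thesis
      by (simp add: leave add.commute) (intro sum.cong refl, auto simp: hop[simplified])
  qed
  also have "(\<Sum>x\<in>{2..m}. \<Sum>\<zeta>\<in>?Z. ?w \<zeta> * ((1 - p) * (?F (add_particle x \<zeta>) *
       (u (add_particle (x - 1) \<zeta>) - u (add_particle x \<zeta>)))))
     = (\<Sum>x\<in>{1..<m}. \<Sum>\<zeta>\<in>?Z. ?w \<zeta> * ((1 - p) * (exp (- (b x - b (x + 1))) * ?r (add_particle x \<zeta>) * ?r (add_particle (x + 1) \<zeta>)
            - (?r (add_particle (x + 1) \<zeta>))\<^sup>2)))"
  proof (rule sum.reindex_bij_witness[of _ Suc "\<lambda>x. x - 1"])
    fix x assume x: "x \<in> {2..m}"
    then have "x - 1 + 1 = x" "x \<in> {1..m}" "x - 1 \<in> {1..m}" by auto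
    then show "(\<Sum>\<zeta>\<in>?Z. ?w \<zeta> * ((1 - p) * (exp (- (b (x - 1) - b (x - 1 + 1))) * ?r (add_particle (x - 1) \<zeta>) * ?r (add_particle (x - 1 + 1) \<zeta>)
            - (?r (add_particle (x - 1 + 1) \<zeta>))\<^sup>2))) =
       (\<Sum>\<zeta>\<in>?Z. ?w \<zeta> * ((1 - p) * (?F (add_particle x \<zeta>) *
       (u (add_particle (x - 1) \<zeta>) - u (add_particle x \<zeta>)))))"
      by (simp only: hop) (simp only: minus_diff_eq mult_ac)
  qed auto
  finally have eq: "(\<Sum>\<xi>\<in>configs m {..k}. ?w \<xi> * ?F \<xi> * exit_gen m u \<xi>) =
     (\<Sum>x\<in>{1..<m}. \<Sum>\<zeta>\<in>?Z. ?w \<zeta> *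
        (p * (exp (b x - b (x + 1)) * ?r (add_particle x \<zeta>) * ?r (add_particle (x + 1) \<zeta>) - (?r (add_particle x \<zeta>))\<^sup>2)
        + (1 - p) * (exp (- (b x - b (x + 1))) * ?r (add_particle x \<zeta>) * ?r (add_particle (x + 1) \<zeta>) - (?r (add_particle (x + 1) \<zeta>))\<^sup>2)))
     + (\<Sum>\<zeta>\<in>?Z. ?w \<zeta> * (p * (exp (b m) * ?r (add_particle m \<zeta>) * ?r \<zeta> - (?r (add_particle m \<zeta>))\<^sup>2)))"
    by (simp only: distrib_left sum.distrib add_ac)
  have bond: "(\<Sum>\<zeta>\<in>?Z. ?w \<zeta> *
        (p * (exp (b x - b (x + 1)) * ?r (add_particle x \<zeta>) * ?r (add_particle (x + 1) \<zeta>) - (?r (add_particle x \<zeta>))\<^sup>2)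
        + (1 - p) * (exp (- (b x - b (x + 1))) * ?r (add_particle x \<zeta>) * ?r (add_particle (x + 1) \<zeta>) - (?r (add_particle (x + 1) \<zeta>))\<^sup>2)))
     \<le> - D x / 2 + tilt (b x - b (x + 1)) / 2 * (N x + N (x + 1)) + (2 * p - 1) / 2 * (N (x + 1) - N x)"
    if x: "x \<in> {1..<m}" for x
  proof -
    have z: "0 \<le> b x - b (x + 1)" using dec[OF x] by simp
    have "- D x / 2 + tilt (b x - b (x + 1)) / 2 * (N x + N (x + 1)) + (2 * p - 1) / 2 * (N (x + 1) - N x)
      = (\<Sum>\<zeta>\<in>?Z. ?w \<zeta> * (- (?r (add_particle x \<zeta>) - ?r (add_particle (x + 1) \<zeta>))\<^sup>2 / 2
           + tilt (b x - b (x + 1)) / 2 * ((?r (add_particle x \<zeta>))\<^sup>2 + (?r (add_particle (x + 1) \<zeta>))\<^sup>2)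
           + (2 * p - 1) / 2 * ((?r (add_particle (x + 1) \<zeta>))\<^sup>2 - (?r (add_particle x \<zeta>))\<^sup>2)))"
    proof -
      have "\<And>A B C t d :: real. A * (- B / 2 + t / 2 * (C + E) + d / 2 * (E - C))
         = - (A * B) / 2 + t / 2 * (A * C + A * E) + d / 2 * (A * E - A * C)" for E
        by (simp add: field_simps)
      then show ?thesis unfolding D_def N_def
        by (simp only: sum.distrib sum_subtractf sum_distrib_left[symmetric] sum_divide_distrib[symmetric] sum_negf)
    qed
    moreover have "(\<Sum>\<zeta>\<in>?Z. ?w \<zeta> *
        (p * (exp (b x - b (x + 1)) * ?r (add_particle x \<zeta>) * ?r (add_particle (x + 1) \<zeta>) - (?r (add_particle x \<zeta>))\<^sup>2)
        + (1 - p) * (exp (- (b x - b (x + 1))) * ?r (add_particle x \<zeta>) * ?r (add_particle (x + 1) \<zeta>) - (?r (add_particle (x + 1) \<zeta>))\<^sup>2)))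
      \<le> (\<Sum>\<zeta>\<in>?Z. ?w \<zeta> * (- (?r (add_particle x \<zeta>) - ?r (add_particle (x + 1) \<zeta>))\<^sup>2 / 2
           + tilt (b x - b (x + 1)) / 2 * ((?r (add_particle x \<zeta>))\<^sup>2 + (?r (add_particle (x + 1) \<zeta>))\<^sup>2)
           + (2 * p - 1) / 2 * ((?r (add_particle (x + 1) \<zeta>))\<^sup>2 - (?r (add_particle x \<zeta>))\<^sup>2)))"
      by (rule sum_mono, rule mult_left_mono[OF bond_form_bound[OF z] w])
    ultimately show ?thesis by linarith
  qed
  have last: "(\<Sum>\<zeta>\<in>?Z. ?w \<zeta> * (p * (exp (b m) * ?r (add_particle m \<zeta>) * ?r \<zeta> - (?r (add_particle m \<zeta>))\<^sup>2)))
     \<le> - p / 2 * N m + p * exp (2 * b m) / 2 * ?H"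
  proof -
    have "(\<Sum>\<zeta>\<in>?Z. ?w \<zeta> * (p * (exp (b m) * ?r (add_particle m \<zeta>) * ?r \<zeta> - (?r (add_particle m \<zeta>))\<^sup>2)))
       \<le> (\<Sum>\<zeta>\<in>?Z. - p / 2 * (?w \<zeta> * (?r (add_particle m \<zeta>))\<^sup>2) + p * exp (2 * b m) / 2 * (?w \<zeta> * (?r \<zeta>)\<^sup>2))"
    proof (rule sum_mono)
      fix \<zeta>
      define a c where "a = ?r (add_particle m \<zeta>)" and "c = exp (b m) * ?r \<zeta>"
      have "a * c \<le> (a\<^sup>2 + c\<^sup>2) / 2" using zero_le_power2[of "a - c"] by (simp add: power2_diff)
      then have "p * (a * c - a\<^sup>2) \<le> p * (- a\<^sup>2 / 2 + c\<^sup>2 / 2)"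
        using p by (intro mult_left_mono) (auto simp: field_simps)
      from mult_left_mono[OF this w[of \<zeta>]]
      have "?w \<zeta> * (p * (a * c - a\<^sup>2)) \<le> ?w \<zeta> * (p * (- a\<^sup>2 / 2 + c\<^sup>2 / 2))" .
      also have "c\<^sup>2 = exp (2 * b m) * (?r \<zeta>)\<^sup>2"
        by (simp add: c_def power_mult_distrib exp_double)
      finally show "?w \<zeta> * (p * (exp (b m) * ?r (add_particle m \<zeta>) * ?r \<zeta> - (?r (add_particle m \<zeta>))\<^sup>2))
         \<le> - p / 2 * (?w \<zeta> * (?r (add_particle m \<zeta>))\<^sup>2) + p * exp (2 * b m) / 2 * (?w \<zeta> * (?r \<zeta>)\<^sup>2)"
        unfolding a_def[symmetric] by (simp add: c_def field_simps)
    qed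
    also have "\<dots> = - p / 2 * N m + p * exp (2 * b m) / 2 * (\<Sum>\<zeta>\<in>?Z. ?w \<zeta> * (?r \<zeta>)\<^sup>2)"
      unfolding N_def by (simp only: sum.distrib sum_distrib_left)
    also have "(\<Sum>\<zeta>\<in>?Z. ?w \<zeta> * (?r \<zeta>)\<^sup>2) \<le> ?H"
    proof (rule sum_mono2)
      show "finite (configs m {..k})" by (simp add: finite_configs)
      show "?Z \<subseteq> configs m {..k}" by (auto simp: configs_def)
      show "0 \<le> ?w \<zeta> * (?r \<zeta>)\<^sup>2" for \<zeta> using w[of \<zeta>] by simp
    qed
    finally show ?thesis using p by (simp add: mult_left_mono)
  qed
  have tel: "(\<Sum>x\<in>{1..<m}. N (x + 1) - N x) = N m - N 1"
    using sum_Suc_diff'[of 1 m N] m by simp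
  have Nn: "0 \<le> N x" for x unfolding N_def by (intro sum_nonneg mult_nonneg_nonneg w) simp
  have "(\<Sum>\<xi>\<in>configs m {..k}. ?w \<xi> * ?F \<xi> * exit_gen m u \<xi>)
     \<le> (\<Sum>x\<in>{1..<m}. - D x / 2 + tilt (b x - b (x + 1)) / 2 * (N x + N (x + 1)) + (2 * p - 1) / 2 * (N (x + 1) - N x))
       + (- p / 2 * N m + p * exp (2 * b m) / 2 * ?H)"
    unfolding eq by (intro add_mono last sum_mono bond)
  also have "\<dots> = - (\<Sum>x\<in>{1..<m}. D x) / 2 + (\<Sum>x\<in>{1..<m}. tilt (b x - b (x + 1)) / 2 * (N x + N (x + 1)))
      + (2 * p - 1) / 2 * (N m - N 1) + (- p / 2 * N m + p * exp (2 * b m) / 2 * ?H)"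
  proof -
    have "(\<Sum>x\<in>{1..<m}. - D x / 2) = - (\<Sum>x\<in>{1..<m}. D x) / 2"
      by (simp only: sum_divide_distrib[symmetric] sum_negf)
    then show ?thesis unfolding tel[symmetric] by (simp only: sum.distrib sum_distrib_left)
  qed
  also have "\<dots> \<le> - (\<Sum>x\<in>{1..<m}. D x) / 2 + (\<Sum>x\<in>{1..<m}. tilt (b x - b (x + 1)) / 2 * (N x + N (x + 1)))
      + p * exp (2 * b m) / 2 * ?H"
  proof -
    have "0 \<le> (1 - p) * N m" "0 \<le> (2 * p - 1) * N 1" using p Nn by auto
    then have "(2 * p - 1) / 2 * (N m - N 1) + - p / 2 * N m \<le> 0"
      by (simp add: field_simps)
    then show ?thesis by linarith
  qed
  finally have main: "(\<Sum>\<xi>\<in>configs m {..k}. ?w \<xi> * ?F \<xi> * exit_gen m u \<xi>)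
     \<le> - (\<Sum>x\<in>{1..<m}. D x) / 2 + (\<Sum>x\<in>{1..<m}. tilt (b x - b (x + 1)) / 2 * (N x + N (x + 1)))
      + p * exp (2 * b m) / 2 * ?H" .
  have D': "(\<Sum>x\<in>{1..<m}. \<Sum>\<xi>\<in>configs m {..k}. ?w \<xi> * g (\<xi> x) * (?r \<xi> - ?r (move x (x + 1) \<xi>))\<^sup>2) = (\<Sum>x\<in>{1..<m}. D x)"
    by (intro sum.cong refl D) auto
  have N': "(\<Sum>x\<in>{1..<m}. tilt (b x - b (x + 1)) / 2 *
           ((\<Sum>\<xi>\<in>configs m {..k}. ?w \<xi> * g (\<xi> x) * (?r \<xi>)\<^sup>2)
          + (\<Sum>\<xi>\<in>configs m {..k}. ?w \<xi> * g (\<xi> (x + 1)) * (?r \<xi>)\<^sup>2)))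
     = (\<Sum>x\<in>{1..<m}. tilt (b x - b (x + 1)) / 2 * (N x + N (x + 1)))"
  proof (rule sum.cong[OF refl])
    fix x assume "x \<in> {1..<m}"
    then have "x \<in> {1..m}" "x + 1 \<in> {1..m}" by auto
    then show "tilt (b x - b (x + 1)) / 2 *
           ((\<Sum>\<xi>\<in>configs m {..k}. ?w \<xi> * g (\<xi> x) * (?r \<xi>)\<^sup>2)
          + (\<Sum>\<xi>\<in>configs m {..k}. ?w \<xi> * g (\<xi> (x + 1)) * (?r \<xi>)\<^sup>2))
       = tilt (b x - b (x + 1)) / 2 * (N x + N (x + 1))" by (simp only: N)
  qed
  show ?thesis unfolding D' N' by (rule main)
qed

end

context zero_range_process
begin

lemma tilt_le_scaled:
  assumes "0 \<le> z'" "z' \<le> z * h" "0 \<le> z" "z \<le> 1" "0 \<le> h" "h \<le> 1"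
  shows "tilt z' \<le> (2 * p - 1 + z) * z * h"
proof -
  have zh: "0 \<le> z * h" "z * h \<le> z" "z * h \<le> 1"
    using assms mult_left_le[of h z] by auto
  have "tilt z' \<le> tilt (z * h)" by (rule tilt_mono[OF assms(1,2)])
  also have "\<dots> \<le> (2 * p - 1) * (z * h) + (z * h)\<^sup>2" by (rule tilt_le) (use zh in auto)
  also have "(z * h)\<^sup>2 \<le> z * (z * h)"
    unfolding power2_eq_square using zh by (intro mult_right_mono) auto
  finally show ?thesis by (simp add: algebra_simps)
qed

text \<open>The left-hand side is half the derivative of the squared tilted norm: the form of the tilted
generator, and the contribution of the moving front. On each block the excess is controlled by \<open>loc\<close>,
whose energy term is absorbed by the Dirichlet form because of \<open>C2\<close>. The slopes of the front sum up
to about \<open>1 / \<epsilon>\<close>, so the growth rate does not depend on the size of the system.\<close>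

lemma front_form_bound:
  fixes u :: "(nat \<Rightarrow> nat) \<Rightarrow> real" and c \<epsilon> lam v s0 \<gamma> \<Gamma> :: real and l M k :: nat
  defines "m \<equiv> l * M" and "z \<equiv> lam * (exp \<epsilon> - 1)"
    and "b \<equiv> \<lambda>x. lam * front \<epsilon> (real x - c)"
  defines "r \<equiv> \<lambda>\<xi>. u \<xi> * exp (potential m b \<xi>)"
  defines "H \<equiv> (\<Sum>\<xi>\<in>configs m {..k}. weight m \<xi> * (r \<xi>)\<^sup>2)"
  assumes pos: "0 < lam" "0 < \<epsilon>" "0 < v" "0 \<le> s0" "0 < \<gamma>" "0 \<le> \<Gamma>" "0 < l" "0 < M"
    and z1: "z \<le> 1" and C1: "(2 * p - 1 + z) * z * exp (2 * \<epsilon> * real l) \<le> \<gamma> * (lam * v * \<epsilon>)"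
    and C2: "lam * v * \<epsilon> * \<Gamma> \<le> 1 / 2"
    and loc: "\<And>k R. (\<Sum>\<sigma>\<in>configs l {..k}. weight l \<sigma> * (R \<sigma>)\<^sup>2 * (excess \<gamma> {1..l} \<sigma> - s0 * real l))
       \<le> \<Gamma> * energy l {..k} R"
  shows "(\<Sum>\<xi>\<in>configs m {..k}. weight m \<xi> * (r \<xi> * exp (potential m b \<xi>)) * exit_gen m u \<xi>)
      - lam * v * \<epsilon> * (\<Sum>x\<in>{1..m}. front_slope \<epsilon> (real x - c) *
           (\<Sum>\<xi>\<in>configs m {..k}. weight m \<xi> * real (\<xi> x) * (r \<xi>)\<^sup>2))
    \<le> (lam * v * s0 * exp \<epsilon> + p * exp (2 * b m) / 2) * H"
proof -
  let ?C = "configs m {..k}" and ?w = "weight m"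
  define h where "h x = front_slope \<epsilon> (real x - c)" for x :: nat
  define N where "N x = (\<Sum>\<xi>\<in>?C. ?w \<xi> * g (\<xi> x) * (r \<xi>)\<^sup>2)" for x
  define Q where "Q x = (\<Sum>\<xi>\<in>?C. ?w \<xi> * real (\<xi> x) * (r \<xi>)\<^sup>2)" for x
  define D where "D x = (\<Sum>\<xi>\<in>?C. ?w \<xi> * g (\<xi> x) * (r \<xi> - r (move x (x + 1) \<xi>))\<^sup>2)" for x
  define \<Theta> where "\<Theta> = (2 * p - 1 + z) * z"
  define a where "a = lam * v * \<epsilon>"
  have a: "0 < a" using pos by (simp add: a_def)
  have m: "1 \<le> m" using pos by (simp add: m_def)
  have w: "0 \<le> ?w \<xi>" for \<xi> by (rule less_imp_le[OF weight_pos])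
  have z0: "0 \<le> z" using pos by (simp add: z_def)
  have \<Theta>: "0 \<le> \<Theta>" using p z0 by (simp add: \<Theta>_def)
  have h: "0 \<le> h x" "h x \<le> 1" for x
    using front_slope_pos[of \<epsilon> "real x - c"] front_slope_le_1[of \<epsilon> "real x - c"] by (auto simp: h_def)
  have N0: "0 \<le> N x" for x unfolding N_def by (intro sum_nonneg mult_nonneg_nonneg w g_nonneg) simp
  have Q0: "0 \<le> Q x" for x unfolding Q_def by (intro sum_nonneg mult_nonneg_nonneg w) auto
  have D0: "0 \<le> D x" for x unfolding D_def by (intro sum_nonneg mult_nonneg_nonneg w g_nonneg) simp
  have H0: "0 \<le> H" unfolding H_def by (intro sum_nonneg mult_nonneg_nonneg w) simp
  have Suc_arg: "real (x + 1) - c = (real x - c) + 1" for x by simp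
  have bd: "0 \<le> b x - b (x + 1)" "b x - b (x + 1) \<le> z * h x" "b x - b (x + 1) \<le> z * h (x + 1)" for x
  proof -
    have e: "b x - b (x + 1) = lam * (front \<epsilon> (real x - c) - front \<epsilon> ((real x - c) + 1))"
      unfolding b_def Suc_arg by (simp add: right_diff_distrib)
    show "0 \<le> b x - b (x + 1)" unfolding e
      using front_antimono[of \<epsilon> "real x - c" "(real x - c) + 1"] pos by simp
    show "b x - b (x + 1) \<le> z * h x"
      unfolding e z_def h_def mult.assoc using pos
      by (intro mult_left_mono front_difference_bounds) auto
    show "b x - b (x + 1) \<le> z * h (x + 1)"
      unfolding e z_def h_def mult.assoc Suc_arg using pos
      by (intro mult_left_mono front_difference_bounds) auto
  qed
  have form: "(\<Sum>\<xi>\<in>?C. ?w \<xi> * (r \<xi> * exp (potential m b \<xi>)) * exit_gen m u \<xi>)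
      \<le> - (\<Sum>x\<in>{1..<m}. D x) / 2 + (\<Sum>x\<in>{1..<m}. tilt (b x - b (x + 1)) / 2 * (N x + N (x + 1)))
        + p * exp (2 * b m) / 2 * H"
    unfolding D_def N_def H_def r_def
    by (rule tilted_form_bound[OF m]) (use bd(1) in simp)
  have tilts: "(\<Sum>x\<in>{1..<m}. tilt (b x - b (x + 1)) / 2 * (N x + N (x + 1))) \<le> (\<Sum>x\<in>{1..m}. \<Theta> * h x * N x)"
  proof -
    have "(\<Sum>x\<in>{1..<m}. tilt (b x - b (x + 1)) / 2 * (N x + N (x + 1)))
       \<le> (\<Sum>x\<in>{1..<m}. \<Theta> * h x * N x / 2 + \<Theta> * h (x + 1) * N (x + 1) / 2)"
    proof (rule sum_mono)
      fix x
      have "tilt (b x - b (x + 1)) \<le> \<Theta> * h x" "tilt (b x - b (x + 1)) \<le> \<Theta> * h (x + 1)"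
        unfolding \<Theta>_def by (rule tilt_le_scaled[OF bd(1) bd(2) z0 z1 h], rule tilt_le_scaled[OF bd(1) bd(3) z0 z1 h])
      from mult_right_mono[OF this(1) N0[of x]] mult_right_mono[OF this(2) N0[of "x + 1"]]
      show "tilt (b x - b (x + 1)) / 2 * (N x + N (x + 1)) \<le> \<Theta> * h x * N x / 2 + \<Theta> * h (x + 1) * N (x + 1) / 2"
        by (simp add: field_simps)
    qed
    also have "\<dots> = (\<Sum>x\<in>{1..<m}. \<Theta> * h x * N x) / 2 + (\<Sum>x\<in>{1..<m}. \<Theta> * h (x + 1) * N (x + 1)) / 2"
      by (simp only: sum.distrib sum_divide_distrib)
    also have "(\<Sum>x\<in>{1..<m}. \<Theta> * h x * N x) \<le> (\<Sum>x\<in>{1..m}. \<Theta> * h x * N x)"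
      by (intro sum_mono2 mult_nonneg_nonneg \<Theta> h N0) auto
    also have "(\<Sum>x\<in>{1..<m}. \<Theta> * h (x + 1) * N (x + 1)) = (\<Sum>x\<in>{2..m}. \<Theta> * h x * N x)"
      by (rule sum.reindex_bij_witness[of _ "\<lambda>x. x - 1" Suc]) auto
    also have "\<dots> \<le> (\<Sum>x\<in>{1..m}. \<Theta> * h x * N x)"
      by (intro sum_mono2 mult_nonneg_nonneg \<Theta> h N0) auto
    finally show ?thesis by simp
  qed
  have block: "(\<Sum>x\<in>{1 + l * i..l + l * i}. h x * (\<Theta> * N x - a * Q x))
     \<le> a * s0 * H * (\<Sum>x\<in>{1 + l * i..l + l * i}. h x) + (\<Sum>x\<in>{1 + l * i..<l + l * i}. D x) / 2"
    if i: "i < M" for i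
  proof -
    let ?B = "{1 + l * i..l + l * i}"
    define hB where "hB = exp (- \<epsilon> * real l) * front_slope \<epsilon> (real (l * i) - c)"
    have hB0: "0 \<le> hB" using front_slope_pos[of \<epsilon> "real (l * i) - c"] by (simp add: hB_def)
    have hB1: "hB \<le> 1"
    proof -
      have "hB \<le> 1 * 1" unfolding hB_def
        using front_slope_pos[of \<epsilon> "real (l * i) - c"] front_slope_le_1[of \<epsilon> "real (l * i) - c"] pos
        by (intro mult_mono) auto
      then show ?thesis by simp
    qed
    have hx: "hB \<le> h x" "h x \<le> exp (2 * \<epsilon> * real l) * hB" if x: "x \<in> ?B" for x
    proof -
      define j where "j = real x - real (l * i)"
      have j: "0 \<le> j" "j \<le> real l"
        using x of_nat_mono[of x "l + l * i", where ?'a = real] unfolding j_def by (auto simp del: of_nat_mult)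
      have xj: "real x - c = (real (l * i) - c) + j" by (simp add: j_def)
      have f0: "0 \<le> front_slope \<epsilon> (real (l * i) - c)" by (rule less_imp_le[OF front_slope_pos])
      have "hB \<le> exp (- \<epsilon> * j) * front_slope \<epsilon> (real (l * i) - c)"
        unfolding hB_def using j pos f0 by (intro mult_right_mono) auto
      also have "\<dots> \<le> h x" unfolding h_def xj by (rule front_slope_shift(2)) (use pos j in auto)
      finally show "hB \<le> h x" .
      have "h x \<le> exp (\<epsilon> * j) * front_slope \<epsilon> (real (l * i) - c)"
        unfolding h_def xj by (rule front_slope_shift(1)) (use pos j in auto)
      also have "\<dots> \<le> exp (\<epsilon> * real l) * front_slope \<epsilon> (real (l * i) - c)"
        using j pos f0 by (intro mult_right_mono) auto
      also have "\<dots> = exp (2 * \<epsilon> * real l) * hB"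
        by (simp add: hB_def exp_add[symmetric] mult.assoc[symmetric])
      finally show "h x \<le> exp (2 * \<epsilon> * real l) * hB" .
    qed
    have "l * (i + 1) \<le> l * M" using i by (intro mult_le_mono2) auto
    then have B: "?B \<subseteq> {1..m}" by (auto simp: m_def)
    have "(\<Sum>x\<in>?B. h x * (\<Theta> * N x - a * Q x)) \<le> (\<Sum>x\<in>?B. a * hB * (\<gamma> * N x - Q x))"
    proof (rule sum_mono)
      fix x assume x: "x \<in> ?B"
      have "h x * (\<Theta> * N x) \<le> (exp (2 * \<epsilon> * real l) * hB) * (\<Theta> * N x)"
        using hx[OF x] \<Theta> N0[of x] by (intro mult_right_mono) auto
      also have "\<dots> = (\<Theta> * exp (2 * \<epsilon> * real l)) * (hB * N x)" by (simp only: mult_ac)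
      also have "\<dots> \<le> (\<gamma> * a) * (hB * N x)"
        using C1 hB0 N0[of x] by (intro mult_right_mono) (auto simp: \<Theta>_def a_def)
      finally have 1: "h x * (\<Theta> * N x) \<le> (\<gamma> * a) * (hB * N x)" .
      have 2: "hB * (a * Q x) \<le> h x * (a * Q x)"
        using hx[OF x] a Q0[of x] by (intro mult_right_mono) auto
      have "h x * (\<Theta> * N x - a * Q x) = h x * (\<Theta> * N x) - h x * (a * Q x)" by (simp only: right_diff_distrib)
      also have "\<dots> \<le> (\<gamma> * a) * (hB * N x) - hB * (a * Q x)" using 1 2 by linarith
      also have "\<dots> = a * hB * (\<gamma> * N x - Q x)" by (simp add: algebra_simps)
      finally show "h x * (\<Theta> * N x - a * Q x) \<le> a * hB * (\<gamma> * N x - Q x)" .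
    qed
    also have "\<dots> = a * hB * (\<Sum>\<xi>\<in>?C. ?w \<xi> * (r \<xi>)\<^sup>2 * excess \<gamma> ?B \<xi>)"
    proof -
      have "(\<Sum>x\<in>?B. \<gamma> * N x - Q x) = (\<Sum>x\<in>?B. \<Sum>\<xi>\<in>?C. ?w \<xi> * (r \<xi>)\<^sup>2 * (\<gamma> * g (\<xi> x) - real (\<xi> x)))"
        unfolding N_def Q_def sum_distrib_left sum_subtractf[symmetric]
        by (intro sum.cong refl) (simp add: algebra_simps)
      also have "\<dots> = (\<Sum>\<xi>\<in>?C. \<Sum>x\<in>?B. ?w \<xi> * (r \<xi>)\<^sup>2 * (\<gamma> * g (\<xi> x) - real (\<xi> x)))"
        by (rule sum.swap)
      finally show ?thesis by (simp only: excess_def sum_distrib_left[symmetric])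
    qed
    also have "(\<Sum>\<xi>\<in>?C. ?w \<xi> * (r \<xi>)\<^sup>2 * excess \<gamma> ?B \<xi>)
      = (\<Sum>\<xi>\<in>?C. ?w \<xi> * (r \<xi>)\<^sup>2 * (excess \<gamma> ?B \<xi> - s0 * real l)) + s0 * real l * H"
      unfolding H_def sum_distrib_left sum.distrib[symmetric]
      by (intro sum.cong refl) (simp add: algebra_simps)
    also have "a * hB * ((\<Sum>\<xi>\<in>?C. ?w \<xi> * (r \<xi>)\<^sup>2 * (excess \<gamma> ?B \<xi> - s0 * real l)) + s0 * real l * H)
      \<le> a * hB * (\<Gamma> * (\<Sum>x\<in>{1 + l * i..<l + l * i}. D x) + s0 * real l * H)"
    proof (intro mult_left_mono add_right_mono)
      have "(\<Sum>\<xi>\<in>?C. \<Sum>x\<in>{1 + l * i..<l + l * i}. ?w \<xi> * g (\<xi> x) * (r \<xi> - r (move x (x + 1) \<xi>))\<^sup>2)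
         = (\<Sum>x\<in>{1 + l * i..<l + l * i}. D x)" unfolding D_def by (rule sum.swap)
      then show "(\<Sum>\<xi>\<in>?C. ?w \<xi> * (r \<xi>)\<^sup>2 * (excess \<gamma> ?B \<xi> - s0 * real l)) \<le> \<Gamma> * (\<Sum>x\<in>{1 + l * i..<l + l * i}. D x)"
        using block_inequality[OF B loc, where k = k and r = r] by (simp only:)
    qed (use a hB0 in auto)
    also have "\<dots> = (a * \<Gamma>) * hB * (\<Sum>x\<in>{1 + l * i..<l + l * i}. D x) + a * s0 * H * (real l * hB)"
      by (simp add: algebra_simps)
    also have "(a * \<Gamma>) * hB * (\<Sum>x\<in>{1 + l * i..<l + l * i}. D x) \<le> 1 / 2 * 1 * (\<Sum>x\<in>{1 + l * i..<l + l * i}. D x)"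
      using C2 hB0 hB1 a pos by (intro mult_right_mono mult_mono sum_nonneg D0) (auto simp: a_def)
    also have "a * s0 * H * (real l * hB) \<le> a * s0 * H * (\<Sum>x\<in>?B. h x)"
    proof (intro mult_left_mono mult_nonneg_nonneg)
      have "(\<Sum>x\<in>?B. hB) \<le> (\<Sum>x\<in>?B. h x)" by (rule sum_mono) (rule hx)
      then show "real l * hB \<le> (\<Sum>x\<in>?B. h x)" by simp
    qed (use a pos H0 in auto)
    finally show ?thesis by simp
  qed
  have "(\<Sum>x\<in>{1..m}. h x * (\<Theta> * N x - a * Q x)) = (\<Sum>i<M. \<Sum>x\<in>{1 + l * i..l + l * i}. h x * (\<Theta> * N x - a * Q x))"
    unfolding m_def by (rule sum_blocks)
  also have "\<dots> \<le> (\<Sum>i<M. a * s0 * H * (\<Sum>x\<in>{1 + l * i..l + l * i}. h x) + (\<Sum>x\<in>{1 + l * i..<l + l * i}. D x) / 2)"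
    by (intro sum_mono block) simp
  also have "\<dots> = a * s0 * H * (\<Sum>x\<in>{1..m}. h x) + (\<Sum>i<M. \<Sum>x\<in>{1 + l * i..<l + l * i}. D x) / 2"
    unfolding m_def sum_blocks by (simp only: sum.distrib sum_distrib_left sum_divide_distrib)
  also have "(\<Sum>i<M. \<Sum>x\<in>{1 + l * i..<l + l * i}. D x) \<le> (\<Sum>x\<in>{1..<m}. D x)"
    unfolding m_def by (rule sum_block_bonds_le[OF D0])
  also have "a * s0 * H * (\<Sum>x\<in>{1..m}. h x) = lam * v * s0 * H * (\<epsilon> * (\<Sum>x\<in>{1..m}. h x))"
    by (simp add: a_def mult_ac)
  also have "\<dots> \<le> lam * v * s0 * H * exp \<epsilon>"
    unfolding h_def by (intro mult_left_mono sum_front_slope_le) (use pos H0 in auto)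
  finally have sites: "(\<Sum>x\<in>{1..m}. h x * (\<Theta> * N x - a * Q x)) \<le> lam * v * s0 * H * exp \<epsilon> + (\<Sum>x\<in>{1..<m}. D x) / 2"
    by simp
  have "(\<Sum>x\<in>{1..m}. h x * (\<Theta> * N x - a * Q x)) = (\<Sum>x\<in>{1..m}. \<Theta> * h x * N x) - a * (\<Sum>x\<in>{1..m}. h x * Q x)"
    unfolding sum_distrib_left sum_subtractf[symmetric] by (intro sum.cong refl) (simp add: algebra_simps)
  then show ?thesis
    using form tilts sites unfolding h_def[symmetric] Q_def[symmetric] a_def[symmetric]
    by (simp add: algebra_simps)
qed

lemma exit_emptying_derivative:
  assumes "\<xi> \<in> configs m {..k}"
  shows "((\<lambda>t. emptying_prob m t \<xi>) has_real_derivative exit_gen m (emptying_prob m t) \<xi>) (at t)"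
proof -
  obtain C where C: "\<And>n. g n \<le> C * real n" "0 < C" using g_linear_bound by blast
  show ?thesis
    using jump_process.semigroup_has_derivative[OF exit_process[OF C] assms, of empty_indicator t]
    by (simp add: emptying_prob_def[abs_def])
qed

lemma emptying_prob_0: "emptying_prob m 0 \<xi> = empty_indicator \<xi>"
proof -
  have "(\<lambda>n. 0 ^ n / fact n * (exit_gen m ^^ n) empty_indicator \<xi>) =
     (\<lambda>n. if n = 0 then empty_indicator \<xi> else 0)" by auto
  then show ?thesis
    using sums_single[of 0 "\<lambda>_. empty_indicator \<xi>"]
    by (simp add: emptying_prob_def gen_exp_def sums_iff)
qed

text \<open>Gronwall's lemma for the tilted norm. The time \<open>s\<close> runs backwards: the emptying probability with
remaining time \<open>s\<close> is tilted by the front at its position \<open>x0 + v * (T - s)\<close>. At \<open>s = 0\<close> only the empty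
configuration contributes, whose tilt and weight are one.\<close>

lemma emptying_prob_bound:
  fixes \<epsilon> lam v x0 T s0 \<gamma> \<Gamma> :: real and l M k :: nat
  defines "m \<equiv> l * M" and "z \<equiv> lam * (exp \<epsilon> - 1)"
  defines "c \<equiv> lam * v * s0 * exp \<epsilon> + p * exp (2 * (lam * front \<epsilon> (real m - x0 - v * T))) / 2"
  assumes pos: "0 < lam" "0 < \<epsilon>" "0 < v" "0 \<le> s0" "0 < \<gamma>" "0 \<le> \<Gamma>" "0 < l" "0 < M"
    and z1: "z \<le> 1" and C1: "(2 * p - 1 + z) * z * exp (2 * \<epsilon> * real l) \<le> \<gamma> * (lam * v * \<epsilon>)"
    and C2: "lam * v * \<epsilon> * \<Gamma> \<le> 1 / 2"
    and loc: "\<And>k R. (\<Sum>\<sigma>\<in>configs l {..k}. weight l \<sigma> * (R \<sigma>)\<^sup>2 * (excess \<gamma> {1..l} \<sigma> - s0 * real l))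
       \<le> \<Gamma> * energy l {..k} R"
    and t: "0 \<le> t" "t \<le> T" and \<xi>: "\<xi> \<in> configs m {..k}"
  shows "(emptying_prob m t \<xi>)\<^sup>2 * weight m \<xi>
    \<le> exp (2 * (c * T - lam * (\<Sum>x\<in>{1..m}. real (\<xi> x) * front \<epsilon> (real x - x0))))"
proof -
  let ?C = "configs m {..k}" and ?w = "weight m"
  define b where "b s x = lam * front \<epsilon> (real x - (x0 + v * (T - s)))" for s and x :: nat
  define r where "r s \<xi> = emptying_prob m s \<xi> * exp (potential m (b s) \<xi>)" for s \<xi>
  define H where "H s = (\<Sum>\<xi>\<in>?C. ?w \<xi> * (r s \<xi>)\<^sup>2)" for s
  define H' where "H' s = 2 * ((\<Sum>\<xi>\<in>?C. ?w \<xi> * (r s \<xi> * exp (potential m (b s) \<xi>)) * exit_gen m (emptying_prob m s) \<xi>)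
      - lam * v * \<epsilon> * (\<Sum>x\<in>{1..m}. front_slope \<epsilon> (real x - (x0 + v * (T - s))) *
           (\<Sum>\<xi>\<in>?C. ?w \<xi> * real (\<xi> x) * (r s \<xi>)\<^sup>2)))" for s
  have w: "0 \<le> ?w \<xi>" for \<xi> by (rule less_imp_le[OF weight_pos])
  have fin: "finite ?C" by (simp add: finite_configs)
  have H0: "0 \<le> H s" for s unfolding H_def by (intro sum_nonneg mult_nonneg_nonneg w) simp
  have c0: "0 \<le> c" using pos p by (simp add: c_def)
  have db: "((\<lambda>s. b s x) has_real_derivative - (lam * v * \<epsilon> * front_slope \<epsilon> (real x - (x0 + v * (T - s))))) (at s)" for x s
  proof -
    have "((\<lambda>s. front \<epsilon> ((real x - x0 - v * T) - (- v) * s)) has_real_derivative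
        (- v) * \<epsilon> * front_slope \<epsilon> ((real x - x0 - v * T) - (- v) * s)) (at s)"
      by (rule front_has_derivative)
    moreover have "(real x - x0 - v * T) - (- v) * s = real x - (x0 + v * (T - s))" for s
      by (simp add: algebra_simps)
    ultimately have "((\<lambda>s. front \<epsilon> (real x - (x0 + v * (T - s)))) has_real_derivative
        (- v) * \<epsilon> * front_slope \<epsilon> (real x - (x0 + v * (T - s)))) (at s)" by (simp only:)
    from DERIV_cmult[OF this, of lam] show ?thesis by (simp add: b_def mult_ac)
  qed
  have dH: "(H has_real_derivative H' s) (at s)" for s
  proof -
    define q where "q \<xi> = - (lam * v * \<epsilon>) * (\<Sum>x\<in>{1..m}. front_slope \<epsilon> (real x - (x0 + v * (T - s))) * real (\<xi> x))" for \<xi> :: "nat \<Rightarrow> nat"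
    have dp: "((\<lambda>s. potential m (b s) \<xi>) has_real_derivative q \<xi>) (at s)" for \<xi>
    proof -
      have "((\<lambda>s. \<Sum>x\<in>{1..m}. real (\<xi> x) * b s x) has_real_derivative
         (\<Sum>x\<in>{1..m}. real (\<xi> x) * - (lam * v * \<epsilon> * front_slope \<epsilon> (real x - (x0 + v * (T - s)))))) (at s)"
        by (intro DERIV_sum DERIV_cmult db)
      moreover have "(\<Sum>x\<in>{1..m}. real (\<xi> x) * - (lam * v * \<epsilon> * front_slope \<epsilon> (real x - (x0 + v * (T - s))))) = q \<xi>"
        unfolding q_def sum_distrib_left by (intro sum.cong refl) simp
      ultimately show ?thesis by (simp add: potential_def)
    qed
    have dr: "((\<lambda>s. r s \<xi>) has_real_derivative
       exit_gen m (emptying_prob m s) \<xi> * exp (potential m (b s) \<xi>) + r s \<xi> * q \<xi>) (at s)" if "\<xi> \<in> ?C" for \<xi>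
      unfolding r_def
      by (rule derivative_eq_intros exit_emptying_derivative[OF that] dp refl)+ (simp add: mult_ac)
    have "(H has_real_derivative (\<Sum>\<xi>\<in>?C. ?w \<xi> * (2 * r s \<xi> *
        (exit_gen m (emptying_prob m s) \<xi> * exp (potential m (b s) \<xi>) + r s \<xi> * q \<xi>)))) (at s)"
      unfolding H_def[abs_def] power2_eq_square
    proof (intro DERIV_sum DERIV_cmult)
      fix \<xi> assume "\<xi> \<in> ?C"
      from DERIV_mult[OF dr[OF this] dr[OF this]]
      show "((\<lambda>s. r s \<xi> * r s \<xi>) has_real_derivative 2 * r s \<xi> *
        (exit_gen m (emptying_prob m s) \<xi> * exp (potential m (b s) \<xi>) + r s \<xi> * q \<xi>)) (at s)"
        by (simp add: algebra_simps)
    qed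
    also have "(\<Sum>\<xi>\<in>?C. ?w \<xi> * (2 * r s \<xi> *
        (exit_gen m (emptying_prob m s) \<xi> * exp (potential m (b s) \<xi>) + r s \<xi> * q \<xi>)))
      = 2 * ((\<Sum>\<xi>\<in>?C. ?w \<xi> * (r s \<xi> * exp (potential m (b s) \<xi>)) * exit_gen m (emptying_prob m s) \<xi>)
         + (\<Sum>\<xi>\<in>?C. ?w \<xi> * (r s \<xi>)\<^sup>2 * q \<xi>))"
      unfolding sum.distrib[symmetric] sum_distrib_left
      by (intro sum.cong refl) (simp add: algebra_simps power2_eq_square)
    also have "(\<Sum>\<xi>\<in>?C. ?w \<xi> * (r s \<xi>)\<^sup>2 * q \<xi>) = - (lam * v * \<epsilon>) *
       (\<Sum>x\<in>{1..m}. front_slope \<epsilon> (real x - (x0 + v * (T - s))) * (\<Sum>\<xi>\<in>?C. ?w \<xi> * real (\<xi> x) * (r s \<xi>)\<^sup>2))"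
    proof -
      have "(\<Sum>\<xi>\<in>?C. ?w \<xi> * (r s \<xi>)\<^sup>2 * q \<xi>) = - (lam * v * \<epsilon>) *
        (\<Sum>\<xi>\<in>?C. \<Sum>x\<in>{1..m}. front_slope \<epsilon> (real x - (x0 + v * (T - s))) * (?w \<xi> * real (\<xi> x) * (r s \<xi>)\<^sup>2))"
        unfolding q_def sum_distrib_left by (intro sum.cong refl) (simp add: mult_ac)
      then show ?thesis by (subst (asm) sum.swap) (simp only: sum_distrib_left)
    qed
    finally show ?thesis by (simp add: H'_def)
  qed
  have growth: "H' s \<le> 2 * c * H s" if s: "0 \<le> s" "s \<le> T" for s
  proof -
    have "H' s \<le> 2 * ((lam * v * s0 * exp \<epsilon> + p * exp (2 * b s m) / 2) * H s)"
      unfolding H'_def H_def r_def b_def m_def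
      by (intro mult_left_mono front_form_bound[OF pos z1[unfolded z_def] C1[unfolded z_def] C2 loc]) simp
    also have "\<dots> \<le> 2 * (c * H s)"
    proof (intro mult_left_mono mult_right_mono H0)
      have "front \<epsilon> (real m - (x0 + v * (T - s))) \<le> front \<epsilon> (real m - x0 - v * T)"
        using pos s by (intro front_antimono) (auto simp: algebra_simps)
      then have "exp (2 * b s m) \<le> exp (2 * (lam * front \<epsilon> (real m - x0 - v * T)))"
        using pos by (simp add: b_def)
      then show "lam * v * s0 * exp \<epsilon> + p * exp (2 * b s m) / 2 \<le> c"
        unfolding c_def using p by (simp add: mult_left_mono)
    qed simp
    finally show ?thesis by simp
  qed
  have "H t * exp (- 2 * c * t) \<le> H 0 * exp (- 2 * c * 0)"
  proof (rule DERIV_nonpos_imp_nonincreasing[OF t(1)])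
    fix s assume s: "0 \<le> s" "s \<le> t"
    have "((\<lambda>s. H s * exp (- 2 * c * s)) has_real_derivative (H' s - 2 * c * H s) * exp (- 2 * c * s)) (at s)"
      by (rule derivative_eq_intros dH refl)+ (simp add: algebra_simps)
    moreover have "(H' s - 2 * c * H s) * exp (- 2 * c * s) \<le> 0"
      using growth[of s] s t by (intro mult_nonpos_nonneg) auto
    ultimately show "\<exists>y. ((\<lambda>s. H s * exp (- 2 * c * s)) has_real_derivative y) (at s) \<and> y \<le> 0" by blast
  qed
  moreover have "H 0 = 1"
  proof -
    have "(\<lambda>_. 0) \<in> ?C" by (simp add: configs_def)
    moreover have "?w (\<lambda>_. 0) * (r 0 (\<lambda>_. 0))\<^sup>2 = 1"
      by (simp add: r_def emptying_prob_0 empty_indicator_def weight_def potential_def)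
    moreover have "?w \<xi> * (r 0 \<xi>)\<^sup>2 = 0" if "\<xi> \<noteq> (\<lambda>_. 0)" for \<xi>
      using that by (simp add: r_def emptying_prob_0 empty_indicator_def)
    ultimately show ?thesis
      unfolding H_def by (subst sum.mono_neutral_right[of _ "{\<lambda>_. 0}"]) (use fin in auto)
  qed
  ultimately have "H t * exp (- 2 * c * t) \<le> 1" by simp
  then have "H t * exp (- 2 * c * t) * exp (2 * c * t) \<le> 1 * exp (2 * c * t)"
    by (intro mult_right_mono) auto
  then have "H t \<le> exp (2 * c * t)" by (simp add: mult.assoc exp_add[symmetric])
  also have "\<dots> \<le> exp (2 * c * T)" using t c0 by (simp add: mult_left_mono)
  finally have Ht: "H t \<le> exp (2 * c * T)" .
  have "?w \<xi> * (r t \<xi>)\<^sup>2 \<le> H t"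
    unfolding H_def by (rule member_le_sum[of \<xi> _ "\<lambda>\<xi>. ?w \<xi> * (r t \<xi>)\<^sup>2"]) (use \<xi> fin w in auto)
  then have "?w \<xi> * (r t \<xi>)\<^sup>2 \<le> exp (2 * c * T)" using Ht by linarith
  moreover have "(r t \<xi>)\<^sup>2 = (emptying_prob m t \<xi>)\<^sup>2 * exp (2 * potential m (b t) \<xi>)"
    by (simp add: r_def power_mult_distrib exp_double)
  ultimately have "(emptying_prob m t \<xi>)\<^sup>2 * ?w \<xi> * exp (2 * potential m (b t) \<xi>) * exp (- 2 * potential m (b t) \<xi>)
      \<le> exp (2 * c * T) * exp (- 2 * potential m (b t) \<xi>)"
    by (intro mult_right_mono) (simp_all add: mult_ac)
  then have "(emptying_prob m t \<xi>)\<^sup>2 * ?w \<xi> \<le> exp (2 * c * T - 2 * potential m (b t) \<xi>)"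
    by (simp add: mult.assoc exp_add[symmetric])
  also have "\<dots> \<le> exp (2 * (c * T - lam * (\<Sum>x\<in>{1..m}. real (\<xi> x) * front \<epsilon> (real x - x0))))"
  proof -
    have "lam * (\<Sum>x\<in>{1..m}. real (\<xi> x) * front \<epsilon> (real x - x0)) \<le> potential m (b t) \<xi>"
      unfolding potential_def sum_distrib_left
    proof (rule sum_mono)
      fix x
      have "front \<epsilon> (real x - x0) \<le> front \<epsilon> (real x - (x0 + v * (T - t)))"
        using pos t by (intro front_antimono) auto
      then have "(lam * real (\<xi> x)) * front \<epsilon> (real x - x0) \<le> (lam * real (\<xi> x)) * front \<epsilon> (real x - (x0 + v * (T - t)))"
        using pos by (intro mult_left_mono) auto
      then show "lam * (real (\<xi> x) * front \<epsilon> (real x - x0)) \<le> real (\<xi> x) * b t x"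
        by (simp add: b_def mult_ac)
    qed
    then show ?thesis by simp
  qed
  finally show ?thesis .
qed

end

context zero_range_process
begin

section \<open>A single particle\<close>

text \<open>An exponential supersolution. Reflection at site \<open>1\<close> pushes the walk to the right; the function
\<open>((1 - p) / p) ^ x\<close> is harmonic inside the segment and compensates this push.\<close>

lemma single_particle_emptying_prob:
  assumes lam: "0 < lam" and m: "1 \<le> m" and t: "0 \<le> t"
  shows "emptying_prob m t (add_particle 1 (\<lambda>_. 0)) \<le>
     exp (g 1 * tilt lam * t - lam * (real m + 1)) * (exp lam + (exp lam - 1) / (1 - (1 - p) / p) * ((1 - p) / p))"
proof -
  obtain C where C: "\<And>n. g n \<le> C * real n" "0 < C" using g_linear_bound by blast
  interpret jump_process "exit_moves m" jump_rate "exit_move m" "configs m {..1}" "C * real (Suc 1)"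
    by (rule exit_process[OF C])
  define \<rho> where "\<rho> = (1 - p) / p"
  have \<rho>: "0 \<le> \<rho>" "\<rho> < 1" "p * \<rho> = 1 - p" using p by (auto simp: \<rho>_def)
  define K where "K = (exp lam - 1) / (1 - \<rho>)"
  have K: "0 \<le> K" "K * (1 - \<rho>) = exp lam - 1" using lam \<rho> by (auto simp: K_def)
  define f where "f x = exp (lam * real x) + K * \<rho> ^ x" for x :: nat
  have f0: "0 \<le> f x" for x using K \<rho> by (simp add: f_def)
  define e where "e = exp (lam * (real m + 1))"
  define F where "F \<xi> = (if \<xi> = (\<lambda>_. 0) then e else \<Sum>x\<in>{1..m}. real (\<xi> x) * f x) / e" for \<xi> :: "nat \<Rightarrow> nat"
  have e: "0 < e" by (simp add: e_def)
  let ?\<delta> = "\<lambda>x. add_particle x (\<lambda>_. 0)"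
  have F\<delta>: "F (?\<delta> x) = f x / e" if "x \<in> {1..m}" for x
  proof -
    have "?\<delta> x \<noteq> (\<lambda>_. 0)" by (auto simp: add_particle_def fun_eq_iff)
    moreover have "(\<Sum>y\<in>{1..m}. real (?\<delta> x y) * f y) = (\<Sum>y\<in>{1..m}. if y = x then f x else 0)"
      by (intro sum.cong) (auto simp: add_particle_apply)
    ultimately show ?thesis using that by (simp add: F_def)
  qed
  have states: "\<xi> = (\<lambda>_. 0) \<or> (\<exists>x\<in>{1..m}. \<xi> = ?\<delta> x)" if "\<xi> \<in> configs m {..1}" for \<xi>
  proof (cases "\<exists>x\<in>{1..m}. 0 < \<xi> x")
    case True
    then obtain x where x: "x \<in> {1..m}" "0 < \<xi> x" by blast
    obtain \<zeta> where \<zeta>: "\<zeta> \<in> configs m {0}" "\<xi> = add_particle x \<zeta>"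
      by (rule remove_particle[OF x(1) \<open>\<xi> \<in> configs m {..1}\<close> x(2), where D = "{0}"]) auto
    have "\<zeta> = (\<lambda>_. 0)" using config_le_total[OF \<zeta>(1), of 0] by auto
    then show ?thesis using \<zeta> x by auto
  next
    case False
    then show ?thesis using that by (auto simp: configs_def fun_eq_iff)
  qed
  have super: "exit_gen m F \<xi> \<le> (g 1 * tilt lam) * F \<xi>" if "\<xi> \<in> configs m {..1}" for \<xi>
    using states[OF that]
  proof
    assume "\<xi> = (\<lambda>_. 0)"
    then show ?thesis
      using e g_nonneg[of 1] tilt_nonneg[of lam] lam by (simp add: jump_gen_def jump_rate_def F_def)
  next
    assume "\<exists>x\<in>{1..m}. \<xi> = ?\<delta> x"
    then obtain x where x: "x \<in> {1..m}" and \<xi>: "\<xi> = ?\<delta> x" by blast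
    let ?h = "\<lambda>i. jump_rate i \<xi> * (F (exit_move m i \<xi>) - F \<xi>)"
    have rate: "jump_rate (b, y) \<xi> = (if y = x then (if b then p else 1 - p) * g 1 else 0)" for b y
      by (simp add: jump_rate_def \<xi> add_particle_apply)
    have fin: "finite (exit_moves m)" by (rule finite_exit_moves)
    have "exit_gen m F \<xi> = (\<Sum>i\<in>exit_moves m \<inter> {(True, x), (False, x)}. ?h i)"
      unfolding jump_gen_def
      by (rule sum.mono_neutral_right[OF fin]) (auto simp: rate)
    also have "exit_moves m \<inter> {(True, x), (False, x)} = (if x = 1 then {(True, x)} else {(True, x), (False, x)})"
      using x by (auto simp: exit_moves_def)
    finally have gen: "exit_gen m F \<xi> = (if x = 1 then ?h (True, x) else ?h (True, x) + ?h (False, x))"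
      by simp
    have right: "?h (True, x) \<le> p * g 1 * (f (x + 1) - f x) / e"
    proof -
      have "F (exit_move m (True, x) \<xi>) \<le> f (x + 1) / e"
      proof (cases "x = m")
        case True
        have "exit_move m (True, x) \<xi> = (\<lambda>_. 0)"
          using True by (auto simp: exit_move_def \<xi> add_particle_def fun_eq_iff)
        moreover have "e \<le> f (x + 1)" using K \<rho> True by (simp add: e_def f_def add.commute)
        ultimately show ?thesis using e by (simp add: F_def)
      next
        case False
        have "exit_move m (True, x) \<xi> = ?\<delta> (x + 1)"
          using False x unfolding \<xi> by (subst exit_move_add_particle) (auto simp: exit_moves_def)
        then show ?thesis using F\<delta>[of "x + 1"] False x by simp
      qed
      moreover have "F \<xi> = f x / e" unfolding \<xi> by (rule F\<delta>[OF x])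
      ultimately have "F (exit_move m (True, x) \<xi>) - F \<xi> \<le> (f (x + 1) - f x) / e"
        by (simp add: diff_divide_distrib)
      from mult_left_mono[OF this, of "p * g 1"] show ?thesis
        using p g_nonneg[of 1] by (simp add: rate)
    qed
    have "(if x = 1 then ?h (True, x) else ?h (True, x) + ?h (False, x)) \<le> g 1 * (tilt lam * f x) / e"
    proof (cases "x = 1")
      case True
      have "p * (f 2 - f 1) = exp lam * (p * (exp lam - 1)) - K * (1 - \<rho>) * (p * \<rho>)"
      proof -
        have "f 2 = exp lam * exp lam + K * (\<rho> * \<rho>)" "f 1 = exp lam + K * \<rho>"
          by (simp_all add: f_def power2_eq_square exp_add[symmetric])
        then show ?thesis by (simp add: algebra_simps)
      qed
      also have "\<dots> = exp lam * (p * (exp lam - 1)) - (exp lam - 1) * (1 - p)"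
        unfolding K(2) \<rho>(3) ..
      also have "\<dots> = tilt lam * exp lam"
        by (simp add: tilt_def exp_minus field_simps)
      also have "\<dots> \<le> tilt lam * f 1"
        using tilt_nonneg[of lam] lam K \<rho> by (intro mult_left_mono) (auto simp: f_def)
      finally have "g 1 * (p * (f 2 - f 1)) / e \<le> g 1 * (tilt lam * f 1) / e"
        using e g_nonneg[of 1] by (intro divide_right_mono mult_left_mono) auto
      then show ?thesis using right True by (simp add: mult_ac numeral_2_eq_2)
    next
      case False
      then obtain y where y: "x = Suc y" "1 \<le> y" using x by (cases x) auto
      have left: "?h (False, x) = (1 - p) * g 1 * (f (x - 1) - f x) / e"
      proof -
        have "exit_move m (False, x) \<xi> = ?\<delta> (x - 1)"
          using False x unfolding \<xi> by (subst exit_move_add_particle) (auto simp: exit_moves_def)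
        moreover have "F (?\<delta> (x - 1)) = f (x - 1) / e" by (rule F\<delta>) (use x False in auto)
        ultimately have "F (exit_move m (False, x) \<xi>) - F \<xi> = (f (x - 1) - f x) / e"
          using F\<delta>[OF x] unfolding \<xi> by (simp add: diff_divide_distrib)
        then show ?thesis by (simp add: rate)
      qed
      have "p * (f (x + 1) - f x) + (1 - p) * (f (x - 1) - f x)
         = tilt lam * exp (lam * real x) + K * \<rho> ^ y * (p * \<rho> * \<rho> + (1 - p) - \<rho>)"
      proof -
        have "f (x + 1) = exp (lam * real x) * exp lam + K * \<rho> ^ y * \<rho> * \<rho>"
          "f x = exp (lam * real x) + K * \<rho> ^ y * \<rho>"
          "f (x - 1) = exp (lam * real x) * exp (- lam) + K * \<rho> ^ y"
          by (simp_all add: f_def y exp_add[symmetric] algebra_simps)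
        then show ?thesis by (simp add: tilt_def algebra_simps)
      qed
      also have "p * \<rho> * \<rho> + (1 - p) - \<rho> = 0"
      proof -
        have "p * \<rho> * \<rho> = (1 - p) * \<rho>" by (simp add: \<rho>(3))
        then have "p * \<rho> * \<rho> + (1 - p) - \<rho> = (1 - p) - p * \<rho>" by (simp add: algebra_simps)
        then show ?thesis by (simp add: \<rho>(3))
      qed
      also have "tilt lam * exp (lam * real x) + K * \<rho> ^ y * 0 \<le> tilt lam * f x"
        using tilt_nonneg[of lam] lam K \<rho> by (simp add: f_def mult_left_mono)
      finally have "g 1 * (p * (f (x + 1) - f x) + (1 - p) * (f (x - 1) - f x)) / e \<le> g 1 * (tilt lam * f x) / e"
        using e g_nonneg[of 1] by (intro divide_right_mono mult_left_mono) auto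
      then have "p * g 1 * (f (x + 1) - f x) / e + (1 - p) * g 1 * (f (x - 1) - f x) / e \<le> g 1 * (tilt lam * f x) / e"
        by (simp add: add_divide_distrib[symmetric] algebra_simps)
      then show ?thesis using right left False by simp
    qed
    then show ?thesis unfolding gen unfolding \<xi> F\<delta>[OF x] by simp
  qed
  have init: "empty_indicator \<xi> \<le> F \<xi>" for \<xi>
    using e f0 by (auto simp: empty_indicator_def F_def intro!: divide_nonneg_pos sum_nonneg mult_nonneg_nonneg)
  have in1: "?\<delta> 1 \<in> configs m {..1}"
    by (rule add_particle_in_configs[of _ _ _ "{0}"]) (use m in \<open>auto simp: configs_def\<close>)
  have "emptying_prob m t (?\<delta> 1) \<le> exp ((g 1 * tilt lam) * t) * F (?\<delta> 1)"
    unfolding emptying_prob_def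
    by (rule semigroup_le_exp_supersolution[OF super init _ in1 t])
       (use g_nonneg[of 1] tilt_nonneg[of lam] lam in auto)
  also have "F (?\<delta> 1) = f 1 / e" by (rule F\<delta>) (use m in auto)
  also have "exp ((g 1 * tilt lam) * t) * (f 1 / e) = exp (g 1 * tilt lam * t - lam * (real m + 1)) * f 1"
    by (simp add: e_def exp_diff)
  finally show ?thesis by (simp add: f_def K_def \<rho>_def)
qed

section \<open>The equilibrium puts no particle far from the right end\<close>

text \<open>Detailed balance across one bond.\<close>

lemma equilibrium_current_balance:
  assumes x: "1 \<le> x" "x < N" and "p < 1"
  shows "p / (1 - p) * (\<Sum>\<eta>\<in>zrp_configs N k. equilibrium_weight g p N \<eta> * g (\<eta> x))
      = (\<Sum>\<eta>\<in>zrp_configs N k. equilibrium_weight g p N \<eta> * g (\<eta> (x + 1)))"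
proof -
  let ?a = "p / (1 - p)" and ?X = "zrp_configs N k" and ?W = "equilibrium_weight g p N"
  define f where "f y n = ?a ^ (n * y) / g_fact g n" for y n
  have fS: "f y (Suc n) * g (Suc n) = ?a ^ y * f y n" for y n
  proof -
    have "f y (Suc n) * g (Suc n) = ?a ^ (Suc n * y) * (g (Suc n) / g_fact g (Suc n))"
      by (simp add: f_def)
    also have "\<dots> = ?a ^ y * f y n"
      unfolding g_weight_Suc by (simp add: f_def power_add)
    finally show ?thesis .
  qed
  have W: "?W \<eta> = f x (\<eta> x) * (f (x + 1) (\<eta> (x + 1)) * (\<Prod>y\<in>{1..N} - {x} - {x + 1}. f y (\<eta> y)))" for \<eta>
  proof -
    have "?W \<eta> = (\<Prod>y\<in>{1..N}. f y (\<eta> y))" by (simp add: equilibrium_weight_def f_def)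
    also have "\<dots> = f x (\<eta> x) * (\<Prod>y\<in>{1..N} - {x}. f y (\<eta> y))"
      by (rule prod.remove) (use x in auto)
    also have "(\<Prod>y\<in>{1..N} - {x}. f y (\<eta> y)) = f (x + 1) (\<eta> (x + 1)) * (\<Prod>y\<in>{1..N} - {x} - {x + 1}. f y (\<eta> y))"
      by (rule prod.remove) (use x in auto)
    finally show ?thesis .
  qed
  have drop: "(\<Sum>\<eta>\<in>?X. ?W \<eta> * g (\<eta> y)) = (\<Sum>\<eta>\<in>{\<eta> \<in> ?X. 0 < \<eta> y}. ?W \<eta> * g (\<eta> y))" for y
    by (rule sum.mono_neutral_right) (auto simp: finite_zrp_configs)
  have "?a * (\<Sum>\<eta>\<in>?X. ?W \<eta> * g (\<eta> x)) = (\<Sum>\<eta>\<in>{\<eta> \<in> ?X. 0 < \<eta> x}. ?a * (?W \<eta> * g (\<eta> x)))"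
    by (simp only: drop sum_distrib_left)
  also have "\<dots> = (\<Sum>\<eta>\<in>{\<eta> \<in> ?X. 0 < \<eta> (x + 1)}. ?W \<eta> * g (\<eta> (x + 1)))"
  proof (rule sum.reindex_bij_witness[of _ "move (x + 1) x" "move x (x + 1)"])
    fix \<eta> assume \<eta>: "\<eta> \<in> {\<eta> \<in> ?X. 0 < \<eta> x}"
    show "move (x + 1) x (move x (x + 1) \<eta>) = \<eta>" using \<eta> by (auto simp: move_def fun_eq_iff)
    have "move x (x + 1) \<eta> \<in> ?X" by (rule move_in_zrp_configs) (use \<eta> x in auto)
    then show "move x (x + 1) \<eta> \<in> {\<eta> \<in> ?X. 0 < \<eta> (x + 1)}" by (simp add: move_def)
    let ?\<eta>' = "move x (x + 1) \<eta>"
    obtain n where n: "\<eta> x = Suc n" using \<eta> by (cases "\<eta> x") auto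
    define R where "R = (\<Prod>y\<in>{1..N} - {x} - {x + 1}. f y (\<eta> y))"
    have R': "(\<Prod>y\<in>{1..N} - {x} - {x + 1}. f y (?\<eta>' y)) = R"
      unfolding R_def by (intro prod.cong) (auto simp: move_def)
    have "?W ?\<eta>' * g (?\<eta>' (x + 1)) = f x n * (f (x + 1) (Suc (\<eta> (x + 1))) * g (Suc (\<eta> (x + 1)))) * R"
      unfolding W R' using n by (simp add: move_def)
    also have "\<dots> = ?a * (f x (Suc n) * g (Suc n)) * f (x + 1) (\<eta> (x + 1)) * R"
      unfolding fS by simp
    also have "\<dots> = ?a * (?W \<eta> * g (\<eta> x))" unfolding W R_def[symmetric] n by simp
    finally show "?W ?\<eta>' * g (?\<eta>' (x + 1)) = ?a * (?W \<eta> * g (\<eta> x))" .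
  next
    fix \<eta> assume \<eta>: "\<eta> \<in> {\<eta> \<in> ?X. 0 < \<eta> (x + 1)}"
    show "move x (x + 1) (move (x + 1) x \<eta>) = \<eta>" using \<eta> by (auto simp: move_def fun_eq_iff)
    have "move (x + 1) x \<eta> \<in> ?X" by (rule move_in_zrp_configs) (use \<eta> x in auto)
    then show "move (x + 1) x \<eta> \<in> {\<eta> \<in> ?X. 0 < \<eta> x}" by (simp add: move_def)
  qed
  also have "\<dots> = (\<Sum>\<eta>\<in>?X. ?W \<eta> * g (\<eta> (x + 1)))" by (simp only: drop)
  finally show ?thesis .
qed

definition left_empty :: "nat \<Rightarrow> nat \<Rightarrow> nat \<Rightarrow> (nat \<Rightarrow> nat) set" where
  "left_empty N k m = {\<eta> \<in> zrp_configs N k. restriction m \<eta> = (\<lambda>_. 0)}"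

lemma zrp_configs_pile:
  assumes "1 \<le> N" shows "(\<lambda>i\<in>{1..N}. if i = N then k else 0) \<in> zrp_configs N k"
  using assms by (auto simp: zrp_configs_def)

lemma equilibrium_left_empty:
  assumes C: "\<And>n. g n \<le> C * real n" and m: "m < N"
  shows "1 - real m * ((1 - p) / p) ^ (N - m) * (C * real k / g 1)
     \<le> measure (zrp_equilibrium g p N k) (left_empty N k m)"
proof (cases "p = 1")
  case True
  let ?\<eta> = "\<lambda>i\<in>{1..N}. if i = N then k else 0"
  have "?\<eta> \<in> left_empty N k m"
    using zrp_configs_pile[of N k] m by (auto simp: left_empty_def restriction_def fun_eq_iff)
  moreover have "left_empty N k m \<in> sets (count_space (zrp_configs N k))"
    by (auto simp: left_empty_def)
  ultimately have "measure (zrp_equilibrium g p N k) (left_empty N k m) = 1"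
    using True by (simp add: zrp_equilibrium_def measure_return)
  moreover have "real m * ((1 - p) / p) ^ (N - m) * (C * real k / g 1) = 0"
    using m True by simp
  ultimately show ?thesis by linarith
next
  case False
  then have p1: "p < 1" using p by simp
  let ?X = "zrp_configs N k" and ?W = "equilibrium_weight g p N" and ?E = "left_empty N k m"
  define \<rho> where "\<rho> = (1 - p) / p"
  have \<rho>: "0 < \<rho>" "\<rho> < 1" using p p1 by (auto simp: \<rho>_def)
  define Z where "Z = (\<Sum>\<xi>\<in>?X. ?W \<xi>)"
  have W: "0 < ?W \<eta>" for \<eta>
    unfolding equilibrium_weight_def using p p1
    by (intro prod_pos) (auto intro!: divide_pos_pos zero_less_power g_fact_pos)
  have fin: "finite ?X" by (rule finite_zrp_configs)
  have "?X \<noteq> {}" using zrp_configs_pile[of N k] m by auto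
  then have Z: "0 < Z" unfolding Z_def using fin W by (intro sum_pos) auto
  define S where "S x = (\<Sum>\<eta>\<in>?X. ?W \<eta> * g (\<eta> x))" for x
  have S0: "0 \<le> S x" for x unfolding S_def by (intro sum_nonneg mult_nonneg_nonneg less_imp_le[OF W] g_nonneg)
  have step: "S x = \<rho> * S (x + 1)" if "1 \<le> x" "x < N" for x
    using equilibrium_current_balance[OF that p1, of k] p p1
    unfolding S_def[symmetric] \<rho>_def by (simp add: field_simps)
  have SN: "S N \<le> C * real k * Z"
  proof -
    have "S N \<le> (\<Sum>\<eta>\<in>?X. ?W \<eta> * (C * real k))"
      unfolding S_def
    proof (intro sum_mono mult_left_mono)
      fix \<eta> assume "\<eta> \<in> ?X"
      then have "\<eta> N \<le> k"
        using member_le_sum[of N "{1..N}" \<eta>] m by (auto simp: zrp_configs_def)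
      then have "g (\<eta> N) \<le> g k" by (rule g_mono)
      then show "g (\<eta> N) \<le> C * real k" using C[of k] by linarith
    qed (simp add: less_imp_le[OF W])
    then show ?thesis by (simp only: Z_def sum_distrib_left mult.commute)
  qed
  have Sx: "S x \<le> \<rho> ^ (N - x) * (C * real k * Z)" if "1 \<le> x" "x \<le> N" for x
    using that(2,1)
  proof (induction x rule: inc_induct)
    case (step n)
    have "S n = \<rho> * S (Suc n)" using \<open>\<And>x. 1 \<le> x \<Longrightarrow> x < N \<Longrightarrow> S x = \<rho> * S (x + 1)\<close>[of n] step by simp
    also have "\<dots> \<le> \<rho> * (\<rho> ^ (N - Suc n) * (C * real k * Z))"
      using step \<rho> by (intro mult_left_mono) auto
    also have "\<dots> = \<rho> ^ (N - n) * (C * real k * Z)"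
      using step(2) by (simp add: Suc_diff_Suc[symmetric])
    finally show ?case .
  qed (use SN in simp)
  have Ck: "0 \<le> C * real k" using C[of k] g_nonneg[of k] by linarith
  have "(\<Sum>\<eta>\<in>?X - ?E. ?W \<eta>) \<le> (\<Sum>\<eta>\<in>?X - ?E. \<Sum>x\<in>{1..m}. ?W \<eta> * g (\<eta> x) / g 1)"
  proof (rule sum_mono)
    fix \<eta> assume \<eta>: "\<eta> \<in> ?X - ?E"
    then obtain x where "restriction m \<eta> x \<noteq> 0" by (auto simp: left_empty_def)
    then have x: "x \<in> {1..m}" "1 \<le> \<eta> x" by (auto simp: restriction_def split: if_splits)
    have "?W \<eta> \<le> ?W \<eta> * g (\<eta> x) / g 1"
      using W[of \<eta>] g_mono[OF x(2)] g1_pos by (simp add: pos_le_divide_eq mult_left_mono)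
    also have "\<dots> \<le> (\<Sum>x\<in>{1..m}. ?W \<eta> * g (\<eta> x) / g 1)"
      by (rule member_le_sum[of _ _ "\<lambda>x. ?W \<eta> * g (\<eta> x) / g 1"])
         (use x g1_pos in \<open>auto intro!: divide_nonneg_pos mult_nonneg_nonneg less_imp_le[OF W] g_nonneg\<close>)
    finally show "?W \<eta> \<le> (\<Sum>x\<in>{1..m}. ?W \<eta> * g (\<eta> x) / g 1)" .
  qed
  also have "\<dots> \<le> (\<Sum>\<eta>\<in>?X. \<Sum>x\<in>{1..m}. ?W \<eta> * g (\<eta> x) / g 1)"
    using fin g1_pos by (intro sum_mono2) (auto intro!: sum_nonneg divide_nonneg_pos mult_nonneg_nonneg less_imp_le[OF W] g_nonneg)
  also have "\<dots> = (\<Sum>x\<in>{1..m}. S x / g 1)"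
    unfolding S_def by (subst sum.swap) (simp add: sum_divide_distrib)
  also have "\<dots> \<le> (\<Sum>x\<in>{1..m}. \<rho> ^ (N - m) * (C * real k * Z) / g 1)"
  proof (intro sum_mono divide_right_mono)
    fix x assume x: "x \<in> {1..m}"
    have "S x \<le> \<rho> ^ (N - x) * (C * real k * Z)" using Sx x m by auto
    also have "\<dots> \<le> \<rho> ^ (N - m) * (C * real k * Z)"
      using \<rho> x Ck Z by (intro mult_right_mono power_decreasing) auto
    finally show "S x \<le> \<rho> ^ (N - m) * (C * real k * Z)" .
  qed (use g1_pos in simp)
  also have "\<dots> = real m * \<rho> ^ (N - m) * (C * real k / g 1) * Z" by simp
  finally have out: "(\<Sum>\<eta>\<in>?X - ?E. ?W \<eta>) \<le> real m * \<rho> ^ (N - m) * (C * real k / g 1) * Z" .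
  have E: "?E \<subseteq> ?X" by (auto simp: left_empty_def)
  have "emeasure (zrp_equilibrium g p N k) ?E = (\<Sum>\<eta>\<in>?E. ennreal (?W \<eta> / Z))"
    using False unfolding zrp_equilibrium_def Z_def by (simp add: emeasure_point_measure_finite[OF fin E])
  also have "\<dots> = ennreal (\<Sum>\<eta>\<in>?E. ?W \<eta> / Z)"
    by (rule sum_ennreal) (use W Z in \<open>auto intro: less_imp_le\<close>)
  finally have "measure (zrp_equilibrium g p N k) ?E = (\<Sum>\<eta>\<in>?E. ?W \<eta> / Z)"
    unfolding measure_def using W Z by (simp add: sum_nonneg less_imp_le)
  also have "\<dots> = (\<Sum>\<eta>\<in>?E. ?W \<eta>) / Z" by (simp add: sum_divide_distrib)
  also have "(\<Sum>\<eta>\<in>?E. ?W \<eta>) = Z - (\<Sum>\<eta>\<in>?X - ?E. ?W \<eta>)"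
    unfolding Z_def using sum.subset_diff[OF E fin, of ?W] by simp
  finally have "measure (zrp_equilibrium g p N k) ?E = 1 - (\<Sum>\<eta>\<in>?X - ?E. ?W \<eta>) / Z"
    using Z by (simp add: diff_divide_distrib)
  moreover have "(\<Sum>\<eta>\<in>?X - ?E. ?W \<eta>) / Z \<le> real m * \<rho> ^ (N - m) * (C * real k / g 1)"
    using out Z by (simp add: pos_divide_le_eq)
  ultimately show ?thesis unfolding \<rho>_def by linarith
qed

section \<open>From the emptying probability to the mixing time\<close>

lemma zrp_semigroup_eq: "zrp_semigroup g p N t J \<eta> = gen_exp (segment_gen N) t J \<eta>"
  by (simp add: zrp_semigroup_def gen_exp_def zrp_generator_eq)

lemma zrp_law_left_empty:
  assumes \<eta>: "\<eta> \<in> zrp_configs N k" and m: "1 \<le> m" "m < N" and t: "0 \<le> t"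
  shows "measure (zrp_law g p N k \<eta> t) (left_empty N k m) \<le> emptying_prob m t (restriction m \<eta>)"
proof -
  obtain C where C: "\<And>n. g n \<le> C * real n" "0 < C" using g_linear_bound by blast
  interpret seg: jump_process "segment_moves N" jump_rate segment_move "zrp_configs N k" "C * real (Suc k)"
    by (rule segment_process[OF C])
  let ?X = "zrp_configs N k" and ?E = "left_empty N k m"
  let ?s = "\<lambda>\<xi>. zrp_semigroup g p N t (indicat_real {\<xi>}) \<eta>"
  have E: "?E \<subseteq> ?X" by (auto simp: left_empty_def)
  have fin: "finite ?X" by (rule finite_zrp_configs)
  have nn: "0 \<le> ?s \<xi>" for \<xi>
    unfolding zrp_semigroup_eq by (rule seg.semigroup_nonneg[OF _ \<eta> t]) simp
  have "emeasure (zrp_law g p N k \<eta> t) ?E = (\<Sum>\<xi>\<in>?E. ennreal (?s \<xi>))"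
    unfolding zrp_law_def by (rule emeasure_point_measure_finite[OF fin E])
  also have "\<dots> = ennreal (\<Sum>\<xi>\<in>?E. ?s \<xi>)" by (rule sum_ennreal) (rule nn)
  finally have "measure (zrp_law g p N k \<eta> t) ?E = (\<Sum>\<xi>\<in>?E. ?s \<xi>)"
    unfolding measure_def by (simp add: sum_nonneg nn)
  also have "\<dots> = gen_exp (segment_gen N) t (\<lambda>x. \<Sum>\<xi>\<in>?E. indicat_real {\<xi>} x) \<eta>"
    unfolding zrp_semigroup_eq by (rule seg.semigroup_sum[OF \<eta>, symmetric])
  also have "\<dots> = gen_exp (segment_gen N) t (\<lambda>\<eta>. empty_indicator (restriction m \<eta>)) \<eta>"
  proof (rule seg.semigroup_cong[OF _ \<eta>])
    fix \<xi> assume \<xi>: "\<xi> \<in> ?X"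
    have "(\<Sum>\<zeta>\<in>?E. indicat_real {\<zeta>} \<xi>) = (\<Sum>\<zeta>\<in>?E. if \<zeta> = \<xi> then 1 else 0)"
      by (intro sum.cong) auto
    also have "\<dots> = (if \<xi> \<in> ?E then 1 else 0)"
      using finite_subset[OF E fin] by simp
    finally show "(\<Sum>\<zeta>\<in>?E. indicat_real {\<zeta>} \<xi>) = empty_indicator (restriction m \<xi>)"
      using \<xi> by (simp add: empty_indicator_def left_empty_def)
  qed
  also have "\<dots> \<le> emptying_prob m t (restriction m \<eta>)"
    by (rule segment_le_emptying_prob[OF \<eta> m t])
  finally show ?thesis .
qed

lemma mixing_dist_ge:
  assumes \<eta>: "\<eta> \<in> zrp_configs N k" and "A \<subseteq> zrp_configs N k"
  shows "measure (zrp_equilibrium g p N k) A - measure (zrp_law g p N k \<eta> t) A \<le> mixing_dist g p N k t"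
proof -
  let ?M = "zrp_law g p N k \<eta> t" and ?\<pi> = "zrp_equilibrium g p N k"
  have sets: "sets ?M = Pow (zrp_configs N k)" by (simp add: zrp_law_def sets_point_measure)
  have "measure ?\<pi> A - measure ?M A \<le> \<bar>measure ?M A - measure ?\<pi> A\<bar>" by simp
  also have "\<dots> \<le> tv_dist ?M ?\<pi>"
    unfolding tv_dist_def sets
    by (rule cSUP_upper) (use assms finite_zrp_configs in auto)
  also have "\<dots> \<le> mixing_dist g p N k t"
    unfolding mixing_dist_def by (rule Max_ge) (use \<eta> finite_zrp_configs in auto)
  finally show ?thesis .
qed

text \<open>The distance to equilibrium is tested with \<open>left_empty N k m\<close>.\<close>

lemma mixing_time_ge:
  assumes \<eta>: "\<eta> \<in> zrp_configs N k" and m: "1 \<le> m" "m < N"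
    and C: "\<And>n. g n \<le> C * real n"
    and small: "\<And>t. 0 \<le> t \<Longrightarrow> t \<le> T \<Longrightarrow> emptying_prob m t (restriction m \<eta>) \<le> a"
    and ab: "a + real m * ((1 - p) / p) ^ (N - m) * (C * real k / g 1) < 1 - \<theta>"
  shows "ereal T \<le> mixing_time g p N k \<theta>"
  unfolding mixing_time_def
proof (rule INF_greatest)
  fix t assume t: "t \<in> {t. 0 \<le> t \<and> mixing_dist g p N k t \<le> \<theta>}"
  show "ereal T \<le> ereal t"
  proof (rule ccontr)
    assume "\<not> ereal T \<le> ereal t"
    then have tT: "0 \<le> t" "t \<le> T" using t by auto
    have "measure (zrp_equilibrium g p N k) (left_empty N k m) - measure (zrp_law g p N k \<eta> t) (left_empty N k m)
        \<le> mixing_dist g p N k t"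
      by (rule mixing_dist_ge[OF \<eta>]) (auto simp: left_empty_def)
    then show False
      using equilibrium_left_empty[OF C m(2), of k] zrp_law_left_empty[OF \<eta> m tT(1)] small[OF tT] ab t
      by auto
  qed
qed

end

section \<open>The macroscopic equilibrium time\<close>

context zero_range_rate
begin

lemma measure_source:
  assumes "0 \<le> \<alpha>" "A \<in> sets borel"
  shows "measure (scale_measure (ennreal \<alpha>) (return borel 0)) A = \<alpha> * indicat_real A (0::real)"
  using assms by (simp add: measure_def indicator_def enn2real_mult)

text \<open>Convexity puts the flux above its tangent at \<open>0\<close>, whose slope is \<open>g 1\<close>.\<close>

lemma flux_ge_linear:
  assumes convex: "strictly_convex_on {0..} (flux g)" and a: "0 \<le> a"
  shows "g 1 * a \<le> flux g a"
proof (rule ccontr)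
  assume "\<not> g 1 * a \<le> flux g a"
  then have less: "flux g a < g 1 * a" by simp
  then have a: "0 < a" using a flux_0 by (cases "a = 0") auto
  define c where "c = flux g a / a"
  have c: "c < g 1" using less a by (simp add: c_def pos_divide_less_eq)
  define c' where "c' = max c (g 1 / 2)"
  have c': "c \<le> c'" "c' < g 1" "0 < c'" using c g1_pos by (auto simp: c'_def)
  \<comment> \<open>Along the chord from \<open>0\<close> to \<open>a\<close> the density stays above \<open>\<phi> / c'\<close>, but the ratio tends to
    \<open>1 / g 1\<close>.\<close>
  have ev: "\<forall>\<^sub>F \<phi> in at_right 0. 1 / c' \<le> mean_density g \<phi> / \<phi>"
  proof -
    have "((\<lambda>\<phi>. mean_density g \<phi> / \<phi> * \<phi>) \<longlongrightarrow> 1 / g 1 * 0) (at_right 0)"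
      by (intro tendsto_mult mean_density_over_fugacity_tendsto tendsto_ident_at)
    then have "\<forall>\<^sub>F \<phi> in at_right 0. mean_density g \<phi> / \<phi> * \<phi> < a"
      using a by (intro order_tendstoD(2)[of _ 0]) auto
    moreover have "\<forall>\<^sub>F \<phi> in at_right 0. 0 < \<phi> \<and> \<phi> < g 1 / 2"
      using g1_pos unfolding eventually_at_right_field by (intro exI[of _ "g 1 / 2"]) auto
    ultimately show ?thesis
    proof eventually_elim
      case (elim \<phi>)
      define b where "b = mean_density g \<phi>"
      have dom: "\<phi> \<in> fugacities" using fugacities_mono[OF fugacity_above_0, of \<phi>] elim by simp
      have b: "0 < b" "b < a"
        using mean_density_strict_mono[OF zero_fugacity dom] mean_density_0 elim by (auto simp: b_def)
      have "flux g ((b / a) * a + (1 - b / a) * 0) < (b / a) * flux g a + (1 - b / a) * flux g 0"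
        by (rule convex[unfolded strictly_convex_on_def, THEN conjunct2, rule_format]) (use a b in auto)
      then have "\<phi> < b * c"
        using a flux_mean_density[OF dom] by (simp add: flux_0 b_def[symmetric] c_def)
      also have "\<dots> \<le> b * c'" using b c' by (intro mult_left_mono) auto
      finally show ?case using elim c' by (simp add: b_def[symmetric] divide_simps mult.commute)
    qed
  qed
  have "1 / c' \<le> 1 / g 1"
    by (rule tendsto_lowerbound[OF mean_density_over_fugacity_tendsto ev]) simp
  then show False using c' g1_pos by (simp add: divide_simps)
qed

text \<open>It suffices to test the infimum over \<open>y\<close> in the Hopf--Lax formula with \<open>y = 0\<close> for \<open>x \<le> 1\<close> and with
\<open>y = x\<close> for \<open>x > 1\<close>, since the Legendre transform is at most \<open>0\<close> on \<open>{..g 1}\<close>.\<close>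

lemma macro_solution_convex:
  assumes convex: "strictly_convex_on {0..} (flux g)" and \<alpha>: "0 \<le> \<alpha>"
  shows "macro_solution g \<alpha> (1 / g 1) x \<le> ereal (\<alpha> * indicat_real {1<..} x)"
proof -
  let ?\<mu> = "scale_measure (ennreal \<alpha>) (return borel (0::real))"
  have leg: "legendre_convex (flux g) s \<le> 0" if "s \<le> g 1" for s
    unfolding legendre_convex_def
  proof (rule SUP_least)
    fix a :: real assume a: "a \<in> {0..}"
    then have "a * s \<le> g 1 * a" using that by (simp add: mult.commute mult_left_mono)
    then show "ereal (a * s - flux g a) \<le> 0" using flux_ge_linear[OF convex, of a] a by simp
  qed
  define y where "y = (if x \<le> 1 then 0 else x)"
  have s: "(x - y) / (1 / g 1) \<le> g 1" using g1_pos by (auto simp: y_def mult_left_le_one_le)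
  have "macro_solution g \<alpha> (1 / g 1) x
     \<le> ereal (measure ?\<mu> {..<y}) + ereal (1 / g 1) * legendre_convex (flux g) ((x - y) / (1 / g 1))"
    using convex by (simp only: macro_solution_def hopf_lax_def if_True) (rule INF_lower, simp)
  also have "\<dots> \<le> ereal (measure ?\<mu> {..<y}) + ereal (1 / g 1) * 0"
    using leg[OF s] g1_pos by (intro add_left_mono ereal_mult_left_mono) auto
  also have "measure ?\<mu> {..<y} \<le> \<alpha> * indicat_real {1<..} x"
    by (subst measure_source[OF \<alpha>]) (use \<alpha> in \<open>auto simp: y_def indicator_def\<close>)
  finally show ?thesis by simp
qed

lemma macro_eq_time_le_convex:
  assumes convex: "strictly_convex_on {0..} (flux g)" and \<alpha>: "0 \<le> \<alpha>" and p: "1 / 2 < p"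
  shows "macro_eq_time g p \<alpha> \<le> ereal (1 / ((2 * p - 1) * g 1))"
proof -
  have "(INF t\<in>{t. 0 < t \<and> (\<forall>x. macro_solution g \<alpha> t x \<le> ereal (\<alpha> * indicat_real {1<..} x))}. ereal t) \<le> ereal (1 / g 1)"
    using macro_solution_convex[OF convex \<alpha>] g1_pos by (intro INF_lower) auto
  then have "macro_eq_time g p \<alpha> \<le> ereal (1 / (p - (1 - p))) * ereal (1 / g 1)"
    unfolding macro_eq_time_def using p by (intro ereal_mult_left_mono) auto
  also have "p - (1 - p) = 2 * p - 1" by simp
  finally show ?thesis by simp
qed

text \<open>The Legendre transform in the Hopf--Lax formula is bounded from below by its value at the single
density \<open>mean_density g \<phi>\<close>; that is enough to push the solution down to \<open>0\<close> on \<open>{..1}\<close>.\<close>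

lemma macro_solution_concave:
  assumes nconvex: "\<not> strictly_convex_on {0..} (flux g)" and \<alpha>: "0 \<le> \<alpha>" and t: "0 < t"
    and \<phi>: "\<phi> \<in> fugacities" and ge: "\<alpha> + mean_density g \<phi> \<le> t * \<phi>"
  shows "macro_solution g \<alpha> t x \<le> ereal (\<alpha> * indicat_real {1<..} x)"
proof -
  let ?\<mu> = "scale_measure (ennreal \<alpha>) (return borel (0::real))"
  have bound: "ereal c - ereal t * legendre_concave (flux g) s \<le> ereal (c - t * (a * s + flux g a))"
    if "0 \<le> a" for a s c
  proof -
    have "ereal (a * s + flux g a) \<le> legendre_concave (flux g) s"
      unfolding legendre_concave_def using that by (intro SUP_upper) auto
    then have "ereal t * ereal (a * s + flux g a) \<le> ereal t * legendre_concave (flux g) s"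
      using t by (intro ereal_mult_left_mono) auto
    then have "ereal c - ereal t * legendre_concave (flux g) s \<le> ereal c - ereal t * ereal (a * s + flux g a)"
      by (intro ereal_minus_mono) auto
    then show ?thesis by simp
  qed
  have "ereal (measure ?\<mu> {..y}) - ereal t * legendre_concave (flux g) (- ((x - y) / t))
      \<le> ereal (\<alpha> * indicat_real {1<..} x)" for y
  proof (cases "1 < x \<or> y < 0")
    case True
    have "ereal (measure ?\<mu> {..y}) - ereal t * legendre_concave (flux g) (- ((x - y) / t)) \<le> ereal (measure ?\<mu> {..y})"
      using bound[of 0 "measure ?\<mu> {..y}"] by (simp add: flux_0)
    also have "measure ?\<mu> {..y} \<le> \<alpha> * indicat_real {1<..} x"
      by (subst measure_source[OF \<alpha>]) (use True \<alpha> in \<open>auto simp: indicator_def\<close>)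
    finally show ?thesis by simp
  next
    case False
    define a where "a = mean_density g \<phi>"
    have a: "0 \<le> a" "flux g a = \<phi>"
      using mean_density_nonneg[OF \<phi>] flux_mean_density[OF \<phi>] by (auto simp: a_def)
    have "t * (a * (- ((x - y) / t)) + flux g a) = t * \<phi> - a * (x - y)"
      using t a by (simp add: field_simps)
    moreover have "a * (x - y) \<le> a * 1" using a False by (intro mult_left_mono) auto
    moreover have "measure ?\<mu> {..y} \<le> \<alpha>"
      by (subst measure_source[OF \<alpha>]) (use \<alpha> in \<open>auto simp: indicator_def\<close>)
    ultimately have "measure ?\<mu> {..y} - t * (a * (- ((x - y) / t)) + flux g a) \<le> 0"
      using ge by (simp add: a_def)
    then have "ereal (measure ?\<mu> {..y}) - ereal t * legendre_concave (flux g) (- ((x - y) / t)) \<le> ereal 0"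
      using bound[OF a(1), of "measure ?\<mu> {..y}" "- ((x - y) / t)"] by (meson ereal_less_eq(3) order_trans)
    then show ?thesis using \<alpha> by (auto simp: indicator_def intro: order_trans)
  qed
  then show ?thesis
    using nconvex by (simp only: macro_solution_def hopf_lax_def if_False) (rule SUP_least, simp)
qed

lemma macro_eq_time_le_concave:
  assumes nconvex: "\<not> strictly_convex_on {0..} (flux g)" and \<alpha>: "0 \<le> \<alpha>" and p: "1 / 2 < p"
    and X: "0 \<le> X"
    and before: "\<And>t. 0 < t \<Longrightarrow> (\<And>\<phi>. \<phi> \<in> fugacities \<Longrightarrow> t * \<phi> < \<alpha> + mean_density g \<phi>) \<Longrightarrow>
        ereal (t / (2 * p - 1)) \<le> X"
  shows "macro_eq_time g p \<alpha> \<le> X"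
proof (rule ccontr)
  let ?I = "INF t\<in>{t. 0 < t \<and> (\<forall>x. macro_solution g \<alpha> t x \<le> ereal (\<alpha> * indicat_real {1<..} x))}. ereal t"
  assume "\<not> macro_eq_time g p \<alpha> \<le> X"
  then have "X < macro_eq_time g p \<alpha>" by simp
  then obtain c where c: "X < ereal c" "ereal c < macro_eq_time g p \<alpha>" using ereal_dense2 by blast
  have "0 < ereal c" using X c(1) by (rule le_less_trans)
  then have c0: "0 < c" by simp
  define d where "d = 2 * p - 1"
  have d: "0 < d" "p - (1 - p) = d" using p by (auto simp: d_def)
  have lt: "ereal (d * c) < ?I"
  proof (rule ccontr)
    assume "\<not> ereal (d * c) < ?I"
    then have "ereal (1 / d) * ?I \<le> ereal (1 / d) * ereal (d * c)"
      using d by (intro ereal_mult_left_mono) auto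
    then show False using c(2) d unfolding macro_eq_time_def d(2) by simp
  qed
  have "d * c * \<phi> < \<alpha> + mean_density g \<phi>" if \<phi>: "\<phi> \<in> fugacities" for \<phi>
  proof (rule ccontr)
    assume "\<not> d * c * \<phi> < \<alpha> + mean_density g \<phi>"
    then have "\<And>x. macro_solution g \<alpha> (d * c) x \<le> ereal (\<alpha> * indicat_real {1<..} x)"
      using d c0 by (intro macro_solution_concave[OF nconvex \<alpha> _ \<phi>]) auto
    then have "?I \<le> ereal (d * c)" using d c0 by (intro INF_lower) auto
    then show False using lt by simp
  qed
  then have "ereal (d * c / (2 * p - 1)) \<le> X" using before[of "d * c"] d c0 by simp
  then show False using c(1) d by (simp add: d_def)
qed

end

section \<open>Asymptotics of the mixing time\<close>

context zero_range_process
begin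

text \<open>The equilibrium error is of order \<open>N\<^sup>2 * \<rho> ^ n\<close> with \<open>n = N - m N \<ge> \<delta> * N\<close>, hence of order
\<open>n\<^sup>2 * \<rho> ^ n\<close>.\<close>

lemma mixing_time_eventually_ge:
  fixes k m :: "nat \<Rightarrow> nat" and \<eta> :: "nat \<Rightarrow> nat \<Rightarrow> nat" and e :: "nat \<Rightarrow> real"
  assumes k: "(\<lambda>N. real (k N) / real N) \<longlonglongrightarrow> \<alpha>" and \<theta>: "\<theta> < 1" and \<delta>: "0 < \<delta>"
    and ev: "\<forall>\<^sub>F N in sequentially. 1 \<le> m N \<and> real (m N) \<le> (1 - \<delta>) * real N \<and> \<eta> N \<in> zrp_configs N (k N) \<and>
       (\<forall>t. 0 \<le> t \<longrightarrow> t \<le> \<tau> * real N \<longrightarrow> emptying_prob (m N) t (restriction (m N) (\<eta> N)) \<le> e N)"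
    and e: "e \<longlonglongrightarrow> 0"
  shows "\<forall>\<^sub>F N in sequentially. ereal (\<tau> * real N) \<le> mixing_time g p N (k N) \<theta>"
proof -
  obtain C where C: "\<And>n. g n \<le> C * real n" "0 < C" using g_linear_bound by blast
  define \<rho> where "\<rho> = (1 - p) / p"
  have \<rho>: "0 \<le> \<rho>" "\<rho> < 1" using p by (auto simp: \<rho>_def)
  define B where "B n = C * (\<bar>\<alpha>\<bar> + 1) / (\<delta>\<^sup>2 * g 1) * ((real n * sqrt \<rho> ^ n) * (real n * sqrt \<rho> ^ n))" for n :: nat
  have "sqrt \<rho> < 1" using \<rho> real_sqrt_less_iff[of \<rho> 1] by simp
  then have "(\<lambda>n. real n * sqrt \<rho> ^ n) \<longlonglongrightarrow> 0"
    using \<rho> by (intro powser_times_n_limit_0) auto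
  then have "(\<lambda>n. C * (\<bar>\<alpha>\<bar> + 1) / (\<delta>\<^sup>2 * g 1) * ((real n * sqrt \<rho> ^ n) * (real n * sqrt \<rho> ^ n)))
     \<longlonglongrightarrow> C * (\<bar>\<alpha>\<bar> + 1) / (\<delta>\<^sup>2 * g 1) * (0 * 0)" by (intro tendsto_intros)
  then have B: "B \<longlonglongrightarrow> 0" by (simp add: B_def[abs_def])
  have gap: "filterlim (\<lambda>N. N - m N) at_top sequentially"
  proof -
    have lin: "filterlim (\<lambda>N. \<delta> * real N) at_top sequentially"
      using \<delta> by (intro filterlim_tendsto_pos_mult_at_top[OF tendsto_const] filterlim_real_sequentially) auto
    have "filterlim (\<lambda>N. real (N - m N)) at_top sequentially"
    proof (rule filterlim_at_top_mono[OF lin])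
      show "\<forall>\<^sub>F N in sequentially. \<delta> * real N \<le> real (N - m N)"
        using ev by eventually_elim (auto simp: left_diff_distrib)
    qed
    then show ?thesis by (simp add: filterlim_sequentially_iff_filterlim_real)
  qed
  have lim: "(\<lambda>N. e N + B (N - m N)) \<longlonglongrightarrow> 0 + 0"
    by (intro tendsto_add e filterlim_compose[OF B gap])
  have "\<forall>\<^sub>F N in sequentially. e N + B (N - m N) < 1 - \<theta>"
    using order_tendstoD(2)[OF lim, of "1 - \<theta>"] \<theta> by simp
  moreover have "\<forall>\<^sub>F N in sequentially. real (k N) / real N < \<bar>\<alpha>\<bar> + 1"
    by (rule order_tendstoD(2)[OF k]) auto
  ultimately show ?thesis using ev eventually_gt_at_top[of 0]
  proof eventually_elim
    case (elim N)
    have gapN: "\<delta> * real N \<le> real (N - m N)" "m N < N"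
    proof -
      have "\<delta> * real N \<le> real N - real (m N)" using elim by (simp add: left_diff_distrib)
      moreover have "0 < \<delta> * real N" using \<delta> elim by simp
      ultimately show "\<delta> * real N \<le> real (N - m N)" "m N < N" by auto
    qed
    define n where "n = N - m N"
    have kN: "real (k N) \<le> (\<bar>\<alpha>\<bar> + 1) * real N" using elim by (simp add: pos_divide_less_eq)
    have "real (m N) * \<rho> ^ n * (C * real (k N) / g 1) \<le> real N * \<rho> ^ n * (C * ((\<bar>\<alpha>\<bar> + 1) * real N) / g 1)"
      using gapN kN \<rho> C g1_pos by (intro mult_mono divide_right_mono mult_left_mono mult_nonneg_nonneg divide_nonneg_pos) auto
    also have "\<dots> = C * (\<bar>\<alpha>\<bar> + 1) / g 1 * \<rho> ^ n * (real N)\<^sup>2" by (simp add: power2_eq_square)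
    also have "\<dots> \<le> C * (\<bar>\<alpha>\<bar> + 1) / g 1 * \<rho> ^ n * (real n / \<delta>)\<^sup>2"
      using gapN \<delta> \<rho> C g1_pos
      by (intro mult_left_mono power_mono) (auto simp: n_def pos_le_divide_eq mult.commute)
    also have "\<dots> = B n"
    proof -
      have "\<rho> ^ n = sqrt \<rho> ^ n * sqrt \<rho> ^ n" using \<rho> by (simp add: power_mult_distrib[symmetric])
      then show ?thesis by (simp add: B_def power2_eq_square mult_ac)
    qed
    finally have err: "real (m N) * \<rho> ^ n * (C * real (k N) / g 1) \<le> B n" .
    show ?case
    proof (rule mixing_time_ge[OF _ _ gapN(2) C(1), of "\<eta> N" "k N" "\<tau> * real N" "e N"])
      show "e N + real (m N) * ((1 - p) / p) ^ (N - m N) * (C * real (k N) / g 1) < 1 - \<theta>"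
        using err elim unfolding \<rho>_def n_def by linarith
    qed (use elim in auto)
  qed
qed

lemma liminf_mixing_time_ge:
  assumes "\<forall>\<^sub>F N in sequentially. ereal (\<tau> * real N) \<le> mixing_time g p N (k N) \<theta>"
  shows "ereal \<tau> \<le> liminf (\<lambda>N. mixing_time g p N (k N) \<theta> / ereal (real N))"
proof (rule Liminf_bounded)
  show "\<forall>\<^sub>F N in sequentially. ereal \<tau> \<le> mixing_time g p N (k N) \<theta> / ereal (real N)"
    using assms eventually_gt_at_top[of 0]
  proof eventually_elim
    case (elim N)
    have "ereal (\<tau> * real N) / ereal (real N) \<le> mixing_time g p N (k N) \<theta> / ereal (real N)"
      using elim by (intro ereal_divide_right_mono) auto
    then show ?case using elim by simp
  qed
qed

lemma mixing_time_nonneg: "0 \<le> mixing_time g p N k \<theta>"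
  unfolding mixing_time_def by (rule INF_greatest) (simp add: zero_ereal_def)

lemma liminf_mixing_time_nonneg: "0 \<le> liminf (\<lambda>N. mixing_time g p N (k N) \<theta> / ereal (real N))"
proof (rule Liminf_bounded)
  show "\<forall>\<^sub>F N in sequentially. 0 \<le> mixing_time g p N (k N) \<theta> / ereal (real N)"
    using eventually_gt_at_top[of 0] by eventually_elim (simp add: mixing_time_nonneg zero_le_divide_ereal)
qed

text \<open>One particle at site \<open>1\<close>, all others at site \<open>N\<close>.\<close>

lemma mixing_time_single_particle:
  assumes k: "(\<lambda>N. real (k N) / real N) \<longlonglongrightarrow> \<alpha>" and k1: "\<And>N. 1 \<le> k N" and \<theta>: "\<theta> < 1"
    and \<tau>: "0 < \<tau>" "\<tau> * ((2 * p - 1) * g 1) < 1"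
  shows "\<forall>\<^sub>F N in sequentially. ereal (\<tau> * real N) \<le> mixing_time g p N (k N) \<theta>"
proof -
  define d where "d = 2 * p - 1"
  have d: "0 < d" using p by (simp add: d_def)
  define \<delta> where "\<delta> = (1 - \<tau> * (d * g 1)) / 3"
  have "0 < \<tau> * (d * g 1)" using \<tau> d g1_pos by (intro mult_pos_pos)
  moreover have "\<tau> * (d * g 1) < 1" using \<tau> by (simp add: d_def)
  moreover have "0 < (1 - s) / 3 \<and> (1 - s) / 3 < 1" if "0 < s" "s < 1" for s :: real
    using that by simp
  ultimately have \<delta>: "0 < \<delta>" "\<delta> < 1" unfolding \<delta>_def by blast+
  define lam where "lam = min 1 (\<delta> / (g 1 * \<tau>))"
  have lam: "0 < lam" "lam \<le> 1" "g 1 * \<tau> * lam \<le> \<delta>"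
  proof -
    show "0 < lam" "lam \<le> 1" using \<delta> \<tau> g1_pos by (auto simp: lam_def)
    have "g 1 * \<tau> * lam \<le> g 1 * \<tau> * (\<delta> / (g 1 * \<tau>))"
      using \<tau> g1_pos by (intro mult_left_mono) (auto simp: lam_def)
    then show "g 1 * \<tau> * lam \<le> \<delta>" using \<tau> g1_pos by simp
  qed
  define m where "m N = nat \<lfloor>(1 - \<delta>) * real N\<rfloor>" for N
  define \<eta> where "\<eta> N = (\<lambda>i\<in>{1..N}. if i = 1 then 1 else if i = N then k N - 1 else 0)" for N :: nat
  define K where "K = exp lam + (exp lam - 1) / (1 - (1 - p) / p) * ((1 - p) / p)"
  have K: "0 \<le> K" using p lam unfolding K_def
    by (intro add_nonneg_nonneg mult_nonneg_nonneg divide_nonneg_nonneg) (auto simp: divide_simps)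
  define e where "e N = K * exp (- (lam * \<delta>)) ^ N" for N :: nat
  have "(\<lambda>N. exp (- (lam * \<delta>)) ^ N) \<longlonglongrightarrow> 0"
    using lam \<delta> by (intro LIMSEQ_realpow_zero) auto
  then have e: "e \<longlonglongrightarrow> 0"
    unfolding e_def[abs_def] using tendsto_mult_left[of _ 0 sequentially K] by simp
  show ?thesis
  proof (rule mixing_time_eventually_ge[OF k \<theta> \<delta>(1), of m \<eta> \<tau> e])
    show "\<forall>\<^sub>F N in sequentially. 1 \<le> m N \<and> real (m N) \<le> (1 - \<delta>) * real N \<and> \<eta> N \<in> zrp_configs N (k N) \<and>
       (\<forall>t. 0 \<le> t \<longrightarrow> t \<le> \<tau> * real N \<longrightarrow> emptying_prob (m N) t (restriction (m N) (\<eta> N)) \<le> e N)"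
      using eventually_ge_at_top[of 2] eventually_ge_at_top[of "nat \<lceil>1 / (1 - \<delta>)\<rceil>"]
    proof eventually_elim
      case (elim N)
      have "1 / (1 - \<delta>) \<le> real N" using elim by linarith
      then have one: "1 \<le> (1 - \<delta>) * real N" using \<delta> by (simp add: pos_divide_le_eq mult.commute)
      then have mN: "real (m N) \<le> (1 - \<delta>) * real N" "(1 - \<delta>) * real N \<le> real (m N) + 1" "1 \<le> m N"
        unfolding m_def by linarith+
      have "real (m N) < real N" using mN(1) \<delta> elim by (intro le_less_trans[OF mN(1)]) auto
      then have mlt: "m N < N" by simp
      have "(\<Sum>i\<in>{1..N}. \<eta> N i) = (\<Sum>i\<in>{1..N}. (if i = 1 then 1 else 0) + (if i = N then k N - 1 else 0))"
        using elim by (intro sum.cong) (auto simp: \<eta>_def)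
      also have "\<dots> = k N" using elim k1[of N] by (simp add: sum.distrib)
      finally have \<eta>N: "\<eta> N \<in> zrp_configs N (k N)" by (auto simp: zrp_configs_def \<eta>_def)
      have res: "restriction (m N) (\<eta> N) = add_particle 1 (\<lambda>_. 0)"
        using mN(3) mlt by (auto simp: restriction_def \<eta>_def add_particle_def fun_eq_iff)
      have "emptying_prob (m N) t (restriction (m N) (\<eta> N)) \<le> e N" if t: "0 \<le> t" "t \<le> \<tau> * real N" for t
      proof -
        have "tilt lam \<le> (d + lam) * lam"
          using tilt_le[of lam] lam by (simp add: d_def power2_eq_square algebra_simps)
        then have "g 1 * tilt lam * t \<le> g 1 * ((d + lam) * lam) * (\<tau> * real N)"
          using t lam d g1_pos tilt_nonneg[of lam] by (intro mult_mono mult_nonneg_nonneg) auto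
        also have "\<dots> = lam * real N * (\<tau> * (d * g 1) + g 1 * \<tau> * lam)" by (simp add: algebra_simps)
        also have "\<dots> \<le> lam * real N * (1 - 2 * \<delta>)"
          using lam by (intro mult_left_mono) (auto simp: \<delta>_def field_simps)
        finally have "g 1 * tilt lam * t - lam * (real (m N) + 1) \<le> lam * real N * (1 - 2 * \<delta>) - lam * ((1 - \<delta>) * real N)"
          using mult_left_mono[OF mN(2), of lam] lam by linarith
        also have "\<dots> = real N * (- (lam * \<delta>))" by (simp add: algebra_simps)
        finally have "exp (g 1 * tilt lam * t - lam * (real (m N) + 1)) \<le> exp (- (lam * \<delta>)) ^ N"
          by (simp add: exp_of_nat_mult[symmetric])
        from mult_right_mono[OF this K]
        show ?thesis
          using single_particle_emptying_prob[OF lam(1) mN(3) t(1)]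
          unfolding res K_def[symmetric] by (simp add: e_def mult.commute)
      qed
      then show ?case using mN \<eta>N by blast
    qed
  qed (rule e)
qed

end

context zero_range_process
begin

text \<open>As \<open>\<epsilon> \<rightarrow> 0\<close> the ratio of both sides of the fourth condition tends to \<open>(2 * p - 1) / (\<gamma> * v)\<close>.\<close>

lemma small_front_parameter:
  assumes "0 < lam" "0 < \<eta>" and C1: "(2 * p - 1) < \<gamma> * v"
  shows "\<forall>\<^sub>F \<epsilon> in at_right 0. 0 < \<epsilon> \<and> lam * (exp \<epsilon> - 1) \<le> 1 \<and> exp \<epsilon> \<le> 1 + \<eta> \<and>
     (2 * p - 1 + lam * (exp \<epsilon> - 1)) * (lam * (exp \<epsilon> - 1)) * exp (2 * \<epsilon> * real l) \<le> \<gamma> * (lam * v * \<epsilon>) \<and>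
     lam * v * \<epsilon> * \<Gamma> \<le> 1 / 2"
proof -
  let ?F = "at_right (0::real)"
  have id: "((\<lambda>\<epsilon>. \<epsilon>) \<longlongrightarrow> 0) ?F" by (rule tendsto_ident_at)
  have ex: "((\<lambda>\<epsilon>. exp \<epsilon>) \<longlongrightarrow> exp 0) ?F" by (rule tendsto_exp[OF id])
  have "((\<lambda>\<epsilon>::real. (exp \<epsilon> - 1) / \<epsilon>) \<longlongrightarrow> 1) (at 0)" by (rule lim_exp_minus_1)
  then have quot: "((\<lambda>\<epsilon>::real. (exp \<epsilon> - 1) / \<epsilon>) \<longlongrightarrow> 1) ?F" by (rule tendsto_mono[OF at_le[OF subset_UNIV]])
  have "((\<lambda>\<epsilon>. lam * (exp \<epsilon> - 1)) \<longlongrightarrow> lam * (exp 0 - 1)) ?F" by (intro tendsto_intros ex)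
  then have z0: "((\<lambda>\<epsilon>. lam * (exp \<epsilon> - 1)) \<longlongrightarrow> 0) ?F" by simp
  have "((\<lambda>\<epsilon>. (2 * p - 1 + lam * (exp \<epsilon> - 1)) * ((exp \<epsilon> - 1) / \<epsilon>) * exp (2 * \<epsilon> * real l))
     \<longlongrightarrow> (2 * p - 1 + 0) * 1 * exp (2 * 0 * real l)) ?F"
    by (intro tendsto_intros z0 quot)
  then have "((\<lambda>\<epsilon>. (2 * p - 1 + lam * (exp \<epsilon> - 1)) * ((exp \<epsilon> - 1) / \<epsilon>) * exp (2 * \<epsilon> * real l)) \<longlongrightarrow> 2 * p - 1) ?F"
    by simp
  then have 1: "\<forall>\<^sub>F \<epsilon> in ?F. (2 * p - 1 + lam * (exp \<epsilon> - 1)) * ((exp \<epsilon> - 1) / \<epsilon>) * exp (2 * \<epsilon> * real l) < \<gamma> * v"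
    by (rule order_tendstoD(2)) (rule C1)
  have 2: "\<forall>\<^sub>F \<epsilon> in ?F. lam * (exp \<epsilon> - 1) < 1" by (rule order_tendstoD(2)[OF z0]) simp
  have 3: "\<forall>\<^sub>F \<epsilon> in ?F. exp \<epsilon> < 1 + \<eta>" by (rule order_tendstoD(2)[OF ex]) (use assms in simp)
  have "((\<lambda>\<epsilon>. lam * v * \<epsilon> * \<Gamma>) \<longlongrightarrow> lam * v * 0 * \<Gamma>) ?F" by (intro tendsto_intros id)
  then have 4: "\<forall>\<^sub>F \<epsilon> in ?F. lam * v * \<epsilon> * \<Gamma> < 1 / 2" by (intro order_tendstoD(2)) auto
  have 5: "\<forall>\<^sub>F \<epsilon> in ?F. 0 < \<epsilon>" by (simp add: eventually_at_right_less)
  show ?thesis using 1 2 3 4 5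
  proof eventually_elim
    case (elim \<epsilon>)
    let ?X = "(2 * p - 1 + lam * (exp \<epsilon> - 1)) * ((exp \<epsilon> - 1) / \<epsilon>) * exp (2 * \<epsilon> * real l)"
    have "(2 * p - 1 + lam * (exp \<epsilon> - 1)) * (lam * (exp \<epsilon> - 1)) * exp (2 * \<epsilon> * real l) = ?X * (lam * \<epsilon>)"
      using elim by simp
    also have "\<dots> \<le> \<gamma> * v * (lam * \<epsilon>)"
      using elim assms by (intro mult_right_mono) auto
    finally show ?case using elim by (simp add: mult_ac)
  qed
qed

text \<open>Piles of \<open>n0\<close> particles on the sites \<open>1, \<dots>, j N\<close>, with \<open>j N \<le> \<delta> * N\<close>, carry almost all the mass; the
rest is at site \<open>N\<close>. The front starts at \<open>2 * \<delta> * N\<close> and stops at distance at least \<open>\<delta> * N\<close> to the left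
of \<open>m N\<close>. Parameters are fixed in the order \<open>\<delta>, v, \<gamma>, l, n0, lam, \<mu>\<close>: the bound on the squared
emptying probability is \<open>exp (N * (3 * \<tau> + ln G - 2 * lam * \<alpha> * \<kappa>))\<close>, where \<open>ln G\<close> comes from the weight
of a pile, and \<open>lam\<close> makes the exponent equal to \<open>- N\<close>; afterwards \<open>\<mu>\<close> makes the front sharp enough for
this \<open>lam\<close>.\<close>

lemma mixing_time_front:
  assumes k: "(\<lambda>N. real (k N) / real N) \<longlonglongrightarrow> \<alpha>" and \<theta>: "\<theta> < 1" and \<alpha>: "0 < \<alpha>"
    and le: "\<And>\<phi>. \<phi> \<in> fugacities \<Longrightarrow> t * \<phi> \<le> \<alpha> + mean_density g \<phi>"
    and \<tau>: "0 < \<tau>" "(2 * p - 1) * \<tau> < t"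
  shows "\<forall>\<^sub>F N in sequentially. ereal (\<tau> * real N) \<le> mixing_time g p N (k N) \<theta>"
proof -
  define d where "d = 2 * p - 1"
  have d: "0 < d" using p by (simp add: d_def)
  have "0 < d * \<tau>" using d \<tau> by simp
  then have t: "0 < t" using \<tau>(2) unfolding d_def by linarith
  define s where "s = d * \<tau> / t"
  have s: "0 < s" "s < 1" using \<open>0 < d * \<tau>\<close> \<tau>(2) t by (auto simp: s_def d_def)
  \<comment> \<open>The front travels the distance \<open>(1 - 6 * \<delta>) * N\<close> in the time \<open>\<tau> * N\<close>; this \<open>\<delta>\<close> keeps
    \<open>(2 * p - 1) / v\<close> below \<open>t\<close>.\<close>
  define \<delta> where "\<delta> = (1 - s) / 12"
  have \<delta>: "0 < \<delta>" "12 * \<delta> < 1" using s by (auto simp: \<delta>_def)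
  define v where "v = (1 - 6 * \<delta>) / \<tau>"
  have v: "0 < v" "v * \<tau> = 1 - 6 * \<delta>" using \<delta> \<tau> by (auto simp: v_def)
  have "d / v < t"
  proof -
    have "s < 1 - 6 * \<delta>" using s by (simp add: \<delta>_def field_simps)
    then have "d * \<tau> < t * (1 - 6 * \<delta>)" using t by (simp add: s_def pos_divide_less_eq mult.commute)
    then have "d * \<tau> < (t * v) * \<tau>" using v(2) by (simp add: mult.assoc)
    then have "d < t * v" using \<tau> by simp
    then show ?thesis using v by (simp add: pos_divide_less_eq)
  qed
  define \<gamma> where "\<gamma> = (d / v + t) / 2"
  have "0 < d / v" using d v by simp
  moreover have "0 < (a + t) / 2 \<and> (a + t) / 2 < t \<and> a < (a + t) / 2" if "0 < a" "a < t" for a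
    using that by simp
  ultimately have \<gamma>: "0 < \<gamma>" "\<gamma> < t" "d / v < \<gamma>" using \<open>d / v < t\<close> unfolding \<gamma>_def by blast+
  then have \<gamma>v: "2 * p - 1 < \<gamma> * v" using v by (simp add: pos_divide_less_eq d_def)
  obtain l \<rho> \<Gamma> where l: "0 < l" and \<rho>: "0 < \<rho>" "\<rho> < 1" and \<Gamma>: "0 \<le> \<Gamma>"
    and loc: "\<And>k R. (\<Sum>\<xi>\<in>configs l {..k}. weight l \<xi> * (R \<xi>)\<^sup>2 *
           (excess \<gamma> {1..l} \<xi> - \<rho> * \<alpha> * real l)) \<le> \<Gamma> * energy l {..k} R"
    using local_inequality[OF le \<alpha> \<gamma>(1,2)] by blast
  \<comment> \<open>Relative losses: of mass by rounding, at the foot of the front, and of its speed.\<close>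
  define \<eta>1 where "\<eta>1 = (1 - \<rho>) / 8"
  have \<eta>1: "0 < \<eta>1" "\<eta>1 < 1 / 8" using \<rho> by (auto simp: \<eta>1_def)
  define \<kappa> where "\<kappa> = (1 - \<rho>) / 2"
  have \<kappa>: "0 < \<kappa>" "\<rho> * (1 + \<eta>1) - (1 - \<eta>1)\<^sup>2 \<le> - \<kappa>"
  proof -
    show "0 < \<kappa>" using \<rho> by (simp add: \<kappa>_def)
    have "\<rho> * \<eta>1 \<le> \<eta>1" using \<rho> \<eta>1 by (simp add: mult_left_le_one_le)
    moreover have "1 - 2 * \<eta>1 \<le> (1 - \<eta>1)\<^sup>2" by (simp add: power2_diff)
    ultimately have "\<rho> * (1 + \<eta>1) - (1 - \<eta>1)\<^sup>2 \<le> \<rho> + \<eta>1 - (1 - 2 * \<eta>1)" by (simp add: distrib_left)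
    also have "\<dots> \<le> - \<kappa>" using \<rho> by (simp add: \<eta>1_def \<kappa>_def field_simps)
    finally show "\<rho> * (1 + \<eta>1) - (1 - \<eta>1)\<^sup>2 \<le> - \<kappa>" .
  qed
  obtain n0' :: nat where "\<alpha> / \<delta> < real n0'" using reals_Archimedean2 by blast
  define n0 where "n0 = Suc n0'"
  have n0: "0 < n0" "\<alpha> \<le> \<delta> * real n0"
    using \<open>\<alpha> / \<delta> < real n0'\<close> \<delta> by (auto simp: n0_def pos_divide_less_eq algebra_simps)
  define G where "G = max 1 (g_fact g n0)"
  have G: "1 \<le> G" "g_fact g n0 \<le> G" by (auto simp: G_def)
  define lam where "lam = (3 * \<tau> + ln G + 1) / (2 * \<alpha> * \<kappa>)"
  have "0 \<le> ln G" using G by simp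
  then have lam: "0 < lam" "2 * lam * \<alpha> * \<kappa> = 3 * \<tau> + ln G + 1"
    using \<tau> \<alpha> \<kappa> by (auto simp: lam_def intro!: divide_pos_pos)
  define b0 where "b0 = min \<eta>1 (1 / (2 * lam))"
  have b0: "0 < b0" "b0 \<le> \<eta>1" "2 * lam * b0 \<le> 1"
  proof -
    show "0 < b0" "b0 \<le> \<eta>1" using \<eta>1 lam by (auto simp: b0_def)
    have "2 * lam * b0 \<le> 2 * lam * (1 / (2 * lam))" using lam by (intro mult_left_mono) (auto simp: b0_def)
    then show "2 * lam * b0 \<le> 1" using lam by simp
  qed
  define \<mu> where "\<mu> = max 1 (- ln b0) / \<delta>"
  have \<mu>: "0 < \<mu>" "exp (- (\<mu> * \<delta>)) \<le> b0"
  proof -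
    show "0 < \<mu>" using \<delta> by (simp add: \<mu>_def)
    have "exp (- (\<mu> * \<delta>)) \<le> exp (ln b0)" using \<delta> by (simp add: \<mu>_def)
    then show "exp (- (\<mu> * \<delta>)) \<le> b0" using b0 by simp
  qed
  define j where "j N = nat \<lfloor>\<alpha> * (1 - \<eta>1 / 2) * real N / real n0\<rfloor>" for N
  define M where "M N = nat \<lfloor>(1 - 2 * \<delta>) * real N / real l\<rfloor>" for N
  define m where "m N = l * M N" for N
  define \<eta> where "\<eta> N = (\<lambda>i\<in>{1..N}. if i \<le> j N then n0 else if i = N then k N - j N * n0 else 0)" for N :: nat
  define e :: "nat \<Rightarrow> real" where "e N = exp (- (1 / 2)) ^ N" for N
  have e: "e \<longlonglongrightarrow> 0" unfolding e_def[abs_def] by (intro LIMSEQ_realpow_zero) auto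
  have eps: "filterlim (\<lambda>N. \<mu> / real N) (at_right 0) sequentially"
    unfolding filterlim_at_right_to_top[symmetric] filterlim_at
  proof (intro conjI)
    show "(\<lambda>N. \<mu> / real N) \<longlonglongrightarrow> 0" by (rule lim_const_over_n)
    show "\<forall>\<^sub>F N in sequentially. \<mu> / real N \<in> {0<..} \<and> \<mu> / real N \<noteq> 0"
      using eventually_gt_at_top[of 0] by eventually_elim (use \<mu> in auto)
  qed
  have params: "\<forall>\<^sub>F N in sequentially. 0 < \<mu> / real N \<and> lam * (exp (\<mu> / real N) - 1) \<le> 1 \<and> exp (\<mu> / real N) \<le> 1 + \<eta>1 \<and>
     (2 * p - 1 + lam * (exp (\<mu> / real N) - 1)) * (lam * (exp (\<mu> / real N) - 1)) * exp (2 * (\<mu> / real N) * real l)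
        \<le> \<gamma> * (lam * v * (\<mu> / real N)) \<and>
     lam * v * (\<mu> / real N) * \<Gamma> \<le> 1 / 2"
    using filterlim_iff[THEN iffD1, OF eps, rule_format, OF small_front_parameter[OF lam(1) \<eta>1(1) \<gamma>v]] .
  have large: "\<forall>\<^sub>F N in sequentially. c \<le> a * real N" if "0 < a" for a c :: real
    using eventually_ge_at_top[of "nat \<lceil>c / a\<rceil>"]
  proof eventually_elim
    case (elim N)
    then have "c / a \<le> real N" by linarith
    then show ?case using that by (simp add: pos_divide_le_eq mult.commute)
  qed
  have kN: "\<forall>\<^sub>F N in sequentially. \<alpha> * (1 - \<eta>1 / 2) < real (k N) / real N"
    by (rule order_tendstoD(1)[OF k]) (use \<alpha> \<eta>1 in simp)
  show ?thesis
  proof (rule mixing_time_eventually_ge[OF k \<theta> \<delta>(1), of m \<eta> \<tau> e])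
    have slack: "0 < \<alpha> * (\<eta>1 / 2)" "0 < 1 - 3 * \<delta>" using \<alpha> \<eta>1 \<delta> by auto
    show "\<forall>\<^sub>F N in sequentially. 1 \<le> m N \<and> real (m N) \<le> (1 - \<delta>) * real N \<and> \<eta> N \<in> zrp_configs N (k N) \<and>
       (\<forall>t. 0 \<le> t \<longrightarrow> t \<le> \<tau> * real N \<longrightarrow> emptying_prob (m N) t (restriction (m N) (\<eta> N)) \<le> e N)"
      using params kN large[OF slack(1), of "real n0"] large[OF \<delta>(1), of "real l"]
        large[OF slack(2), of 1] eventually_gt_at_top[of 0]
    proof eventually_elim
      case (elim N)
      have N0: "0 < real N" using elim by simp
      define \<epsilon> where "\<epsilon> = \<mu> / real N"
      have \<epsilon>: "0 < \<epsilon>" "lam * (exp \<epsilon> - 1) \<le> 1" "exp \<epsilon> \<le> 1 + \<eta>1"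
        "(2 * p - 1 + lam * (exp \<epsilon> - 1)) * (lam * (exp \<epsilon> - 1)) * exp (2 * \<epsilon> * real l) \<le> \<gamma> * (lam * v * \<epsilon>)"
        "lam * v * \<epsilon> * \<Gamma> \<le> 1 / 2" "\<epsilon> * real N = \<mu>"
        using elim N0 by (auto simp: \<epsilon>_def)

      have jf: "real (j N) \<le> \<alpha> * (1 - \<eta>1 / 2) * real N / real n0" "\<alpha> * (1 - \<eta>1 / 2) * real N / real n0 \<le> real (j N) + 1"
      proof -
        have "0 \<le> \<alpha> * (1 - \<eta>1 / 2) * real N / real n0" using \<alpha> \<eta>1 by simp
        then show "real (j N) \<le> \<alpha> * (1 - \<eta>1 / 2) * real N / real n0" "\<alpha> * (1 - \<eta>1 / 2) * real N / real n0 \<le> real (j N) + 1"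
          unfolding j_def by linarith+
      qed
      have mass_le: "real (j N) * real n0 \<le> \<alpha> * (1 - \<eta>1 / 2) * real N"
        using jf(1) n0 by (simp add: pos_le_divide_eq)
      have mass_ge: "\<alpha> * (1 - \<eta>1) * real N \<le> real (j N) * real n0"
      proof -
        have "\<alpha> * (1 - \<eta>1 / 2) * real N \<le> real (j N) * real n0 + real n0"
          using jf(2) n0 by (simp add: pos_divide_le_eq distrib_right)
        moreover have "\<alpha> * (1 - \<eta>1 / 2) * real N - \<alpha> * (\<eta>1 / 2) * real N = \<alpha> * (1 - \<eta>1) * real N"
          by (simp add: algebra_simps)
        ultimately show ?thesis using elim by linarith
      qed
      have "real (j N * n0) < real (k N)"
        using mass_le elim N0 by (simp add: pos_less_divide_eq)
      then have jk: "j N * n0 \<le> k N" by (simp only: of_nat_less_iff less_imp_le)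
      have j\<delta>: "real (j N) \<le> \<delta> * real N"
      proof -
        have "real (j N) * real n0 \<le> \<alpha> * 1 * real N"
          using mass_le \<alpha> \<eta>1 N0 by (intro order_trans[OF mass_le] mult_right_mono mult_left_mono) auto
        also have "\<dots> \<le> \<delta> * real n0 * real N" using n0 by (simp add: mult_right_mono)
        finally have "real (j N) * real n0 \<le> (\<delta> * real N) * real n0" by (simp add: mult_ac)
        then show ?thesis using n0 by simp
      qed

      have lN: "real l \<le> \<delta> * real N" and oneN: "1 \<le> (1 - 3 * \<delta>) * real N" by (fact elim)+
      have mN: "real (m N) \<le> (1 - 2 * \<delta>) * real N" "(1 - 3 * \<delta>) * real N \<le> real (m N)"
      proof -
        have "0 \<le> (1 - 2 * \<delta>) * real N / real l" using \<delta> by simp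
        then have "real (M N) \<le> (1 - 2 * \<delta>) * real N / real l" "(1 - 2 * \<delta>) * real N / real l \<le> real (M N) + 1"
          unfolding M_def by linarith+
        then have up: "real (M N) * real l \<le> (1 - 2 * \<delta>) * real N"
          and low: "(1 - 2 * \<delta>) * real N \<le> (real (M N) + 1) * real l"
          using l by (simp_all add: pos_le_divide_eq pos_divide_le_eq)
        have mM: "real (m N) = real (M N) * real l" by (simp add: m_def mult.commute)
        show "real (m N) \<le> (1 - 2 * \<delta>) * real N" unfolding mM by (rule up)
        have "(1 - 3 * \<delta>) * real N = (1 - 2 * \<delta>) * real N - \<delta> * real N"
          "(real (M N) + 1) * real l = real (M N) * real l + real l" by (simp_all add: algebra_simps)
        then show "(1 - 3 * \<delta>) * real N \<le> real (m N)" unfolding mM using low lN by linarith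
      qed
      have m1: "1 \<le> m N" using mN(2) oneN by linarith
      then have M0: "0 < M N" by (cases "M N") (auto simp: m_def)
      have \<delta>N: "0 < \<delta> * real N" using \<delta> N0 by simp
      have mlt: "m N < N" "real (m N) \<le> (1 - \<delta>) * real N"
      proof -
        have "(1 - 2 * \<delta>) * real N = (1 - \<delta>) * real N - \<delta> * real N"
          by (simp add: algebra_simps)
        then show b: "real (m N) \<le> (1 - \<delta>) * real N" using mN(1) \<delta>N by simp
        have "(1 - \<delta>) * real N < 1 * real N" using \<delta> N0 by (intro mult_strict_right_mono) auto
        then have "real (m N) < real N" using b by simp
        then show "m N < N" by simp
      qed
      have jm: "j N \<le> m N"
      proof -
        have "\<delta> * real N \<le> (1 - 3 * \<delta>) * real N" using \<delta> by (intro mult_right_mono) auto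
        then have "real (j N) \<le> real (m N)" using j\<delta> mN(2) by linarith
        then show ?thesis by simp
      qed
      have \<eta>N: "\<eta> N \<in> zrp_configs N (k N)"
      proof -
        have "(\<Sum>i\<in>{1..N}. \<eta> N i) = (\<Sum>i\<in>{1..N}. (if i \<in> {1..j N} then n0 else 0) + (if i = N then k N - j N * n0 else 0))"
          using jm mlt by (intro sum.cong) (auto simp: \<eta>_def)
        also have "\<dots> = (\<Sum>i\<in>{1..N}. if i \<in> {1..j N} then n0 else 0) + (k N - j N * n0)"
          using mlt by (simp add: sum.distrib)
        also have "(\<Sum>i\<in>{1..N}. if i \<in> {1..j N} then n0 else 0) = (\<Sum>i\<in>{1..j N}. n0)"
          using jm mlt by (intro sum.mono_neutral_cong_right) auto
        finally show ?thesis using jk by (auto simp: zrp_configs_def \<eta>_def)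
      qed
      define \<xi> where "\<xi> = restriction (m N) (\<eta> N)"
      have \<xi>: "\<xi> x = (if x \<in> {1..j N} then n0 else 0)" for x
        using jm mlt by (auto simp: \<xi>_def restriction_def \<eta>_def)
      have \<xi>k: "\<xi> \<in> configs (m N) {..k N}"
        unfolding \<xi>_def by (rule restriction_in_configs[OF \<eta>N]) (use mlt in simp)
      have weight: "(1 / G) ^ N \<le> weight (m N) \<xi>"
      proof -
        have "weight (m N) \<xi> = (\<Prod>x\<in>{1..j N}. 1 / g_fact g n0)"
          unfolding weight_def using jm by (intro prod.mono_neutral_cong_right) (auto simp: \<xi>)
        also have "\<dots> = (1 / g_fact g n0) ^ j N" by simp
        finally have w: "weight (m N) \<xi> = (1 / g_fact g n0) ^ j N" .
        have "(1 / G) ^ N \<le> (1 / G) ^ j N" using G jm mlt by (intro power_decreasing) auto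
        also have "\<dots> \<le> (1 / g_fact g n0) ^ j N"
          using G g_fact_pos[of n0] by (intro power_mono divide_left_mono) auto
        finally show ?thesis unfolding w .
      qed
      have mass: "\<alpha> * (1 - \<eta>1)\<^sup>2 * real N \<le> (\<Sum>x\<in>{1..m N}. real (\<xi> x) * front \<epsilon> (real x - 2 * \<delta> * real N))"
      proof -
        have "\<alpha> * (1 - \<eta>1)\<^sup>2 * real N = (\<alpha> * (1 - \<eta>1) * real N) * (1 - \<eta>1)"
          by (simp add: power2_eq_square mult_ac)
        also have "\<dots> \<le> (real (j N) * real n0) * (1 - \<eta>1)"
          using mass_ge \<eta>1 by (intro mult_right_mono) auto
        also have "\<dots> = (\<Sum>x\<in>{1..j N}. real n0 * (1 - \<eta>1))" by simp
        also have "\<dots> \<le> (\<Sum>x\<in>{1..j N}. real (\<xi> x) * front \<epsilon> (real x - 2 * \<delta> * real N))"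
        proof (rule sum_mono)
          fix x assume x: "x \<in> {1..j N}"
          then have "real x - 2 * \<delta> * real N \<le> - \<delta> * real N" using j\<delta> by auto
          then have "\<epsilon> * (real x - 2 * \<delta> * real N) \<le> \<epsilon> * (- \<delta> * real N)"
            using \<epsilon> by (intro mult_left_mono) auto
          also have "\<dots> = - (\<mu> * \<delta>)" using \<epsilon>(6) by (simp add: mult_ac)
          finally have "exp (\<epsilon> * (real x - 2 * \<delta> * real N)) \<le> exp (- (\<mu> * \<delta>))" by simp
          then have "1 - \<eta>1 \<le> front \<epsilon> (real x - 2 * \<delta> * real N)"
            using front_ge[of \<epsilon> "real x - 2 * \<delta> * real N"] \<mu>(2) b0(2) by linarith
          then show "real n0 * (1 - \<eta>1) \<le> real (\<xi> x) * front \<epsilon> (real x - 2 * \<delta> * real N)"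
            using x by (simp add: \<xi> mult_left_mono)
        qed
        also have "\<dots> \<le> (\<Sum>x\<in>{1..m N}. real (\<xi> x) * front \<epsilon> (real x - 2 * \<delta> * real N))"
          using jm by (intro sum_mono2) (auto intro!: mult_nonneg_nonneg front_nonneg)
        finally show ?thesis .
      qed
      define c where "c = lam * v * (\<rho> * \<alpha>) * exp \<epsilon>
         + p * exp (2 * (lam * front \<epsilon> (real (m N) - 2 * \<delta> * real N - v * (\<tau> * real N)))) / 2"
      have c: "c \<le> lam * v * (\<rho> * \<alpha>) * (1 + \<eta>1) + 3 / 2"
      proof -
        have "v * (\<tau> * real N) = (1 - 6 * \<delta>) * real N" using v(2) by (simp add: mult.assoc[symmetric])
        then have "\<delta> * real N \<le> real (m N) - 2 * \<delta> * real N - v * (\<tau> * real N)"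
          using mN(2) by (simp add: algebra_simps)
        then have "- \<epsilon> * (real (m N) - 2 * \<delta> * real N - v * (\<tau> * real N)) \<le> - \<epsilon> * (\<delta> * real N)"
          using \<epsilon> by simp
        also have "\<dots> = - (\<mu> * \<delta>)" using \<epsilon>(6) by (simp add: mult_ac)
        finally have "front \<epsilon> (real (m N) - 2 * \<delta> * real N - v * (\<tau> * real N)) \<le> exp (- (\<mu> * \<delta>))"
          using front_le_exp by (meson exp_le_cancel_iff order_trans)
        then have "front \<epsilon> (real (m N) - 2 * \<delta> * real N - v * (\<tau> * real N)) \<le> b0" using \<mu>(2) by linarith
        then have "2 * lam * front \<epsilon> (real (m N) - 2 * \<delta> * real N - v * (\<tau> * real N)) \<le> 2 * lam * b0"
          using lam by (intro mult_left_mono) auto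
        then have "2 * (lam * front \<epsilon> (real (m N) - 2 * \<delta> * real N - v * (\<tau> * real N))) \<le> 1"
          using b0(3) by simp
        then have "exp (2 * (lam * front \<epsilon> (real (m N) - 2 * \<delta> * real N - v * (\<tau> * real N)))) \<le> exp 1"
          by (simp only: exp_le_cancel_iff)
        then have "exp (2 * (lam * front \<epsilon> (real (m N) - 2 * \<delta> * real N - v * (\<tau> * real N)))) \<le> 3"
          using exp_le by linarith
        then have "p * exp (2 * (lam * front \<epsilon> (real (m N) - 2 * \<delta> * real N - v * (\<tau> * real N)))) \<le> 1 * 3"
          using p by (intro mult_mono) auto
        moreover have "lam * v * (\<rho> * \<alpha>) * exp \<epsilon> \<le> lam * v * (\<rho> * \<alpha>) * (1 + \<eta>1)"
          using \<epsilon>(3) lam v \<rho> \<alpha> by (intro mult_left_mono) auto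
        ultimately show ?thesis unfolding c_def by linarith
      qed
      have cT: "c * (\<tau> * real N) \<le> real N * (lam * \<alpha> * (\<rho> * (1 + \<eta>1)) + 3 / 2 * \<tau>)"
      proof -
        have "c * (\<tau> * real N) \<le> (lam * v * (\<rho> * \<alpha>) * (1 + \<eta>1) + 3 / 2) * (\<tau> * real N)"
          using c \<tau> N0 by (intro mult_right_mono) auto
        also have "\<dots> = real N * ((v * \<tau>) * (lam * \<alpha> * (\<rho> * (1 + \<eta>1))) + 3 / 2 * \<tau>)"
          by (simp add: algebra_simps)
        also have "\<dots> \<le> real N * (1 * (lam * \<alpha> * (\<rho> * (1 + \<eta>1))) + 3 / 2 * \<tau>)"
          unfolding v(2) using \<delta> lam \<alpha> \<rho> \<eta>1
          by (intro mult_left_mono add_right_mono mult_right_mono) auto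
        finally show ?thesis by simp
      qed
      have exponent: "2 * (c * (\<tau> * real N) - lam * (\<Sum>x\<in>{1..m N}. real (\<xi> x) * front \<epsilon> (real x - 2 * \<delta> * real N)))
          \<le> real N * (- ln G - 1)"
      proof -
        have gain: "lam * (\<alpha> * (1 - \<eta>1)\<^sup>2 * real N) \<le> lam * (\<Sum>x\<in>{1..m N}. real (\<xi> x) * front \<epsilon> (real x - 2 * \<delta> * real N))"
          using mass lam by (intro mult_left_mono) auto
        have "2 * (c * (\<tau> * real N) - lam * (\<Sum>x\<in>{1..m N}. real (\<xi> x) * front \<epsilon> (real x - 2 * \<delta> * real N)))
          \<le> 2 * (real N * (lam * \<alpha> * (\<rho> * (1 + \<eta>1)) + 3 / 2 * \<tau>) - lam * (\<alpha> * (1 - \<eta>1)\<^sup>2 * real N))"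
          by (intro mult_left_mono diff_mono cT gain) simp
        also have "\<dots> = real N * (2 * lam * \<alpha> * (\<rho> * (1 + \<eta>1) - (1 - \<eta>1)\<^sup>2) + 3 * \<tau>)"
          by (simp add: algebra_simps)
        also have "\<dots> \<le> real N * (2 * lam * \<alpha> * (- \<kappa>) + 3 * \<tau>)"
          using \<kappa>(2) lam \<alpha> by (intro mult_left_mono add_right_mono) auto
        also have "2 * lam * \<alpha> * (- \<kappa>) + 3 * \<tau> = - ln G - 1" using lam(2) by simp
        finally show ?thesis .
      qed
      have "emptying_prob (m N) t (restriction (m N) (\<eta> N)) \<le> e N" if t: "0 \<le> t" "t \<le> \<tau> * real N" for t
      proof -
        have "(emptying_prob (m N) t \<xi>)\<^sup>2 * weight (m N) \<xi>
          \<le> exp (2 * (c * (\<tau> * real N) - lam * (\<Sum>x\<in>{1..m N}. real (\<xi> x) * front \<epsilon> (real x - 2 * \<delta> * real N))))"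
          unfolding c_def m_def
          by (rule emptying_prob_bound[OF lam(1) \<epsilon>(1) v(1) _ \<gamma>(1) \<Gamma> l M0 \<epsilon>(2,4,5) loc t \<xi>k[unfolded m_def]])
             (use \<rho> \<alpha> in simp)
        also have "\<dots> \<le> exp (real N * (- ln G - 1))" using exponent by simp
        finally have "(emptying_prob (m N) t \<xi>)\<^sup>2 * (1 / G) ^ N \<le> exp (real N * (- ln G - 1))"
          using mult_left_mono[OF weight, of "(emptying_prob (m N) t \<xi>)\<^sup>2"] by simp
        moreover have "(1 / G) ^ N = exp (real N * (- ln G))"
          using G by (simp add: exp_of_nat_mult exp_minus inverse_eq_divide power_one_over)
        moreover have "exp (real N * (- ln G - 1)) = exp (- real N) * exp (real N * (- ln G))"
          by (simp add: exp_add[symmetric] algebra_simps)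
        ultimately have "(emptying_prob (m N) t \<xi>)\<^sup>2 \<le> exp (- real N)" by simp
        also have "\<dots> = (e N)\<^sup>2"
          unfolding e_def by (simp add: exp_of_nat_mult[symmetric] exp_double[symmetric])
        finally show ?thesis unfolding \<xi>_def
          by (rule power2_le_imp_le) (simp add: e_def)
      qed
      then show ?case using m1 mlt(2) \<eta>N by blast
    qed
  qed (rule e)
qed

end

section \<open>The lower bound\<close>

theorem theorem2:
  fixes g :: "nat \<Rightarrow> real" and p \<alpha> \<theta> :: real and k :: "nat \<Rightarrow> nat"
  assumes "rate_function g"
    and "filterlim (\<lambda>\<phi>. partition_fun g (real_of_ereal \<phi>)) at_top (at_left (phi_star g))"
    and "strictly_convex_on {0..} (flux g) \<or> strictly_concave_on {0..} (flux g)"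
    and "1 / 2 < p" and "p \<le> 1"
    and "0 \<le> \<alpha>"
    and "0 < \<theta>" and "\<theta> < 1"
    and "\<And>N. 1 \<le> k N"
    and "(\<lambda>N. real (k N) / real N) \<longlonglongrightarrow> \<alpha>"
  shows "macro_eq_time g p \<alpha> \<le> liminf (\<lambda>N. mixing_time g p N (k N) \<theta> / ereal (real N))"
proof -
  interpret zero_range_process g p
    by unfold_locales (use assms in auto)
  let ?X = "liminf (\<lambda>N. mixing_time g p N (k N) \<theta> / ereal (real N))"
  have X: "0 \<le> ?X" by (rule liminf_mixing_time_nonneg)
  have d: "0 < 2 * p - 1" using assms(4) by simp
  have below: "ereal a \<le> ?X" if "\<And>\<tau>. 0 < \<tau> \<Longrightarrow> \<tau> < a \<Longrightarrow>
      \<forall>\<^sub>F N in sequentially. ereal (\<tau> * real N) \<le> mixing_time g p N (k N) \<theta>" for a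
  proof (rule ccontr)
    assume "\<not> ereal a \<le> ?X"
    then have "?X < ereal a" by simp
    then obtain \<tau> where \<tau>: "?X < ereal \<tau>" "ereal \<tau> < ereal a" using ereal_dense2 by blast
    have "0 < ereal \<tau>" using X \<tau>(1) by (rule le_less_trans)
    then show False using liminf_mixing_time_ge[OF that[of \<tau>]] \<tau> by simp
  qed
  show ?thesis
  proof (cases "strictly_convex_on {0..} (flux g)")
    case True
    have "ereal (1 / ((2 * p - 1) * g 1)) \<le> ?X"
    proof (rule below)
      fix \<tau> :: real assume \<tau>: "0 < \<tau>" "\<tau> < 1 / ((2 * p - 1) * g 1)"
      have "0 < (2 * p - 1) * g 1" using d g1_pos by simp
      then have "\<tau> * ((2 * p - 1) * g 1) < 1" using \<tau>(2) by (simp only: pos_less_divide_eq)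
      then show "\<forall>\<^sub>F N in sequentially. ereal (\<tau> * real N) \<le> mixing_time g p N (k N) \<theta>"
        by (rule mixing_time_single_particle[OF assms(10,9,8) \<tau>(1)])
    qed
    then show ?thesis using macro_eq_time_le_convex[OF True assms(6,4)] by (rule order_trans[rotated])
  next
    case False
    show ?thesis
    proof (rule macro_eq_time_le_concave[OF False assms(6,4) X])
      fix t :: real assume t: "0 < t" and lt: "\<And>\<phi>. \<phi> \<in> fugacities \<Longrightarrow> t * \<phi> < \<alpha> + mean_density g \<phi>"
      have \<alpha>: "0 < \<alpha>" using lt[OF zero_fugacity] by (simp add: mean_density_0)
      show "ereal (t / (2 * p - 1)) \<le> ?X"
      proof (rule below)
        fix \<tau> :: real assume \<tau>: "0 < \<tau>" "\<tau> < t / (2 * p - 1)"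
        then have "(2 * p - 1) * \<tau> < t" using d by (simp add: pos_less_divide_eq mult.commute)
        then show "\<forall>\<^sub>F N in sequentially. ereal (\<tau> * real N) \<le> mixing_time g p N (k N) \<theta>"
          by (intro mixing_time_front[OF assms(10,8) \<alpha> less_imp_le[OF lt] \<tau>(1)])
      qed
    qed
  qed
qed

end
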